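(* Consider a periodic billiard trajectory on the regular pentagon table and the tree word $k_1k_2\cdots k_n$ associated to its direction. Let each $\sigma_i$ act on the set of nodes $\{A,B,C,D,E,F\}$ by the permutation $$\begin{aligned}\sigma_0&:\ A\to B,\ B\to C,\ C\to D,\ D\to E,\ E\to A,\ F\to F;\\ \sigma_1&:\ A\to B,\ B\to D,\ C\to F,\ D\to A,\ E\to C,\ F\to E;\\ \sigma_2&:\ A\to B,\ B\to F,\ C\to E,\ D\to C,\ E\to D,\ F\to A;\\ \sigma_3&:\ A\to B,\ B\to E,\ C\to A,\ D\to D,\ E\to F,\ F\to C.\end{aligned}$$ Start at $A$ and follow the arrows backwards according to the tree word read backwards, i.e. apply to $A$ first $\sigma_{k_n}^{-1}$, then $\sigma_{k_{n-1}}^{-1}$, ..., and finally $\sigma_{k_1}^{-1}$. If the resulting node is one of $A,B,C,D,E$, then the trajectory has order $5$ rotational symmetry; if it is $F$, then the trajectory does not have rotational symmetry.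
   Context: Let $\phi=(1+\sqrt5)/2$ and $\sigma_0=\begin{bmatrix}1&\phi\\0&1\end{bmatrix}$, $\sigma_1=\begin{bmatrix}\phi&\phi\\1&\phi\end{bmatrix}$, $\sigma_2=\begin{bmatrix}\phi&1\\\phi&\phi\end{bmatrix}$, $\sigma_3=\begin{bmatrix}1&0\\\phi&1\end{bmatrix}$, $P=\begin{bmatrix}1&\cos(\pi/5)\\0&\sin(\pi/5)\end{bmatrix}$. A tree word is a finite word $k_1k_2\cdots k_n$ in $\{0,1,2,3\}$ that is empty or has $k_1\ne0$; it corresponds to the vector $\mathbf v=\sigma_{k_n}\cdots\sigma_{k_1}\begin{bmatrix}1\\0\end{bmatrix}$ (digits are listed in order of application). Let $Q$ be a regular pentagon centered at the origin with a horizontal side and diagonals of length $1$; it is the billiard table. The double pentagon is the translation surface obtained from $Q$ and $-Q$ by gluing each side of $Q$ by translation to the parallel side of $-Q$. For every tree word, $P\mathbf v$ is a periodic direction of the double pentagon, in which there are exactly two cylinders (maximal families of parallel periodic trajectories), a short and a long one; up to symmetry all periodic directions arise this way. The necklace is the translation surface which is the unfolding of the billiard table $Q$: letting $D$ be the dihedral group of order 10 generated by the linear reflections $s_e$ in the directions of the sides $e$ of $Q$, it is made of the ten pentagons $gQ$, $g\in D$ (each equal to $Q$ or $-Q$), with side $ge$ of the copy $gQ$ glued by translation to the parallel side of the copy $gs_eQ$. It is a 5-fold cover of the double pentagon, and folding ($gx\mapsto x$) maps necklace trajectories to billiard trajectories in $Q$. The periodic billiard trajectories whose direction has tree word $k_1\cdots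 k_n$ are the foldings of the lifts to the necklace of the periodic trajectories (short or long) of the double pentagon in direction $P\mathbf v$. Order $5$ rotational symmetry means that the trajectory, as a subset of $Q$, is invariant under rotation by $2\pi/5$ about the center of $Q$. *)

theory Defs
  imports "HOL-Analysis.Analysis"
begin

section \<open>Tree words and their directions\<close>

definition golden :: real where
  "golden = (1 + sqrt 5) / 2"

definition sigma :: "nat \<Rightarrow> real^2^2" where
  "sigma k =
    [vector [vector [1, golden], vector [0, 1]],
     vector [vector [golden, golden], vector [1, golden]],
     vector [vector [golden, 1], vector [golden, golden]],
     vector [vector [1, 0], vector [golden, 1]]] ! k"

definition P_matrix :: "real^2^2" where
  "P_matrix = vector [vector [1, cos (pi/5)], vector [0, sin (pi/5)]]"

text \<open>The word \<open>k\<^sub>1 k\<^sub>2 \<dots> k\<^sub>n\<close> is the list \<open>[k\<^sub>1, k\<^sub>2, \<dots>, k\<^sub>n]\<close>.\<close>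

definition tree_word :: "nat list \<Rightarrow> bool" where
  "tree_word ks \<longleftrightarrow> set ks \<subseteq> {0, 1, 2, 3} \<and> (ks = [] \<or> hd ks \<noteq> 0)"

definition tree_vector :: "nat list \<Rightarrow> real^2" where
  "tree_vector ks = fold (\<lambda>k v. sigma k *v v) ks (vector [1, 0])"

definition tree_direction :: "nat list \<Rightarrow> complex" where
  "tree_direction ks =
    (let w = P_matrix *v tree_vector ks in Complex (w $ 1) (w $ 2))"


section \<open>The action on the six nodes\<close>

datatype node = NA | NB | NC | ND | NE | NF

definition node_perm :: "nat \<Rightarrow> node \<Rightarrow> node" where
  "node_perm k =
    [case_node NB NC ND NE NA NF,
     case_node NB ND NF NA NC NE,
     case_node NB NF NE NC ND NA,
     case_node NB NE NA ND NF NC] ! k"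

text \<open>\<open>foldr\<close> applies the inverse of the last letter \<open>k\<^sub>n\<close> first and that of \<open>k\<^sub>1\<close> last.\<close>

definition end_node :: "nat list \<Rightarrow> node" where
  "end_node ks = foldr (\<lambda>k. inv (node_perm k)) ks NA"


section \<open>Polygons glued along sides by translations\<close>

text \<open>
  The faces are labelled by type \<open>'l\<close>, and the face labelled \<open>l\<close> is placed in the plane as the
  polygon \<open>face M l\<close>, with vertices \<open>corners M l\<close>.  A pair \<open>(l, y)\<close> is the point \<open>y\<close> of that
  polygon; \<open>gluing\<close> need not be symmetric or transitive.
\<close>

record 'l glued_surface =
  faces :: "'l set"
  face :: "'l \<Rightarrow> complex set"
  corners :: "'l \<Rightarrow> complex set"
  gluing :: "(('l \<times> complex) \<times> ('l \<times> complex)) set"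

definition surface_pt :: "'l glued_surface \<Rightarrow> 'l \<times> complex \<Rightarrow> ('l \<times> complex) set" where
  "surface_pt M q = (gluing M \<union> (gluing M)\<inverse>)\<^sup>* `` {q}"

text \<open>
  The gluing of the side \<open>a\<close> of face \<open>l\<close> to the side \<open>b\<close> of face \<open>l'\<close> by translation.  It is empty
  unless \<open>b\<close> is a translate of \<open>a\<close>; as all sides below have the same length, this means
  unless \<open>b\<close> is parallel to \<open>a\<close>.
\<close>

definition glue_sides ::
    "'l \<Rightarrow> complex set \<Rightarrow> 'l \<Rightarrow> complex set \<Rightarrow> (('l \<times> complex) \<times> ('l \<times> complex)) set" where
  "glue_sides l a l' b = {((l, y), (l', y + c)) | y c. y \<in> a \<and> (\<lambda>z. z + c) ` a = b}"

text \<open>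
  A bi-infinite straight trajectory with constant velocity \<open>d\<close> that never meets a vertex.  The
  point at time \<open>t\<close> has a representative \<open>(l, y)\<close> through which the trajectory is followed
  shortly before \<open>t\<close> and a representative \<open>(l', y')\<close> through which it is followed shortly
  after \<open>t\<close>; they differ exactly when a side is crossed at time \<open>t\<close>.
\<close>

definition straight_trajectory ::
    "'l glued_surface \<Rightarrow> complex \<Rightarrow> (real \<Rightarrow> ('l \<times> complex) set) \<Rightarrow> bool" where
  "straight_trajectory M d \<gamma> \<longleftrightarrow>
    (\<forall>t.
      (\<forall>l\<in>faces M. \<forall>c\<in>corners M l. (l, c) \<notin> \<gamma> t) \<and>
      (\<exists>\<delta>>0. \<exists>l\<in>faces M. \<exists>l'\<in>faces M. \<exists>y y'.
        \<gamma> t = surface_pt M (l, y) \<and> \<gamma> t = surface_pt M (l', y') \<and>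
        (\<forall>s\<in>{0..\<delta>}.
          y - of_real s * d \<in> face M l \<and>
          \<gamma> (t - s) = surface_pt M (l, y - of_real s * d) \<and>
          y' + of_real s * d \<in> face M l' \<and>
          \<gamma> (t + s) = surface_pt M (l', y' + of_real s * d))))"

definition periodic_curve :: "(real \<Rightarrow> 'a) \<Rightarrow> bool" where
  "periodic_curve \<gamma> \<longleftrightarrow> (\<exists>T>0. \<forall>t. \<gamma> (t + T) = \<gamma> t)"


section \<open>The pentagon, the double pentagon and the necklace\<close>

text \<open>
  The table is given by its sequence of vertices, which has period 5.  Both positions of the
  horizontal side (below or above the center) are allowed.
\<close>

definition pentagon_table :: "(nat \<Rightarrow> complex) \<Rightarrow> bool" where
  "pentagon_table p \<longleftrightarrow>
    (\<exists>r \<theta>. r > 0 \<and> (\<forall>k. p k = of_real r * cis (\<theta> + 2 * pi * real k / 5))) \<and>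
    (\<exists>k. Im (p k) = Im (p (Suc k))) \<and>
    dist (p 0) (p 2) = 1"

definition vertices :: "(nat \<Rightarrow> complex) \<Rightarrow> complex set" where
  "vertices p = p ` {..<5}"

definition table :: "(nat \<Rightarrow> complex) \<Rightarrow> complex set" where
  "table p = convex hull (vertices p)"

definition side :: "(nat \<Rightarrow> complex) \<Rightarrow> nat \<Rightarrow> complex set" where
  "side p i = closed_segment (p i) (p (Suc i))"

text \<open>The faces of the double pentagon are labelled by the sets \<open>Q\<close> and \<open>-Q\<close> themselves.\<close>

definition double_pentagon :: "(nat \<Rightarrow> complex) \<Rightarrow> complex set glued_surface" where
  "double_pentagon p = \<lparr>
    faces = {table p, uminus ` table p},
    face = (\<lambda>A. A),
    corners = (\<lambda>A. if A = table p then vertices p else uminus ` vertices p),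
    gluing = (\<Union>i<5. \<Union>j<5.
      glue_sides (table p) (side p i) (uminus ` table p) (uminus ` side p j)) \<rparr>"

text \<open>The linear reflection whose axis is the line through the origin parallel to side \<open>i\<close>.\<close>

definition side_reflection :: "(nat \<Rightarrow> complex) \<Rightarrow> nat \<Rightarrow> complex \<Rightarrow> complex" where
  "side_reflection p i z = (let u = p (Suc i) - p i in (u / cnj u) * cnj z)"

text \<open>Reflections are involutions, so products of the generators already form a group.\<close>

inductive_set dihedral :: "(nat \<Rightarrow> complex) \<Rightarrow> (complex \<Rightarrow> complex) set" for p where
  one: "id \<in> dihedral p"
| mult: "g \<in> dihedral p \<Longrightarrow> i < 5 \<Longrightarrow> g \<circ> side_reflection p i \<in> dihedral p"

definition necklace :: "(nat \<Rightarrow> complex) \<Rightarrow> (complex \<Rightarrow> complex) glued_surface" where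
  "necklace p = \<lparr>
    faces = dihedral p,
    face = (\<lambda>g. g ` table p),
    corners = (\<lambda>g. g ` vertices p),
    gluing = (\<Union>g\<in>dihedral p. \<Union>i<5. \<Union>j<5.
      glue_sides g (g ` side p i)
        (g \<circ> side_reflection p i) ((g \<circ> side_reflection p i) ` side p j)) \<rparr>"

text \<open>
  The covering sends the point \<open>y\<close> of the copy \<open>gQ\<close> to the point \<open>y\<close> of whichever of
  \<open>Q\<close>, \<open>-Q\<close> equals \<open>gQ\<close>.
\<close>

definition is_lift ::
    "(nat \<Rightarrow> complex) \<Rightarrow> (real \<Rightarrow> ((complex \<Rightarrow> complex) \<times> complex) set) \<Rightarrow>
     (real \<Rightarrow> (complex set \<times> complex) set) \<Rightarrow> bool" where
  "is_lift p \<eta> \<gamma> \<longleftrightarrow> (\<forall>t. \<forall>(g, y) \<in> \<eta> t. (g ` table p, y) \<in> \<gamma> t)"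

text \<open>
  The folding \<open>gx \<mapsto> x\<close>.  It is well defined since the glued points of \<open>gQ\<close> and \<open>g s\<^sub>e Q\<close> are
  \<open>gx\<close> and \<open>g s\<^sub>e x\<close> with the same \<open>x\<close>.
\<close>

definition folding_map :: "((complex \<Rightarrow> complex) \<times> complex) set \<Rightarrow> complex" where
  "folding_map C = (THE x. \<exists>g. (g, g x) \<in> C)"

definition periodic_billiard_trajectory ::
    "(nat \<Rightarrow> complex) \<Rightarrow> nat list \<Rightarrow> (real \<Rightarrow> complex) \<Rightarrow> bool" where
  "periodic_billiard_trajectory p ks \<beta> \<longleftrightarrow>
    (\<exists>\<gamma> \<eta>.
      straight_trajectory (double_pentagon p) (tree_direction ks) \<gamma> \<and>
      periodic_curve \<gamma> \<and>
      straight_trajectory (necklace p) (tree_direction ks) \<eta> \<and>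
      is_lift p \<eta> \<gamma> \<and>
      \<beta> = folding_map \<circ> \<eta>)"


section \<open>Rotational symmetry about the center\<close>

definition rotation_invariant :: "real \<Rightarrow> complex set \<Rightarrow> bool" where
  "rotation_invariant \<theta> S \<longleftrightarrow> (\<lambda>z. cis \<theta> * z) ` S = S"

definition order5_symmetric :: "complex set \<Rightarrow> bool" where
  "order5_symmetric S \<longleftrightarrow> rotation_invariant (2 * pi / 5) S"

definition rotationally_symmetric :: "complex set \<Rightarrow> bool" where
  "rotationally_symmetric S \<longleftrightarrow> (\<exists>\<theta>. cis \<theta> \<noteq> 1 \<and> rotation_invariant \<theta> S)"

end

theory Submission
  imports Defs
begin

text \<open>
  Let \<open>\<zeta> = e\<^bsup>2\<pi>i/5\<^esup>\<close>. The periods of the double pentagon lie in \<open>\<int>[\<zeta>]\<close>, and the necklace is the cyclic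
  cover whose holonomy is the reduction of the period modulo \<open>1 - \<zeta>\<close>, since \<open>\<int>[\<zeta>]/(1 - \<zeta>) = \<int>/5\<close>.
  The rotation by \<open>\<pi>/5\<close> and the horizontal multi-twist are affine automorphisms of the double pentagon
  and generate all \<open>\<sigma>\<^sub>k\<close>. Hence every trajectory in the direction \<open>v\<^sub>1 + v\<^sub>2 e\<^bsup>\<pi>i/5\<^esup>\<close> of a tree vector
  has as period this vector or its multiple by the unit \<open>\<phi>\<close>, and its holonomy vanishes if and only if
  \<open>v\<^sub>1 \<equiv> v\<^sub>2\<close> modulo \<open>\<surd>5\<close>. Pulling this linear condition back through the word gives the automaton on
  the six points of the dual projective line over \<open>\<int>/5\<close>.

  If the holonomy is nonzero, the billiard path is rotated after one period by a nontrivial multiple of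
  \<open>2\<pi>/5\<close>. If it is zero, the lift is closed. A rotation preserving the billiard path would
  carry its lift to itself, either forwards, which contradicts the vanishing of the holonomy, or backwards,
  in which case the path would pass through the center with both velocities \<open>w\<close> and \<open>-w\<close> at once.
\<close>

text \<open>Two obstacles shape the proof. Trajectories are curves of gluing classes, so
  automorphisms must be built on classes. The rotation permutes the faces, but the multi-twist cuts
  through them; it is defined on the developed strips of the two horizontal cylinders, as a twist of
  each that is the identity on the boundary. The twists form one affine map because both cylinders
  have circumference divided by height equal to phi / sin(pi/5). Closing times are found in the
  horizontal direction and transported by sigma_k = T R^k, with T the multi-twist and R the
  rotation. The other obstacle: symmetry concerns the image, a set in which the path may cross
  itself, while holonomy concerns the parametrized lift. The germs of segments inside the image
  recover the velocities, by compactness of a period. Their sum at a point of the path is 0 inside Q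
  and a nonzero inward normal on a side, so a rotation of the image permutes normals of sides; this
  forces a multiple of 2 pi / 5. In the case of zero holonomy the return times are arbitrary; that
  they lie in Z[phi] is due to the unimodularity of the sigma_k.\<close>

section \<open>The golden ratio\<close>

lemma golden_sq: "golden\<^sup>2 = golden + 1"
  by (simp add: golden_def power2_eq_square field_simps)

lemma golden_gt_1: "1 < golden"
  by (simp add: golden_def)

lemma golden_mult_minus_1: "golden * (golden - 1) = 1"
  using golden_sq by (simp add: algebra_simps power2_eq_square)

text \<open>Uniqueness of the coordinates in Z[phi], and with it the existence of
  \<open>gold_res\<close>, rests on this. For phi = m/n in lowest terms, phi^2 = phi + 1 gives n dvd
  m^2, hence n = 1, and m (m - 1) = 1 has no solution.\<close>

lemma golden_irrational: "golden \<notin> \<rat>"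
proof
  assume "golden \<in> \<rat>"
  then obtain m n :: nat where n: "n \<noteq> 0" and mn: "\<bar>golden\<bar> = real m / real n" and cop: "coprime m n"
    by (rule Rats_abs_nat_div_natE)
  have m: "real m = golden * real n" using mn n golden_gt_1 by (simp add: field_simps)
  have "real (m * m) = golden\<^sup>2 * real n * real n" by (simp add: m power2_eq_square)
  also have "\<dots> = real (m * n + n * n)" by (simp add: golden_sq m algebra_simps)
  finally have eq: "m * m = m * n + n * n" by (simp only: of_nat_eq_iff)
  then have "m * m = n * (m + n)" by (simp add: algebra_simps)
  then have "n dvd m * m" by (metis dvd_triv_left)
  then have "n dvd m" using cop by (simp add: coprime_commute coprime_dvd_mult_left_iff)
  then have "n = 1" using coprime_common_divisor_nat[OF cop, of n] by simp
  then have "m * m = m + 1" using eq by simp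
  then have "m * (m - 1) = 1" by (simp add: diff_mult_distrib2)
  then show False by auto
qed

text \<open>The angles 2 pi/5 and 3 pi/5 add up to pi, so their cosines are opposite. In terms of c
  this is a cubic with the factors c + 1 and 4 c^2 - 2 c - 1, and its only positive root is
  phi/2.\<close>

lemma cos_pi_5: "cos (pi/5) = golden / 2"
proof -
  define c where "c = cos (pi/5)"
  have c0: "c > 0" unfolding c_def by (rule cos_gt_zero_pi) (use pi_gt_zero in linarith)+
  have "cos (2 * (pi/5)) = - cos (3 * (pi/5))"
    using cos_pi_minus[of "3 * (pi/5)"] by (simp add: field_simps)
  then have "2 * c\<^sup>2 - 1 = - (4 * c^3 - 3 * c)"
    unfolding cos_double_cos cos_treble_cos c_def by simp
  then have "(c + 1) * (4 * c\<^sup>2 - 2 * c - 1) = 0"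
    by (simp add: algebra_simps power2_eq_square power3_eq_cube)
  then have "4 * c\<^sup>2 - 2 * c - 1 = 0" using c0 by simp
  then have "(2 * c - golden) * (2 * c + golden - 1) = 0"
    using golden_mult_minus_1 by (simp add: algebra_simps power2_eq_square)
  moreover have "2 * c + golden - 1 > 0" using c0 golden_gt_1 by simp
  ultimately show ?thesis by (simp add: c_def)
qed


section \<open>The ring Z[phi] and its reduction modulo sqrt 5\<close>

definition gold_ints :: "real set" where
  "gold_ints = {of_int a + of_int b * golden | a b. True}"

lemma gold_ints_cases:
  assumes "x \<in> gold_ints"
  obtains a b where "x = of_int a + of_int b * golden"
  using assms unfolding gold_ints_def by blast

lemma gold_intsI: "of_int a + of_int b * golden \<in> gold_ints"
  unfolding gold_ints_def by blast

lemma gold_ints_of_int [simp]: "of_int a \<in> gold_ints"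
  using gold_intsI[of a 0] by simp

lemma gold_ints_0 [simp]: "0 \<in> gold_ints" and gold_ints_1 [simp]: "1 \<in> gold_ints"
  using gold_ints_of_int[of 0] gold_ints_of_int[of 1] by simp_all

lemma gold_ints_golden [simp]: "golden \<in> gold_ints"
  using gold_intsI[of 0 1] by simp

lemma gold_ints_add:
  assumes "x \<in> gold_ints" "y \<in> gold_ints" shows "x + y \<in> gold_ints"
proof -
  obtain a b c d where "x = of_int a + of_int b * golden" "y = of_int c + of_int d * golden"
    using assms by (metis gold_ints_cases)
  then have "x + y = of_int (a + c) + of_int (b + d) * golden" by (simp add: algebra_simps)
  then show ?thesis by (metis gold_intsI)
qed

lemma golden_mult_repr:
  "(of_int a + of_int b * golden) * (of_int c + of_int d * golden) =
    of_int (a * c + b * d) + of_int (a * d + b * c + b * d) * golden"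
proof -
  have "(of_int a + of_int b * golden) * (of_int c + of_int d * golden) =
    of_int a * of_int c + (of_int a * of_int d + of_int b * of_int c) * golden
      + of_int b * of_int d * golden\<^sup>2"
    by (simp add: algebra_simps power2_eq_square)
  then show ?thesis unfolding golden_sq by (simp add: algebra_simps)
qed

lemma gold_ints_mult:
  assumes "x \<in> gold_ints" "y \<in> gold_ints" shows "x * y \<in> gold_ints"
  using assms by (metis gold_ints_cases golden_mult_repr gold_intsI)

lemma gold_ints_uminus: "x \<in> gold_ints \<Longrightarrow> - x \<in> gold_ints"
  using gold_ints_mult[of "-1" x] gold_ints_of_int[of "-1"] by simp

lemma gold_ints_diff: "x \<in> gold_ints \<Longrightarrow> y \<in> gold_ints \<Longrightarrow> x - y \<in> gold_ints"
  using gold_ints_add[of x "- y"] gold_ints_uminus[of y] by simp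

lemma golden_repr_unique:
  assumes "of_int a + of_int b * golden = of_int c + of_int d * golden"
  shows "a = c \<and> b = d"
proof -
  have *: "of_int (b - d) * golden = of_int (c - a)" using assms by (simp add: algebra_simps)
  have "b = d"
  proof (rule ccontr)
    assume "b \<noteq> d"
    then have "golden = of_int (c - a) / of_int (b - d)" using * by (simp add: field_simps)
    also have "\<dots> \<in> \<rat>" by (intro Rats_divide Rats_of_int)
    finally show False using golden_irrational by blast
  qed
  then show ?thesis using assms by simp
qed

text \<open>
  Reduction of \<open>\<int>[\<phi>]\<close> modulo the prime \<open>\<surd>5 = 2\<phi> - 1\<close>, with values taken modulo 5; it sends \<open>\<phi>\<close> to
  \<open>1/2 = 3\<close>.
\<close>

definition gold_res :: "real \<Rightarrow> int" where
  "gold_res x = (THE n. \<exists>a b. x = of_int a + of_int b * golden \<and> n = a + 3 * b)"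

lemma gold_res_repr [simp]: "gold_res (of_int a + of_int b * golden) = a + 3 * b"
  unfolding gold_res_def by (rule the_equality) (use golden_repr_unique in blast)+

lemma gold_res_of_int [simp]: "gold_res (of_int a) = a"
  using gold_res_repr[of a 0] by simp

lemma gold_res_0 [simp]: "gold_res 0 = 0" and gold_res_1 [simp]: "gold_res 1 = 1"
  using gold_res_of_int[of 0] gold_res_of_int[of 1] by simp_all

lemma gold_res_golden [simp]: "gold_res golden = 3"
  using gold_res_repr[of 0 1] by simp

lemma gold_res_add:
  assumes "x \<in> gold_ints" "y \<in> gold_ints" shows "gold_res (x + y) = gold_res x + gold_res y"
proof -
  obtain a b c d where xy: "x = of_int a + of_int b * golden" "y = of_int c + of_int d * golden"
    using assms by (metis gold_ints_cases)
  then have "x + y = of_int (a + c) + of_int (b + d) * golden" by (simp add: algebra_simps)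
  then have "gold_res (x + y) = (a + c) + 3 * (b + d)" by (simp only: gold_res_repr)
  then show ?thesis unfolding xy gold_res_repr by simp
qed

lemma gold_res_uminus:
  assumes "x \<in> gold_ints" shows "gold_res (- x) = - gold_res x"
  using gold_res_add[OF assms gold_ints_uminus[OF assms]] by simp

lemma gold_res_diff:
  assumes "x \<in> gold_ints" "y \<in> gold_ints" shows "gold_res (x - y) = gold_res x - gold_res y"
  using gold_res_add[OF assms(1) gold_ints_uminus[OF assms(2)]] gold_res_uminus[OF assms(2)] by simp

text \<open>The values are integers, not classes, so products agree only modulo 5. The root 3 of X^2
  - X - 1 modulo 5 has 3 + 1 - 3^2 = -5, and this error occurs with the coefficient b d.\<close>

lemma gold_res_mult:
  assumes "x \<in> gold_ints" "y \<in> gold_ints"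
  shows "5 dvd gold_res (x * y) - gold_res x * gold_res y"
proof -
  obtain a b c d where xy: "x = of_int a + of_int b * golden" "y = of_int c + of_int d * golden"
    using assms by (metis gold_ints_cases)
  have "gold_res (x * y) - gold_res x * gold_res y = 5 * (- b * d)"
    unfolding xy golden_mult_repr gold_res_repr by (simp add: algebra_simps)
  then show ?thesis by simp
qed

lemma gold_res_golden_mult:
  assumes "x \<in> gold_ints" shows "5 dvd gold_res (golden * x) - 3 * gold_res x"
  using gold_res_mult[OF gold_ints_golden assms] by simp

section \<open>Tree vectors modulo \<open>\<surd>5\<close>\<close>

lemma sigma_mult:
  "sigma 0 *v u = vector [u $ 1 + golden * u $ 2, u $ 2]"
  "sigma (Suc 0) *v u = vector [golden * u $ 1 + golden * u $ 2, u $ 1 + golden * u $ 2]"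
  "sigma 2 *v u = vector [golden * u $ 1 + u $ 2, golden * u $ 1 + golden * u $ 2]"
  "sigma 3 *v u = vector [u $ 1, golden * u $ 1 + u $ 2]"
  by (simp_all add: sigma_def matrix_vector_mult_def vec_eq_iff forall_2 sum_2 numeral_3_eq_3 numeral_2_eq_2)

text \<open>
  The nodes are the points of the dual projective line over \<open>\<int>[\<phi>]/(\<surd>5) = \<int>/5\<close>: each node is a linear
  functional up to scaling, and \<open>\<sigma>\<^sub>k\<^sup>-\<^sup>1\<close> acts on nodes as precomposition with \<open>\<sigma>\<^sub>k\<close>.
\<close>

primrec node_form :: "node \<Rightarrow> int \<Rightarrow> int \<Rightarrow> int" where
  "node_form NA x y = x + 4 * y"
| "node_form NB x y = x + y"
| "node_form NC x y = x + 3 * y"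
| "node_form ND x y = x"
| "node_form NE x y = x + 2 * y"
| "node_form NF x y = y"

definition gold_vec :: "real^2 \<Rightarrow> bool" where
  "gold_vec u \<longleftrightarrow> u $ 1 \<in> gold_ints \<and> u $ 2 \<in> gold_ints"

definition node_kills :: "node \<Rightarrow> real^2 \<Rightarrow> bool" where
  "node_kills N u \<longleftrightarrow> 5 dvd node_form N (gold_res (u $ 1)) (gold_res (u $ 2))"

lemma sigma_gold_vec:
  assumes "k \<in> {0, 1, 2, 3}" "gold_vec u" shows "gold_vec (sigma k *v u)"
  using assms by (auto simp: gold_vec_def sigma_mult gold_ints_add gold_ints_mult)

text \<open>A node is a functional only up to a scalar, so two forms are compared as b = c a modulo
  5 with a unit c; e is the explicit quotient by 5.\<close>

lemma dvd5_iff: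
  fixes a b c e :: int
  assumes "b = c * a + 5 * e" "c \<in> {1, 2, 3, 4}"
  shows "5 dvd b \<longleftrightarrow> 5 dvd a"
proof -
  have "5 dvd b \<longleftrightarrow> 5 dvd c * a" unfolding assms(1) by (simp add: dvd_add_left_iff)
  also have "\<dots> \<longleftrightarrow> 5 dvd a"
  proof -
    have "prime (5 :: int)" by simp
    moreover have "\<not> 5 dvd c" using assms(2) by auto
    ultimately show ?thesis by (simp add: prime_dvd_mult_iff)
  qed
  finally show ?thesis .
qed

text \<open>Each of the 24 arrows is an identity of linear forms in x and y: the form of the target
  node, evaluated at sigma_k u, equals c times the form of N at u plus 5 e.\<close>

lemma node_kills_sigma:
  assumes k: "k \<in> {0, 1, 2, 3}" and u: "gold_vec u"
  shows "node_kills (node_perm k N) (sigma k *v u) \<longleftrightarrow> node_kills N u"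
proof -
  note g = u[unfolded gold_vec_def]
  define x y where "x = gold_res (u $ 1)" and "y = gold_res (u $ 2)"
  \<comment> \<open>\<open>m\<close> and \<open>n\<close> are the errors made in replacing phi by 3;
    they reappear in the quotients \<open>e\<close> below.\<close>
  obtain m where m: "gold_res (golden * u $ 1) = 3 * x + 5 * m"
    using gold_res_golden_mult[of "u $ 1"] g unfolding x_def by (auto simp: dvd_def algebra_simps)
  obtain n where n: "gold_res (golden * u $ 2) = 3 * y + 5 * n"
    using gold_res_golden_mult[of "u $ 2"] g unfolding y_def by (auto simp: dvd_def algebra_simps)
  note defs = node_kills_def x_def[symmetric] y_def[symmetric]
  note simps = node_perm_def sigma_mult gold_res_add gold_ints_mult g m n x_def[symmetric] y_def[symmetric]
  consider "k = 0" | "k = 1" | "k = 2" | "k = 3" using k by blast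
  then show ?thesis
  proof cases
    case 1
    show ?thesis
    proof (cases N)
      case NA
      show ?thesis unfolding defs by (rule dvd5_iff[where c = 1 and e = "1 * n"]) (simp_all add: 1 NA simps)
    next
      case NB
      show ?thesis unfolding defs by (rule dvd5_iff[where c = 1 and e = "1 * y + 1 * n"]) (simp_all add: 1 NB simps)
    next
      case NC
      show ?thesis unfolding defs by (rule dvd5_iff[where c = 1 and e = "1 * n"]) (simp_all add: 1 NC simps)
    next
      case ND
      show ?thesis unfolding defs by (rule dvd5_iff[where c = 1 and e = "1 * y + 1 * n"]) (simp_all add: 1 ND simps)
    next
      case NE
      show ?thesis unfolding defs by (rule dvd5_iff[where c = 1 and e = "1 * y + 1 * n"]) (simp_all add: 1 NE simps)
    next
      case NF
      show ?thesis unfolding defs by (rule dvd5_iff[where c = 1 and e = "0"]) (simp_all add: 1 NF simps)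
    qed
  next
    case 2
    show ?thesis
    proof (cases N)
      case NA
      show ?thesis unfolding defs by (rule dvd5_iff[where c = 4 and e = "(- 2) * y + 1 * m + 2 * n"]) (simp_all add: 2 NA simps)
    next
      case NB
      show ?thesis unfolding defs by (rule dvd5_iff[where c = 3 and e = "1 * m + 1 * n"]) (simp_all add: 2 NB simps)
    next
      case NC
      show ?thesis unfolding defs by (rule dvd5_iff[where c = 1 and e = "1 * n"]) (simp_all add: 2 NC simps)
    next
      case ND
      show ?thesis unfolding defs by (rule dvd5_iff[where c = 2 and e = "1 * x + 3 * y + 1 * m + 5 * n"]) (simp_all add: 2 ND simps)
    next
      case NE
      show ?thesis unfolding defs by (rule dvd5_iff[where c = 1 and e = "1 * x + 2 * y + 1 * m + 4 * n"]) (simp_all add: 2 NE simps)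
    next
      case NF
      show ?thesis unfolding defs by (rule dvd5_iff[where c = 4 and e = "1 * x + 1 * y + 1 * m + 3 * n"]) (simp_all add: 2 NF simps)
    qed
  next
    case 3
    show ?thesis
    proof (cases N)
      case NA
      show ?thesis unfolding defs by (rule dvd5_iff[where c = 1 and e = "1 * x + 2 * m + 1 * n"]) (simp_all add: 3 NA simps)
    next
      case NB
      show ?thesis unfolding defs by (rule dvd5_iff[where c = 3 and e = "1 * m + 1 * n"]) (simp_all add: 3 NB simps)
    next
      case NC
      show ?thesis unfolding defs by (rule dvd5_iff[where c = 4 and e = "1 * x + (- 1) * y + 3 * m + 2 * n"]) (simp_all add: 3 NC simps)
    next
      case ND
      show ?thesis unfolding defs by (rule dvd5_iff[where c = 2 and e = "2 * x + 2 * y + 4 * m + 3 * n"]) (simp_all add: 3 ND simps)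
    next
      case NE
      show ?thesis unfolding defs by (rule dvd5_iff[where c = 3 and e = "(- 1) * y + 1 * m"]) (simp_all add: 3 NE simps)
    next
      case NF
      show ?thesis unfolding defs by (rule dvd5_iff[where c = 3 and e = "3 * x + 2 * y + 5 * m + 4 * n"]) (simp_all add: 3 NF simps)
    qed
  next
    case 4
    show ?thesis
    proof (cases N)
      case NA
      show ?thesis unfolding defs by (rule dvd5_iff[where c = 4 and e = "(- 3) * y + 1 * m"]) (simp_all add: 4 NA simps)
    next
      case NB
      show ?thesis unfolding defs by (rule dvd5_iff[where c = 2 and e = "1 * x + 2 * m"]) (simp_all add: 4 NB simps)
    next
      case NC
      show ?thesis unfolding defs by (rule dvd5_iff[where c = 3 and e = "2 * x + (- 1) * y + 4 * m"]) (simp_all add: 4 NC simps)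
    next
      case ND
      show ?thesis unfolding defs by (rule dvd5_iff[where c = 1 and e = "0"]) (simp_all add: 4 ND simps)
    next
      case NE
      show ?thesis unfolding defs by (rule dvd5_iff[where c = 3 and e = "(- 1) * y + 1 * m"]) (simp_all add: 4 NE simps)
    next
      case NF
      show ?thesis unfolding defs by (rule dvd5_iff[where c = 3 and e = "2 * x + 3 * m"]) (simp_all add: 4 NF simps)
    qed
  qed
qed

lemma bij_node_perm:
  assumes "k \<in> {0, 1, 2, 3}" shows "bij (node_perm k)"
proof -
  have "inj (node_perm k)"
    using assms by (auto simp: inj_def node_perm_def numeral_3_eq_3 numeral_2_eq_2 split: node.splits)
  moreover have "finite (UNIV :: node set)"
  proof -
    have "(UNIV :: node set) = {NA, NB, NC, ND, NE, NF}" using node.exhaust by auto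
    then show ?thesis by (metis finite.emptyI finite_insert)
  qed
  ultimately show ?thesis by (metis bij_def finite_UNIV_inj_surj)
qed

text \<open>To test a functional on the product of the matrices applied to u, it is pulled back
  through the outermost matrix, that of the last letter, before all others. Hence the word is read
  backwards, and each step applies an inverse permutation.\<close>

lemma node_kills_fold:
  assumes "set ks \<subseteq> {0, 1, 2, 3}" "gold_vec u"
  shows "gold_vec (fold (\<lambda>k v. sigma k *v v) ks u)"
    and "node_kills (foldr (\<lambda>k. inv (node_perm k)) ks N) u \<longleftrightarrow>
      node_kills N (fold (\<lambda>k v. sigma k *v v) ks u)"
  using assms
proof (induction ks arbitrary: u)
  case (Cons k ks)
  { case 1
    then show ?case using Cons.IH(1) sigma_gold_vec by simp
  next
    case 2
    let ?N = "foldr (\<lambda>k. inv (node_perm k)) ks N"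
    have "node_perm k (inv (node_perm k) ?N) = ?N"
      using 2 bij_node_perm[of k] by (simp add: bij_is_surj surj_f_inv_f)
    then have "node_kills (inv (node_perm k) ?N) u \<longleftrightarrow> node_kills ?N (sigma k *v u)"
      using 2 node_kills_sigma[of k u "inv (node_perm k) ?N"] by simp
    then show ?case using Cons.IH(2)[of "sigma k *v u"] 2 sigma_gold_vec[of k u] by simp
  }
qed simp_all

lemma tree_vector_gold_vec: "tree_word ks \<Longrightarrow> gold_vec (tree_vector ks)"
  using node_kills_fold(1)[of ks "vector [1, 0]"]
  by (simp add: tree_word_def tree_vector_def gold_vec_def)

text \<open>\<open>NA\<close> stands for x + 4 y = x - y modulo 5, the condition for vanishing
  holonomy. At the start vector (1, 0) only the form y of \<open>NF\<close> vanishes, since the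
  other five forms have x-coefficient 1.\<close>

lemma end_node_NF_iff:
  assumes "tree_word ks"
  shows "end_node ks = NF \<longleftrightarrow> 5 dvd gold_res (tree_vector ks $ 1) - gold_res (tree_vector ks $ 2)"
proof -
  let ?u = "vector [1, 0] :: real^2"
  have "node_kills (end_node ks) ?u \<longleftrightarrow> node_kills NA (tree_vector ks)"
    using node_kills_fold(2)[of ks ?u NA] assms
    by (simp add: tree_word_def tree_vector_def end_node_def gold_vec_def)
  moreover have "node_kills (end_node ks) ?u \<longleftrightarrow> end_node ks = NF"
    by (cases "end_node ks") (simp_all add: node_kills_def)
  moreover have "node_kills NA v \<longleftrightarrow> 5 dvd gold_res (v $ 1) - gold_res (v $ 2)" for v
    unfolding node_kills_def by (rule dvd5_iff[where c = 1 and e = "gold_res (v $ 2)"]) simp_all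
  ultimately show ?thesis by simp
qed

lemma tree_vector_induct [consumes 1, case_names Nil snoc]:
  assumes "tree_word ks" "P (vector [1, 0])"
    and "\<And>k u. k \<in> {0, 1, 2, 3} \<Longrightarrow> P u \<Longrightarrow> P (sigma k *v u)"
  shows "P (tree_vector ks)"
proof -
  have "set ks \<subseteq> {0, 1, 2, 3} \<Longrightarrow> P u \<Longrightarrow> P (fold (\<lambda>k v. sigma k *v v) ks u)" for u
    by (induction ks arbitrary: u) (use assms(3) in auto)
  then show ?thesis using assms by (simp add: tree_word_def tree_vector_def)
qed

text \<open>All sigma_k have determinant 1 over Z[phi], so the Bezout row (a, b) of u passes to (a,
  b) sigma_k^(-1) for sigma_k u. The consequence needed later: a real t with t v_1 and t v_2 in
  Z[phi] lies itself in Z[phi].\<close>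

lemma tree_vector_bezout:
  assumes "tree_word ks"
  obtains a b where "a \<in> gold_ints" "b \<in> gold_ints"
    "a * tree_vector ks $ 1 + b * tree_vector ks $ 2 = 1"
proof -
  define P where "P u \<longleftrightarrow> (\<exists>a\<in>gold_ints. \<exists>b\<in>gold_ints. a * u $ 1 + b * u $ 2 = 1)" for u :: "real^2"
  have "P (tree_vector ks)"
    using assms
  proof (induction rule: tree_vector_induct)
    case Nil
    then show ?case unfolding P_def by (intro bexI[of _ 1] bexI[of _ 0]) simp_all
  next
    case (snoc k u)
    obtain a b where ab: "a \<in> gold_ints" "b \<in> gold_ints" "a * u $ 1 + b * u $ 2 = 1"
      using snoc unfolding P_def by blast
    have g2: "golden * (golden * x) = golden * x + x" for x
      using golden_sq by (simp add: power2_eq_square algebra_simps flip: mult.assoc)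
    note [simp] = ab(1,2) gold_ints_mult gold_ints_diff gold_ints_add
    consider "k = 0" | "k = 1" | "k = 2" | "k = 3" using snoc by blast
    then show ?case
    proof cases
      case 1
      then show ?thesis using ab unfolding P_def
        by (intro bexI[of _ a] bexI[of _ "b - golden * a"]) (auto simp: sigma_mult algebra_simps)
    next
      case 2
      then show ?thesis using ab unfolding P_def
        by (intro bexI[of _ "golden * a - b"] bexI[of _ "golden * b - golden * a"])
          (auto simp: sigma_mult algebra_simps g2)
    next
      case 3
      then show ?thesis using ab unfolding P_def
        by (intro bexI[of _ "golden * a - golden * b"] bexI[of _ "golden * b - a"])
          (auto simp: sigma_mult algebra_simps g2)
    next
      case 4
      then show ?thesis using ab unfolding P_def
        by (intro bexI[of _ "a - golden * b"] bexI[of _ b]) (auto simp: sigma_mult algebra_simps)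
    qed
  qed
  then show thesis using that unfolding P_def by blast
qed

text \<open>The condition on the first letter enters here: sigma_0 fixes (1, 0), whereas the other
  matrices move it into the open quadrant, which all four preserve.\<close>

lemma tree_vector_pos:
  assumes "tree_word ks" "ks \<noteq> []"
  shows "tree_vector ks $ 1 > 0" "tree_vector ks $ 2 > 0"
proof -
  define pos where "pos u \<longleftrightarrow> u $ 1 > 0 \<and> u $ 2 > 0" for u :: "real^2"
  have step: "pos (sigma k *v u)" if "k \<in> {0, 1, 2, 3}" "pos u" for k u
    using that golden_gt_1 by (auto simp: pos_def sigma_mult intro!: add_pos_pos mult_pos_pos)
  have fold: "set ls \<subseteq> {0, 1, 2, 3} \<Longrightarrow> pos u \<Longrightarrow> pos (fold (\<lambda>k v. sigma k *v v) ls u)" for ls u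
    by (induction ls arbitrary: u) (use step in auto)
  obtain k ls where ks: "ks = k # ls" using assms by (cases ks) auto
  have k: "k \<in> {1, 2, 3}" and ls: "set ls \<subseteq> {0, 1, 2, 3}"
    using assms ks by (auto simp: tree_word_def)
  have "pos (sigma k *v vector [1, 0])"
    using k golden_gt_1 by (auto simp: pos_def sigma_mult)
  from fold[OF ls this] show "tree_vector ks $ 1 > 0" "tree_vector ks $ 2 > 0"
    by (simp_all add: tree_vector_def ks pos_def)
qed

section \<open>Fifth roots of unity\<close>

definition zeta :: "int \<Rightarrow> complex" where
  "zeta i = cis (2 * pi * of_int i / 5)"

definition omega :: complex where
  "omega = cis (pi / 5)"

abbreviation sn :: real where
  "sn \<equiv> sin (pi / 5)"

lemma zeta_add: "zeta (i + j) = zeta i * zeta j"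
  by (simp add: zeta_def cis_mult field_simps)

lemma zeta_0 [simp]: "zeta 0 = 1"
  by (simp add: zeta_def)

lemma zeta_5: "zeta (5 * k) = 1"
proof -
  have "zeta (5 * k) = cis (2 * pi * of_int k)" by (simp add: zeta_def field_simps)
  then show ?thesis by simp
qed

lemma zeta_neq_0 [simp]: "zeta i \<noteq> 0"
  by (simp add: zeta_def)

lemma norm_zeta [simp]: "norm (zeta i) = 1"
  by (simp add: zeta_def)

lemma cnj_zeta: "cnj (zeta i) = zeta (- i)"
  by (simp add: zeta_def cis_cnj)

lemma zeta_mod: "zeta (i mod 5) = zeta i"
proof -
  have "zeta i = zeta (i mod 5 + 5 * (i div 5))" by simp
  then show ?thesis unfolding zeta_add zeta_5 by simp
qed

lemma zeta_mult_uminus [simp]: "zeta i * zeta (- i) = 1" "zeta (- i) * zeta i = 1"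
  using zeta_add[of i "- i"] zeta_add[of "- i" i] by simp_all

lemma zeta_cancel [simp]: "zeta i * (zeta (- i) * z) = z" "zeta (- i) * (zeta i * z) = z"
  by (metis mult.assoc mult_1 zeta_mult_uminus)+

lemma sn_pos: "sn > 0"
  by (rule sin_gt_zero) (use pi_gt_zero in linarith)+

lemma sn_sq: "sn\<^sup>2 = (3 - golden) / 4"
proof -
  have "sn\<^sup>2 = 1 - (golden / 2)\<^sup>2"
    using sin_cos_squared_add[of "pi/5"] by (simp add: cos_pi_5)
  then show ?thesis by (simp add: power_divide golden_sq field_simps)
qed

lemma omega_eq: "omega = Complex (golden / 2) sn"
  by (simp add: omega_def complex_eq_iff cos_pi_5)

lemma omega_sq: "omega\<^sup>2 = golden * omega - 1"
proof -
  have "sn * sn = (3 - golden) / 4" "golden * golden = golden + 1"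
    using sn_sq golden_sq by (simp_all add: power2_eq_square)
  then show ?thesis
    by (simp add: omega_eq complex_eq_iff power2_eq_square field_simps)
qed

lemma omega_mult: "omega * omega = golden * omega - 1" "omega * (omega * z) = (golden * omega - 1) * z"
  using omega_sq by (simp_all add: power2_eq_square flip: mult.assoc)

lemma golden_mult_complex:
  "of_real golden * of_real golden = (of_real golden + 1 :: complex)"
  "of_real golden * (of_real golden * z) = (of_real golden * z + z :: complex)"
proof -
  show 1: "of_real golden * of_real golden = (of_real golden + 1 :: complex)"
    using golden_sq by (metis of_real_1 of_real_add of_real_mult power2_eq_square)
  show "of_real golden * (of_real golden * z) = (of_real golden * z + z :: complex)"
    unfolding mult.assoc[symmetric] 1 by (simp add: algebra_simps)
qed

text \<open>Here and in the next three lemmas: the powers of zeta = omega^2 in the basis 1,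
  \<open>omega\<close> over Z[phi], in which membership in the ideal is tested.\<close>

lemma zeta_1: "zeta 1 = golden * omega - 1"
proof -
  have "zeta 1 = omega\<^sup>2" by (simp add: zeta_def omega_def power2_eq_square cis_mult field_simps)
  then show ?thesis by (simp add: omega_sq)
qed

lemma zeta_2: "zeta 2 = omega - golden"
  using zeta_add[of 1 1] by (simp add: zeta_1 algebra_simps omega_mult golden_mult_complex)

lemma zeta_3: "zeta 3 = - omega"
  using zeta_add[of 1 2] by (simp add: zeta_1 zeta_2 algebra_simps omega_mult golden_mult_complex)

lemma zeta_4: "zeta 4 = golden - golden * omega"
  using zeta_add[of 1 3] by (simp add: zeta_1 zeta_3 algebra_simps omega_mult golden_mult_complex)

lemma mod5_cases:
  fixes i :: int
  obtains "i mod 5 = 0" | "i mod 5 = 1" | "i mod 5 = 2" | "i mod 5 = 3" | "i mod 5 = 4"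
proof -
  have "0 \<le> i mod 5" "i mod 5 < 5" by simp_all
  then show thesis using that by linarith
qed

lemma Im_zeta:
  "Im (zeta 1) = golden * sn" "Im (zeta 2) = sn" "Im (zeta 3) = - sn" "Im (zeta 4) = - (golden * sn)"
  by (simp_all add: zeta_1 zeta_2 zeta_3 zeta_4 omega_eq)

lemma Im_zeta_eq_0:
  assumes "Im (zeta i) = 0" shows "i mod 5 = 0"
proof -
  have "Im (zeta (i mod 5)) = 0" using assms by (simp only: zeta_mod)
  then show ?thesis using golden_gt_1 sn_pos Im_zeta by (cases i rule: mod5_cases) auto
qed

lemma zeta_eq_iff: "zeta i = zeta j \<longleftrightarrow> i mod 5 = j mod 5"
proof
  assume "zeta i = zeta j"
  then have "zeta (i - j) = 1" using zeta_add[of "i - j" j] by simp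
  then have "(i - j) mod 5 = 0" using Im_zeta_eq_0[of "i - j"] by simp
  then show "i mod 5 = j mod 5" by (metis mod_eq_dvd_iff mod_0_imp_dvd)
next
  assume "i mod 5 = j mod 5"
  then show "zeta i = zeta j" by (metis zeta_mod)
qed

lemma zeta_eq_1_iff: "zeta i = 1 \<longleftrightarrow> 5 dvd i"
  using zeta_eq_iff[of i 0] by (metis dvd_eq_mod_eq_0 mod_0 zeta_0)

text \<open>The group of fifth roots of unity has odd order and does not contain -1. This rules out
  matching sides of Q and -Q in the direction in which they run, and rotations that reverse a
  velocity.\<close>

lemma zeta_neq_minus: "zeta i \<noteq> - zeta j"
proof
  assume "zeta i = - zeta j"
  then have "(zeta (i - j) + 1) * zeta j = 0"
    using zeta_add[of "i - j" j] unfolding ring_distribs by (metis add.left_inverse diff_add_cancel mult_1)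
  then have *: "zeta (i - j) = - 1" by (simp add: eq_neg_iff_add_eq_0)
  then have "(i - j) mod 5 = 0" using Im_zeta_eq_0[of "i - j"] by simp
  then have "zeta (i - j) = 1" using zeta_mod[of "i - j"] by simp
  then show False using * by simp
qed

lemma omega_zeta: "omega * zeta i = - zeta (i + 3)"
  by (simp add: zeta_add zeta_3)

lemma norm_omega [simp]: "norm omega = 1"
  by (simp add: omega_def)

lemma omega_neq_0 [simp]: "omega \<noteq> 0"
  by (simp add: omega_def)

section \<open>The ideal \<open>(1 - \<zeta>)\<close> of \<open>\<int>[\<zeta>] = \<int>[\<phi>] + \<int>[\<phi>] e\<^bsup>\<pi>i/5\<^esup>\<close>\<close>

definition cpl :: "real \<Rightarrow> real \<Rightarrow> complex" where
  "cpl x y = of_real x + of_real y * omega"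

lemma cpl_eq_iff: "cpl x y = cpl x' y' \<longleftrightarrow> x = x' \<and> y = y'"
  using sn_pos by (auto simp: cpl_def complex_eq_iff omega_eq)

lemma cpl_add: "cpl x y + cpl x' y' = cpl (x + x') (y + y')"
  by (simp add: cpl_def algebra_simps)

lemma cpl_diff: "cpl x y - cpl x' y' = cpl (x - x') (y - y')"
  by (simp add: cpl_def algebra_simps)

lemma cpl_scale: "of_real t * cpl x y = cpl (t * x) (t * y)"
  by (simp add: cpl_def algebra_simps)

text \<open>Modulo \<open>1 - \<zeta>\<close> we have \<open>\<phi> = 3\<close> and \<open>e\<^bsup>\<pi>i/5\<^esup> = -\<zeta>\<^sup>3 = -1\<close>.\<close>

definition ideal5 :: "complex set" where
  "ideal5 = {cpl x y | x y. x \<in> gold_ints \<and> y \<in> gold_ints \<and> 5 dvd gold_res x - gold_res y}"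

lemma cpl_in_ideal5_iff:
  assumes "x \<in> gold_ints" "y \<in> gold_ints"
  shows "cpl x y \<in> ideal5 \<longleftrightarrow> 5 dvd gold_res x - gold_res y"
  using assms by (auto simp: ideal5_def cpl_eq_iff)

lemma ideal5_add: "a \<in> ideal5 \<Longrightarrow> b \<in> ideal5 \<Longrightarrow> a + b \<in> ideal5"
proof -
  assume "a \<in> ideal5" "b \<in> ideal5"
  then obtain x y x' y' where xy: "a = cpl x y" "x \<in> gold_ints" "y \<in> gold_ints" "b = cpl x' y'" "x' \<in> gold_ints" "y' \<in> gold_ints"
    and res: "5 dvd gold_res x - gold_res y" "5 dvd gold_res x' - gold_res y'"
    unfolding ideal5_def by blast
  have "gold_res (x + x') - gold_res (y + y') = (gold_res x - gold_res y) + (gold_res x' - gold_res y')"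
    using xy by (simp add: gold_res_add)
  then have "5 dvd gold_res (x + x') - gold_res (y + y')" using dvd_add[OF res] by simp
  then show ?thesis using xy by (simp add: cpl_add cpl_in_ideal5_iff gold_ints_add)
qed

lemma ideal5_diff: "a \<in> ideal5 \<Longrightarrow> b \<in> ideal5 \<Longrightarrow> a - b \<in> ideal5"
proof -
  assume "a \<in> ideal5" "b \<in> ideal5"
  then obtain x y x' y' where xy: "a = cpl x y" "x \<in> gold_ints" "y \<in> gold_ints" "b = cpl x' y'" "x' \<in> gold_ints" "y' \<in> gold_ints"
    and res: "5 dvd gold_res x - gold_res y" "5 dvd gold_res x' - gold_res y'"
    unfolding ideal5_def by blast
  have "gold_res (x - x') - gold_res (y - y') = (gold_res x - gold_res y) - (gold_res x' - gold_res y')"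
    using xy by (simp add: gold_res_diff)
  then have "5 dvd gold_res (x - x') - gold_res (y - y')" using dvd_diff[OF res] by simp
  then show ?thesis using xy by (simp add: cpl_diff cpl_in_ideal5_iff gold_ints_diff)
qed

lemma of_int_in_ideal5_iff: "of_int n \<in> ideal5 \<longleftrightarrow> 5 dvd n"
proof -
  have "of_int n = cpl (of_int n) 0" by (simp add: cpl_def)
  then show ?thesis using cpl_in_ideal5_iff[of "of_int n" 0] by simp
qed

lemma zero_in_ideal5 [simp]: "0 \<in> ideal5"
  using of_int_in_ideal5_iff[of 0] by simp

lemma ideal5_uminus: "a \<in> ideal5 \<Longrightarrow> - a \<in> ideal5"
  using ideal5_diff[of 0 a] by simp

text \<open>Modulo 5, scaling by t multiplies the residue of x - y by that of t. For the periods 1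
  and phi the latter is 1 or 3, prime to 5, so short and long trajectories obey the same
  criterion.\<close>

lemma scale_in_ideal5_iff:
  assumes "x \<in> gold_ints" "y \<in> gold_ints" "t \<in> gold_ints"
  shows "of_real t * cpl x y \<in> ideal5 \<longleftrightarrow> 5 dvd gold_res t * (gold_res x - gold_res y)"
proof -
  obtain m n where "gold_res (t * x) - gold_res t * gold_res x = 5 * m"
    "gold_res (t * y) - gold_res t * gold_res y = 5 * n"
    using gold_res_mult assms by (meson dvdE)
  then have *: "gold_res (t * x) - gold_res (t * y) = gold_res t * (gold_res x - gold_res y) + 5 * (m - n)"
    by (simp add: algebra_simps)
  show ?thesis
    unfolding cpl_scale using assms by (simp add: cpl_in_ideal5_iff gold_ints_mult * dvd_add_left_iff)
qed

section \<open>The upright pentagon\<close>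

text \<open>Chosen so that side i is the vector (phi - 1) zeta^i: diagonals of length 1 mean sides
  of length 1/phi = phi - 1. The denominator zeta - 1 makes this the difference of consecutive
  vertices of a pentagon centered at 0, with side 0 at the bottom. Indices run over all integers,
  with period 5.\<close>

definition vtx :: "int \<Rightarrow> complex" where
  "vtx i = of_real (golden - 1) * zeta i / (zeta 1 - 1)"

text \<open>Twice the midpoint of side i: the translation from the center of Q to the center of the
  copy of -Q across that side.\<close>

definition mid2 :: "int \<Rightarrow> complex" where
  "mid2 i = vtx i + vtx (i + 1)"

definition edge :: "int \<Rightarrow> complex set" where
  "edge i = closed_segment (vtx i) (vtx (i + 1))"

definition pent :: "complex set" where
  "pent = convex hull (range vtx)"

text \<open>Half the side divided by tan(pi/5) is 1 / (4 sin(pi/5)); the present form follows from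
  sin^2(pi/5) = (3 - phi)/4 and (3 - phi)(2 + phi) = 5.\<close>

definition apo :: real where
  "apo = sn * (2 + golden) / 5"

lemma zeta_1_neq_1: "zeta 1 - 1 \<noteq> 0"
  using zeta_eq_1_iff[of 1] by simp

lemma vtx_add: "vtx (i + j) = zeta j * vtx i"
  by (simp add: vtx_def zeta_add)

lemma vtx_diff: "vtx (i + 1) - vtx i = of_real (golden - 1) * zeta i"
proof -
  have "vtx (i + 1) - vtx i = of_real (golden - 1) * zeta i * ((zeta 1 - 1) / (zeta 1 - 1))"
    by (simp only: vtx_def zeta_add times_divide_eq_right flip: diff_divide_distrib) (simp add: algebra_simps)
  then show ?thesis using zeta_1_neq_1 by simp
qed

lemma mid2_eq: "mid2 i = omega * zeta i / (zeta 1 - 1)"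
proof -
  have "mid2 i = of_real (golden - 1) * zeta i * (1 + zeta 1) / (zeta 1 - 1)"
    by (simp add: mid2_def vtx_def zeta_add ring_distribs add_divide_distrib)
  also have "of_real (golden - 1) * zeta i * (1 + zeta 1) = (of_real golden * of_real (golden - 1)) * (omega * zeta i)"
    by (simp add: zeta_1)
  also have "of_real golden * of_real (golden - 1) = (1::complex)"
    using golden_mult_minus_1 by (metis of_real_1 of_real_mult)
  finally show ?thesis by simp
qed

lemma mid2_add: "mid2 (i + j) = zeta j * mid2 i"
  by (simp add: mid2_eq zeta_add)

lemma mid2_diff: "mid2 (i + 1) - mid2 i = omega * zeta i"
proof -
  have "mid2 (i + 1) - mid2 i = omega * zeta i * ((zeta 1 - 1) / (zeta 1 - 1))"
    by (simp only: mid2_eq zeta_add times_divide_eq_right flip: diff_divide_distrib) (simp add: algebra_simps)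
  then show ?thesis using zeta_1_neq_1 by simp
qed

lemma vtx_mod: "vtx (i mod 5) = vtx i"
  by (simp add: vtx_def zeta_mod)

lemma mid2_mod: "mid2 (i mod 5) = mid2 i"
  by (simp add: mid2_eq zeta_mod)

lemma sn_mult: "sn * sn = (3 - golden) / 4" "sn * (sn * z) = (3 - golden) / 4 * z"
  and golden_mult: "golden * golden = golden + 1" "golden * (golden * z) = golden * z + z"
proof -
  show 1: "sn * sn = (3 - golden) / 4" and 2: "golden * golden = golden + 1"
    using sn_sq golden_sq by (simp_all add: power2_eq_square)
  show "sn * (sn * z) = (3 - golden) / 4 * z" "golden * (golden * z) = golden * z + z"
    unfolding mult.assoc[symmetric] 1 2 by (simp_all add: algebra_simps)
qed

lemma vtx_0: "vtx 0 = Complex (- (golden - 1) / 2) (- apo)"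
proof -
  have "Complex (- (golden - 1) / 2) (- apo) * (zeta 1 - 1) = of_real (golden - 1)"
    by (simp add: zeta_1 omega_eq complex_eq_iff apo_def field_simps sn_mult golden_mult)
  then show ?thesis using zeta_1_neq_1 by (simp add: vtx_def field_simps)
qed

lemma vtx_1: "vtx 1 = Complex ((golden - 1) / 2) (- apo)"
proof -
  have "vtx 1 = vtx 0 + of_real (golden - 1)" using vtx_diff[of 0] by (simp add: algebra_simps)
  moreover have "- (golden - 1) / 2 + (golden - 1) = (golden - 1) / 2" by argo
  ultimately show ?thesis
    unfolding vtx_0 complex_eq_iff plus_complex.sel complex.sel Re_complex_of_real Im_complex_of_real
    by (simp only: add_0_right)
qed

lemma vtx_2: "vtx 2 = Complex (1 / 2) (sn - apo)"
  using vtx_diff[of 1] vtx_1 by (simp add: complex_eq_iff zeta_1 omega_eq field_simps golden_mult)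

lemma vtx_3: "vtx 3 = Complex 0 (golden * sn - apo)"
  using vtx_diff[of 2] vtx_2 by (simp add: complex_eq_iff zeta_2 omega_eq field_simps golden_mult)

lemma vtx_4: "vtx 4 = Complex (- 1 / 2) (sn - apo)"
  using vtx_diff[of 3] vtx_3 by (simp add: complex_eq_iff zeta_3 omega_eq field_simps golden_mult)

lemma apo_pos: "apo > 0" and apo_less_sn: "apo < sn"
proof -
  show "apo > 0" using sn_pos golden_gt_1 by (simp add: apo_def)
  have "golden < 2" by (simp add: golden_def real_less_lsqrt)
  then show "apo < sn" using sn_pos by (simp add: apo_def)
qed

lemma golden_less_2: "golden < 2"
  by (simp add: golden_def real_less_lsqrt)

text \<open>The reflection z -> - cnj z in the vertical axis preserves Q and exchanges vertices 0
  and 1; so complex conjugation itself maps Q to -Q.\<close>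

lemma cnj_vtx: "cnj (vtx i) = - vtx (1 - i)"
proof -
  have 0: "cnj (vtx 0) = - vtx 1" unfolding vtx_0 vtx_1 complex_eq_iff by simp argo
  have "cnj (vtx i) = zeta (- i) * cnj (vtx 0)" using vtx_add[of 0 i] by (simp add: cnj_zeta)
  also have "\<dots> = - vtx (1 - i)" using vtx_add[of 1 "- i"] by (simp add: 0)
  finally show ?thesis .
qed

lemma cnj_mid2: "cnj (mid2 i) = - mid2 (- i)"
  by (simp add: mid2_def cnj_vtx algebra_simps)

lemma mid2_0: "mid2 0 = Complex 0 (- 2 * apo)"
  by (simp add: mid2_def vtx_0 vtx_1 complex_eq_iff flip: add_divide_distrib)

lemma mid2_neq_0 [simp]: "mid2 i \<noteq> 0"
  using zeta_1_neq_1 by (simp add: mid2_eq)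

lemma norm_mid2: "norm (mid2 i) = 2 * apo"
proof -
  have "mid2 i = zeta i * mid2 0" using mid2_add[of 0 i] by simp
  then have "norm (mid2 i) = norm (mid2 0)" by (simp add: norm_mult)
  also have "\<dots> = 2 * apo" using apo_pos by (simp add: mid2_0 cmod_def real_sqrt_mult)
  finally show ?thesis .
qed

lemma range_vtx: "range vtx = {vtx 0, vtx 1, vtx 2, vtx 3, vtx 4}"
proof -
  have "vtx i \<in> {vtx 0, vtx 1, vtx 2, vtx 3, vtx 4}" for i
    using vtx_mod[of i] by (cases i rule: mod5_cases) simp_all
  then show ?thesis by auto
qed

lemma pent_rot: "z \<in> pent \<Longrightarrow> zeta i * z \<in> pent"
proof -
  have "(\<lambda>z. zeta i * z) ` range vtx \<subseteq> range vtx" by (force simp flip: vtx_add)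
  then have "convex hull ((\<lambda>z. zeta i * z) ` range vtx) \<subseteq> pent" unfolding pent_def by (rule hull_mono)
  moreover have "convex hull ((\<lambda>z. zeta i * z) ` range vtx) = (\<lambda>z. zeta i * z) ` pent"
    unfolding pent_def by (rule convex_hull_linear_image[symmetric]) (simp add: linear_times)
  ultimately show "z \<in> pent \<Longrightarrow> zeta i * z \<in> pent" by blast
qed

lemma pent_rot_iff: "zeta i * z \<in> pent \<longleftrightarrow> z \<in> pent"
proof
  assume "zeta i * z \<in> pent"
  then have "zeta (- i) * (zeta i * z) \<in> pent" by (rule pent_rot)
  then show "z \<in> pent" by simp
qed (rule pent_rot)

lemma edge_rot: "edge (i + j) = (\<lambda>z. zeta j * z) ` edge i"
proof -
  have "i + j + 1 = (i + 1) + j" by simp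
  then have "edge (i + j) = closed_segment (zeta j * vtx i) (zeta j * vtx (i + 1))"
    unfolding edge_def by (metis vtx_add)
  also have "\<dots> = (\<lambda>z. zeta j * z) ` edge i"
    unfolding edge_def by (rule closed_segment_linear_image) (simp add: linear_times)
  finally show ?thesis .
qed

lemma edge_rot_iff: "zeta j * z \<in> edge (i + j) \<longleftrightarrow> z \<in> edge i"
  unfolding edge_rot using zeta_neq_0 by (metis (no_types, lifting) imageE imageI mult_left_cancel)

lemma vtx_in_pent: "vtx i \<in> pent"
  unfolding pent_def by (simp add: hull_inc)

lemma convex_pent: "convex pent"
  by (simp add: pent_def)

lemma edge_subset_pent: "edge i \<subseteq> pent"
  unfolding edge_def by (rule closed_segment_subset) (simp_all add: vtx_in_pent convex_pent)

text \<open>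
  \<open>apo\<close> is the apothem: the height of the center above the bottom side.
\<close>

definition low_half :: "real \<Rightarrow> real" where
  "low_half h = (golden - 1) / 2 + (2 - golden) / 2 * ((h + apo) / sn)"

text \<open>Half the width of Q above the horizontal diagonal, falling linearly from 1/2 to 0 at the
  top vertex. Its companion \<open>low_half\<close> rises from (phi - 1)/2 at the bottom side to 1/2
  at the diagonal.\<close>

definition high_half :: "real \<Rightarrow> real" where
  "high_half h = 1 / 2 * ((golden * sn - apo - h) / ((golden - 1) * sn))"


lemma low_half_bounds:
  assumes "- apo \<le> h" "h \<le> sn - apo"
  shows "(golden - 1) / 2 \<le> low_half h" "low_half h \<le> 1 / 2"
proof -
  have h: "0 \<le> (h + apo) / sn" "(h + apo) / sn \<le> 1" using assms sn_pos by simp_all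
  then have "0 \<le> (2 - golden) / 2 * ((h + apo) / sn)" using golden_less_2 by (intro mult_nonneg_nonneg) auto
  then show "(golden - 1) / 2 \<le> low_half h" unfolding low_half_def by argo
  have "(2 - golden) / 2 * ((h + apo) / sn) \<le> (2 - golden) / 2 * 1"
    using h golden_less_2 by (intro mult_left_mono) auto
  then show "low_half h \<le> 1 / 2" unfolding low_half_def by argo
qed

lemma high_half_bounds:
  assumes "sn - apo \<le> h" "h \<le> golden * sn - apo"
  shows "0 \<le> high_half h" "high_half h \<le> 1 / 2"
proof -
  have pos: "(golden - 1) * sn > 0" using golden_gt_1 sn_pos by simp
  have "0 \<le> (golden * sn - apo - h) / ((golden - 1) * sn)"
    using assms pos by (intro divide_nonneg_pos) auto
  moreover have "(golden * sn - apo - h) / ((golden - 1) * sn) \<le> 1"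
    using assms pos by (subst divide_le_eq_1_pos) (auto simp: algebra_simps)
  ultimately show "0 \<le> high_half h" "high_half h \<le> 1 / 2" unfolding high_half_def by argo+
qed

lemma segment_in_pent:
  assumes "Complex (- r) h \<in> pent" "Complex r h \<in> pent" "\<bar>x\<bar> \<le> r"
  shows "Complex x h \<in> pent"
proof (cases "r = 0")
  case True
  then show ?thesis using assms by simp
next
  case False
  define u where "u = (x + r) / (2 * r)"
  have u: "0 \<le> u" "u \<le> 1" using assms(3) False by (auto simp: u_def)
  have "Complex x h = (1 - u) *\<^sub>R Complex (- r) h + u *\<^sub>R Complex r h"
    using False by (simp add: complex_eq_iff u_def field_simps)
  then show ?thesis using convexD_alt[OF convex_pent assms(1,2) u] by simp
qed

lemma segment_point:
  assumes "0 \<le> u" "u \<le> 1"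
  shows "(1 - u) *\<^sub>R a + u *\<^sub>R b \<in> closed_segment a b"
  using assms unfolding closed_segment_def by blast

lemma low_half_edges:
  assumes "- apo \<le> h" "h \<le> sn - apo"
  shows "Complex (low_half h) h \<in> edge 1" "Complex (- low_half h) h \<in> edge 4"
proof -
  define u where "u = (h + apo) / sn"
  have u: "0 \<le> u" "u \<le> 1" "0 \<le> 1 - u" "1 - u \<le> 1" using assms sn_pos by (simp_all add: u_def)
  have h: "h = u * sn - apo" using sn_pos by (simp add: u_def)
  have r: "low_half h = (golden - 1) / 2 + (2 - golden) / 2 * u" by (simp add: low_half_def u_def)
  have q5: "vtx 5 = vtx 0" using vtx_mod[of 5] by simp
  have "Complex (low_half h) h = (1 - u) *\<^sub>R vtx 1 + u *\<^sub>R vtx 2"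
    unfolding vtx_1 vtx_2 r by (simp add: complex_eq_iff h field_simps)
  then show "Complex (low_half h) h \<in> edge 1" using segment_point[OF u(1,2)] by (simp add: edge_def)
  have "Complex (- low_half h) h = (1 - (1 - u)) *\<^sub>R vtx 4 + (1 - u) *\<^sub>R vtx 0"
    unfolding vtx_0 vtx_4 r by (simp add: complex_eq_iff h field_simps)
  then show "Complex (- low_half h) h \<in> edge 4" using segment_point[OF u(3,4)] by (simp add: edge_def q5)
qed

lemma high_half_edges:
  assumes "sn - apo \<le> h" "h \<le> golden * sn - apo"
  shows "Complex (high_half h) h \<in> edge 2" "Complex (- high_half h) h \<in> edge 3"
proof -
  have pos: "(golden - 1) * sn > 0" using golden_gt_1 sn_pos by simp
  define u where "u = (golden * sn - apo - h) / ((golden - 1) * sn)"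
  have r: "high_half h = 1 / 2 * u" by (simp add: high_half_def u_def)
  have u: "0 \<le> u" "u \<le> 1" "0 \<le> 1 - u" "1 - u \<le> 1"
    using high_half_bounds[OF assms] unfolding r by simp_all
  have "u * ((golden - 1) * sn) = golden * sn - apo - h"
    unfolding u_def using pos by (metis less_irrefl nonzero_eq_divide_eq)
  then have h: "h = golden * sn - apo - u * ((golden - 1) * sn)" by argo
  have "Complex (high_half h) h = (1 - (1 - u)) *\<^sub>R vtx 2 + (1 - u) *\<^sub>R vtx 3"
    unfolding vtx_2 vtx_3 r by (simp add: complex_eq_iff h algebra_simps)
  then show "Complex (high_half h) h \<in> edge 2" using segment_point[OF u(3,4)] by (simp add: edge_def)
  have "Complex (- high_half h) h = (1 - u) *\<^sub>R vtx 3 + u *\<^sub>R vtx 4"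
    unfolding vtx_3 vtx_4 r by (simp add: complex_eq_iff h algebra_simps)
  then show "Complex (- high_half h) h \<in> edge 3" using segment_point[OF u(1,2)] by (simp add: edge_def)
qed

lemma edge_0_iff: "z \<in> edge 0 \<longleftrightarrow> Im z = - apo \<and> \<bar>Re z\<bar> \<le> (golden - 1) / 2"
proof
  assume "z \<in> edge 0"
  then obtain u where u: "0 \<le> u" "u \<le> 1" and "z = (1 - u) *\<^sub>R vtx 0 + u *\<^sub>R vtx 1"
    unfolding edge_def closed_segment_def by auto
  then have "Im z = (1 - u) * (- apo) + u * (- apo)"
    "Re z = (1 - u) * (- (golden - 1) / 2) + u * ((golden - 1) / 2)" by (simp_all add: vtx_0 vtx_1)
  then have z: "Im z = - apo" "Re z = (golden - 1) * (u - 1/2)" by argo+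
  have "\<bar>u - 1/2\<bar> \<le> 1/2" using u by (intro abs_leI) argo+
  then have "\<bar>Re z\<bar> \<le> (golden - 1) * (1/2)"
    unfolding z(2) abs_mult using golden_gt_1 by (simp only: abs_of_pos mult_left_mono)
  then show "Im z = - apo \<and> \<bar>Re z\<bar> \<le> (golden - 1) / 2" using z by simp
next
  assume z: "Im z = - apo \<and> \<bar>Re z\<bar> \<le> (golden - 1) / 2"
  define u where "u = Re z / (golden - 1) + 1 / 2"
  have g: "golden - 1 > 0" using golden_gt_1 by simp
  have Rez: "Re z = (golden - 1) * (u - 1/2)" using g by (simp add: u_def)
  then have "(golden - 1) * \<bar>u - 1/2\<bar> \<le> (golden - 1) * (1/2)" using z g by (simp add: abs_mult)
  then have "\<bar>u - 1/2\<bar> \<le> 1/2" using g by simp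
  then have u: "0 \<le> u" "u \<le> 1" unfolding abs_le_iff by argo+
  have "z = (1 - u) *\<^sub>R vtx 0 + u *\<^sub>R vtx 1"
    unfolding vtx_0 vtx_1 using z Rez by (simp add: complex_eq_iff algebra_simps) argo?
  then show "z \<in> edge 0" using segment_point[OF u] by (simp add: edge_def)
qed

text \<open>The lines of the slanted sides bound Q at every height, not only along the sides, so
  both width functions may be imposed everywhere. The resulting set S is an intersection of five
  half planes that contains the vertices.\<close>

lemma pent_section_bounds:
  assumes "z \<in> pent"
  shows "- apo \<le> Im z" "Im z \<le> golden * sn - apo"
    "Im z \<le> sn - apo \<Longrightarrow> \<bar>Re z\<bar> \<le> low_half (Im z)"
    "sn - apo \<le> Im z \<Longrightarrow> \<bar>Re z\<bar> \<le> high_half (Im z)"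
proof -
  have gs: "(golden - 1) * sn > 0" using golden_gt_1 sn_pos by simp
  define S where "S = {z. - apo \<le> Im z \<and> \<bar>Re z\<bar> \<le> low_half (Im z) \<and> \<bar>Re z\<bar> \<le> high_half (Im z)}"
  have l: "low_half h = low_half 0 - (golden - 2) / (2 * sn) * h" for h
    using sn_pos by (simp add: low_half_def field_simps)
  have h: "high_half h = high_half 0 - 1 / (2 * ((golden - 1) * sn)) * h" for h
    using gs by (simp add: high_half_def diff_divide_distrib)
  have S_eq: "S = {z. Im z \<ge> - apo} \<inter> {z. Re z + (golden - 2) / (2 * sn) * Im z \<le> low_half 0}
    \<inter> {z. - Re z + (golden - 2) / (2 * sn) * Im z \<le> low_half 0}
    \<inter> {z. Re z + 1 / (2 * ((golden - 1) * sn)) * Im z \<le> high_half 0}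
    \<inter> {z. - Re z + 1 / (2 * ((golden - 1) * sn)) * Im z \<le> high_half 0}"
    unfolding S_def by (subst l, subst h) auto
  have "convex {z. Re z + c * Im z \<le> b}" "convex {z. - Re z + c * Im z \<le> b}" "convex {z. b \<le> Im z}" for b c
    using convex_halfspace_le[of "Complex 1 c" b] convex_halfspace_le[of "Complex (- 1) c" b]
      convex_halfspace_ge[of b "Complex 0 1"] by (simp_all add: inner_complex_def)
  then have "convex S"
    unfolding S_eq by (intro convex_Int)
  moreover have "range vtx \<subseteq> S"
  proof -
    have low: "low_half (- apo) = (golden - 1) / 2" "low_half (sn - apo) = 1 / 2"
      "low_half (golden * sn - apo) = golden - 1"
      using sn_pos by (simp_all add: low_half_def field_simps golden_mult)
    have "golden * sn / ((golden - 1) * sn) = golden + 1"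
      using sn_pos golden_gt_1 by (simp add: field_simps golden_mult)
    then have high: "high_half (- apo) = (golden + 1) / 2" by (simp add: high_half_def)
    have "golden * sn - apo - (sn - apo) = (golden - 1) * sn" by (simp add: algebra_simps)
    then have high': "high_half (sn - apo) = 1 / 2" "high_half (golden * sn - apo) = 0"
      using gs sn_pos golden_gt_1 by (simp_all add: high_half_def)
    have "0 < golden * sn" using sn_pos golden_gt_1 by simp
    then show ?thesis
      unfolding range_vtx S_def using golden_gt_1 sn_pos
      by (simp add: vtx_0 vtx_1 vtx_2 vtx_3 vtx_4 low high high')
  qed
  ultimately have "pent \<subseteq> S" unfolding pent_def by (simp add: hull_minimal)
  then have z: "z \<in> S" using assms by blast
  show "- apo \<le> Im z" using z by (simp add: S_def)
  have "\<bar>Re z\<bar> \<le> low_half (Im z)" using z by (simp add: S_def)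
  then show "Im z \<le> sn - apo \<Longrightarrow> \<bar>Re z\<bar> \<le> low_half (Im z)" by simp
  have *: "\<bar>Re z\<bar> \<le> high_half (Im z)" using z by (simp add: S_def)
  then show "sn - apo \<le> Im z \<Longrightarrow> \<bar>Re z\<bar> \<le> high_half (Im z)" by simp
  \<comment> \<open>The two upper sides meet at the top vertex, so the height bound is the condition
    that this width is nonnegative.\<close>
  have "0 \<le> high_half (Im z)" using * by simp
  then have "0 \<le> (golden * sn - apo - Im z) / ((golden - 1) * sn)" unfolding high_half_def by argo
  then show "Im z \<le> golden * sn - apo" using gs by (simp add: zero_le_divide_iff)
qed

lemma pent_iff:
  "z \<in> pent \<longleftrightarrow> - apo \<le> Im z \<and> Im z \<le> golden * sn - apo \<and>
    (Im z \<le> sn - apo \<longrightarrow> \<bar>Re z\<bar> \<le> low_half (Im z)) \<and>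
    (sn - apo \<le> Im z \<longrightarrow> \<bar>Re z\<bar> \<le> high_half (Im z))"
proof
  assume "z \<in> pent"
  then show "- apo \<le> Im z \<and> Im z \<le> golden * sn - apo \<and>
    (Im z \<le> sn - apo \<longrightarrow> \<bar>Re z\<bar> \<le> low_half (Im z)) \<and>
    (sn - apo \<le> Im z \<longrightarrow> \<bar>Re z\<bar> \<le> high_half (Im z))"
    using pent_section_bounds by blast
next
  assume z: "- apo \<le> Im z \<and> Im z \<le> golden * sn - apo \<and>
    (Im z \<le> sn - apo \<longrightarrow> \<bar>Re z\<bar> \<le> low_half (Im z)) \<and>
    (sn - apo \<le> Im z \<longrightarrow> \<bar>Re z\<bar> \<le> high_half (Im z))"
  have "Complex (Re z) (Im z) \<in> pent"
  proof (cases "Im z \<le> sn - apo")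
    case True
    with z show ?thesis
      using segment_in_pent[of "low_half (Im z)" "Im z" "Re z"] low_half_edges[of "Im z"] edge_subset_pent by blast
  next
    case False
    with z show ?thesis
      using segment_in_pent[of "high_half (Im z)" "Im z" "Re z"] high_half_edges[of "Im z"] edge_subset_pent
      by (metis nle_le subsetD)
  qed
  then show "z \<in> pent" by simp
qed

text \<open>\<open>mid2 i\<close> is an outer normal of length 2 apo, so the inner product with it
  attains its maximum 2 apo^2 over Q exactly on side i. A rotation reduces this to the bottom
  side.\<close>

lemma pent_halfplane:
  assumes "z \<in> pent"
  shows "Re (z * cnj (mid2 i)) \<le> 2 * apo\<^sup>2"
    and "Re (z * cnj (mid2 i)) = 2 * apo\<^sup>2 \<longleftrightarrow> z \<in> edge i"
proof -
  define w where "w = zeta (- i) * z"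
  have w: "w \<in> pent" using assms unfolding w_def by (rule pent_rot)
  have "z * cnj (mid2 i) = w * cnj (mid2 0)"
    using mid2_add[of 0 i] by (simp add: w_def cnj_zeta ac_simps)
  then have *: "Re (z * cnj (mid2 i)) = - 2 * apo * Im w" by (simp add: mid2_0)
  have "- apo \<le> Im w" using w by (simp add: pent_iff)
  then have "- Im w * (2 * apo) \<le> apo * (2 * apo)"
    using apo_pos by (intro mult_right_mono) auto
  then show "Re (z * cnj (mid2 i)) \<le> 2 * apo\<^sup>2"
    unfolding * by (simp add: power2_eq_square algebra_simps)
  have "Re (z * cnj (mid2 i)) = 2 * apo\<^sup>2 \<longleftrightarrow> - Im w * (2 * apo) = apo * (2 * apo)"
    unfolding * by (simp add: power2_eq_square algebra_simps)
  also have "\<dots> \<longleftrightarrow> Im w = - apo" using apo_pos by (subst mult_cancel_right) auto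
  also have "\<dots> \<longleftrightarrow> w \<in> edge 0"
  proof -
    have "low_half (- apo) = (golden - 1) / 2" by (simp add: low_half_def)
    moreover have "\<bar>Re w\<bar> \<le> low_half (Im w)" if "Im w = - apo"
      using w that sn_pos by (simp add: pent_iff)
    ultimately show ?thesis by (auto simp: edge_0_iff)
  qed
  also have "\<dots> \<longleftrightarrow> z \<in> edge i" using edge_rot_iff[of "- i" z i] by (simp add: w_def)
  finally show "Re (z * cnj (mid2 i)) = 2 * apo\<^sup>2 \<longleftrightarrow> z \<in> edge i" .
qed

lemma edge_mod: "edge (i mod 5) = edge i"
proof -
  have "edge i = edge (i mod 5 + 5 * (i div 5))" by simp
  also have "\<dots> = edge (i mod 5)" by (simp only: edge_rot zeta_5 mult_1_left image_ident)
  finally show ?thesis ..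
qed

lemma sn_golden: "sn < golden * sn" "golden * sn \<noteq> 0"
  using sn_pos golden_gt_1 by auto

lemma edge_cases:
  assumes "z \<in> edge i"
  obtains u where "0 \<le> u" "u \<le> 1" "z = (1 - u) *\<^sub>R vtx i + u *\<^sub>R vtx (i + 1)"
  using assms unfolding edge_def closed_segment_def by blast

lemma Im_vtx: "Im (vtx 0) = - apo" "Im (vtx 1) = - apo" "Im (vtx 2) = sn - apo" "Im (vtx 3) = golden * sn - apo"
  "Im (vtx 4) = sn - apo"
  by (simp_all add: vtx_0 vtx_1 vtx_2 vtx_3 vtx_4)

lemma edge_0_inter:
  assumes "z \<in> edge 0" "z \<in> edge i" "i mod 5 \<noteq> 0"
  shows "z \<in> range vtx"
proof -
  have z: "Im z = - apo" using assms(1) by (simp add: edge_0_iff)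
  have q5: "vtx 5 = vtx 0" using vtx_mod[of 5] by simp
  have zi: "z \<in> edge (i mod 5)" using assms(2) by (simp add: edge_mod)
  have pos: "0 < sn" "0 < golden * sn" using sn_pos sn_golden by auto
  from zi obtain u where u: "0 \<le> u" "u \<le> 1" and
    zu: "z = (1 - u) *\<^sub>R vtx (i mod 5) + u *\<^sub>R vtx (i mod 5 + 1)" by (rule edge_cases)
  then have Imz: "- apo = (1 - u) * Im (vtx (i mod 5)) + u * Im (vtx (i mod 5 + 1))" using z by simp
  consider "i mod 5 = 1" | "i mod 5 = 2" | "i mod 5 = 3" | "i mod 5 = 4"
    using assms(3) by (cases i rule: mod5_cases) auto
  then show ?thesis
  proof cases
    case 1
    then have "u * sn = 0" using Imz by (simp add: Im_vtx algebra_simps)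
    then show ?thesis using zu 1 pos by simp
  next
    case 2
    then have "(1 - u) * sn + u * (golden * sn) = 0" using Imz by (simp add: Im_vtx algebra_simps)
    then have "(1 - u) * sn = 0 \<and> u * (golden * sn) = 0"
      using u pos by (meson add_nonneg_eq_0_iff diff_ge_0_iff_ge less_imp_le mult_nonneg_nonneg)
    then show ?thesis using pos by auto
  next
    case 3
    then have "(1 - u) * (golden * sn) + u * sn = 0" using Imz by (simp add: Im_vtx algebra_simps)
    then have "(1 - u) * (golden * sn) = 0 \<and> u * sn = 0"
      using u pos by (meson add_nonneg_eq_0_iff diff_ge_0_iff_ge less_imp_le mult_nonneg_nonneg)
    then show ?thesis using pos by auto
  next
    case 4
    then have "(1 - u) * sn = 0" using Imz by (simp add: Im_vtx q5 algebra_simps)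
    then show ?thesis using zu 4 pos q5 by simp
  qed
qed

lemma vtx_rot_range: "zeta j * z \<in> range vtx \<longleftrightarrow> z \<in> range vtx"
proof -
  have *: "zeta j * z \<in> range vtx" if "z \<in> range vtx" for j z
    using that by (auto simp flip: vtx_add)
  show ?thesis using *[of z j] *[of "zeta j * z" "- j"] by (metis zeta_cancel(2))
qed

lemma edge_inter:
  assumes "z \<in> edge i" "z \<in> edge j" "z \<notin> range vtx"
  shows "i mod 5 = j mod 5"
proof -
  define w where "w = zeta (- i) * z"
  have "w \<in> edge 0" using edge_rot_iff[of "- i" z i] assms(1) by (simp add: w_def)
  moreover have "w \<in> edge (j - i)" using edge_rot_iff[of "- i" z j] assms(2) by (simp add: w_def)
  moreover have "w \<notin> range vtx" using assms(3) by (simp only: w_def vtx_rot_range not_False_eq_True)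
  ultimately have "(j - i) mod 5 = 0" using edge_0_inter by blast
  then show ?thesis by (metis mod_0_imp_dvd mod_eq_dvd_iff)
qed

text \<open>If z lies on side i of Q, its position relative to the neighboring -Q is z - mid2 i. The
  change of sign turns it into a point of Q again, on the same side.\<close>

lemma edge_reflect: "z \<in> edge i \<Longrightarrow> mid2 i - z \<in> edge i"
proof -
  assume "z \<in> edge i"
  then obtain u where u: "0 \<le> u" "u \<le> 1" "z = (1 - u) *\<^sub>R vtx i + u *\<^sub>R vtx (i + 1)" by (rule edge_cases)
  then have "mid2 i - z = (1 - (1 - u)) *\<^sub>R vtx i + (1 - u) *\<^sub>R vtx (i + 1)"
    by (simp add: mid2_def algebra_simps)
  then show ?thesis using segment_point[of "1 - u" "vtx i" "vtx (i + 1)"] u by (simp add: edge_def)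
qed

lemma edge_range_vtx:
  assumes "z \<in> edge i" "z \<in> range vtx" shows "z = vtx i \<or> z = vtx (i + 1)"
proof -
  define w where "w = zeta (- i) * z"
  have "w \<in> edge 0" using edge_rot_iff[of "- i" z i] assms(1) by (simp add: w_def)
  then have Imw: "Im w = - apo" by (simp add: edge_0_iff)
  have "w \<in> range vtx" using assms(2) by (simp only: w_def vtx_rot_range)
  then have "w \<in> {vtx 0, vtx 1, vtx 2, vtx 3, vtx 4}" by (simp only: range_vtx)
  then have "w = vtx 0 \<or> w = vtx 1"
    using Imw sn_pos sn_golden by (auto simp: Im_vtx)
  moreover have "z = zeta i * w" by (simp add: w_def)
  ultimately show ?thesis using vtx_add[of 0 i] vtx_add[of 1 i] by (auto simp: ac_simps)
qed

lemma edge_reflect_vertex: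
  assumes "z \<in> edge i" shows "mid2 i - z \<in> range vtx \<longleftrightarrow> z \<in> range vtx"
proof -
  have *: "mid2 i - z \<in> range vtx" if "z \<in> edge i" "z \<in> range vtx" for z
    using edge_range_vtx[OF that] by (auto simp: mid2_def)
  show ?thesis using *[of z] *[of "mid2 i - z"] assms edge_reflect[OF assms] by auto
qed

lemma pent_neg_cnj: "z \<in> pent \<Longrightarrow> - cnj z \<in> pent"
  by (simp add: pent_iff)

lemma edge_neg_cnj:
  assumes "z \<in> edge i" shows "- cnj z \<in> edge (- i)"
proof -
  obtain u where u: "0 \<le> u" "u \<le> 1" "z = (1 - u) *\<^sub>R vtx i + u *\<^sub>R vtx (i + 1)" using assms by (rule edge_cases)
  have "- cnj z = (1 - (1 - u)) *\<^sub>R vtx (- i) + (1 - u) *\<^sub>R vtx (- i + 1)"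
    unfolding u(3) by (simp add: cnj_vtx algebra_simps)
  then show ?thesis using segment_point[of "1 - u" "vtx (- i)" "vtx (- i + 1)"] u by (simp add: edge_def)
qed

lemma bounded_pent: "bounded pent"
  unfolding pent_def range_vtx by (intro finite_imp_bounded_convex_hull) simp

text \<open>The labels of the double pentagon are the polygons themselves, so Q and -Q have to be
  different sets: the opposite of the top vertex lies below the bottom side.\<close>

lemma vtx_3_pent: "- vtx 3 \<notin> pent"
proof -
  have "apo * 2 < golden * sn"
  proof -
    have "5 / 3 < sqrt 5" by (rule real_less_rsqrt) (simp add: power2_eq_square)
    then have "4 / 3 < golden" by (simp add: golden_def)
    then have "2 * (2 + golden) < 5 * golden" by argo
    then have "sn * (2 * (2 + golden)) < sn * (5 * golden)" using sn_pos by simp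
    then show ?thesis by (simp add: apo_def field_simps)
  qed
  then show ?thesis by (simp add: pent_iff vtx_3)
qed


section \<open>Straight trajectories on surfaces tiled by pentagons\<close>

text \<open>Connectedness of the interval. The hypotheses are one-sided because trajectories are
  given by separate germs before and after each time.\<close>

lemma const_on_interval:
  fixes P :: "real \<Rightarrow> bool"
  assumes "a \<le> b"
    and right: "\<And>t. a \<le> t \<Longrightarrow> t < b \<Longrightarrow> \<exists>\<delta>>0. \<forall>s\<in>{0..\<delta>}. t + s \<le> b \<longrightarrow> P (t + s) = P t"
    and left: "\<And>t. a < t \<Longrightarrow> t \<le> b \<Longrightarrow> \<exists>\<delta>>0. \<forall>s\<in>{0..\<delta>}. a \<le> t - s \<longrightarrow> P (t - s) = P t"
  shows "P a = P b"
proof -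
  have "(P a = P b)"
  proof (rule connected_induction_simple[of "{a..b}" a b "\<lambda>t. P a = P t"])
    show "connected {a..b}" "a \<in> {a..b}" "b \<in> {a..b}" "P a = P a" using assms by auto
    fix t assume t: "t \<in> {a..b}"
    obtain \<delta>1 where \<delta>1: "\<delta>1 > 0" "\<forall>s\<in>{0..\<delta>1}. t + s \<le> b \<longrightarrow> P (t + s) = P t"
    proof (cases "t < b")
      case True
      then show ?thesis using right[of t] t that by auto
    next
      case False
      then have "s = 0" if "0 \<le> s" "t + s \<le> b" for s using that t by auto
      then have "\<forall>s\<in>{0..1}. t + s \<le> b \<longrightarrow> P (t + s) = P t"
        by (metis add_0_right atLeastAtMost_iff)
      then show ?thesis using that[of 1] by auto
    qed
    obtain \<delta>2 where \<delta>2: "\<delta>2 > 0" "\<forall>s\<in>{0..\<delta>2}. a \<le> t - s \<longrightarrow> P (t - s) = P t"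
    proof (cases "a < t")
      case True
      then show ?thesis using left[of t] t that by auto
    next
      case False
      then have "s = 0" if "0 \<le> s" "a \<le> t - s" for s using that t by auto
      then have "\<forall>s\<in>{0..1}. a \<le> t - s \<longrightarrow> P (t - s) = P t"
        by (metis diff_0_right atLeastAtMost_iff)
      then show ?thesis using that[of 1] by auto
    qed
    define \<delta> where "\<delta> = min \<delta>1 \<delta>2"
    have eq: "P x = P t" if "x \<in> {a..b} \<inter> ball t \<delta>" for x
    proof (cases "t \<le> x")
      case True
      then have "x - t \<in> {0..\<delta>1}" using that by (auto simp: \<delta>_def dist_real_def)
      then show ?thesis using \<delta>1(2) that by fastforce
    next
      case False
      then have "t - x \<in> {0..\<delta>2}" using that by (auto simp: \<delta>_def dist_real_def)
      then show ?thesis using \<delta>2(2) that by fastforce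
    qed
    have "openin (top_of_set {a..b}) ({a..b} \<inter> ball t \<delta>)" by (simp add: openin_open_Int)
    moreover have "t \<in> {a..b} \<inter> ball t \<delta>" using t \<delta>1(1) \<delta>2(1) by (simp add: \<delta>_def)
    ultimately show "\<exists>T. openin (top_of_set {a..b}) T \<and> t \<in> T \<and>
        (\<forall>x\<in>T. \<forall>y\<in>T. (P a = P x) \<longrightarrow> (P a = P y))"
      using eq by blast
  qed
  then show ?thesis .
qed

lemma const_on_reals:
  fixes P :: "real \<Rightarrow> bool"
  assumes "\<And>t. \<exists>\<delta>>0. \<forall>s\<in>{0..\<delta>}. P (t + s) = P t"
    and "\<And>t. \<exists>\<delta>>0. \<forall>s\<in>{0..\<delta>}. P (t - s) = P t"
  shows "P a = P b"
proof -
  have "P a = P b" if "a \<le> b" for a b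
  proof (rule const_on_interval[OF that])
    fix t
    show "\<exists>\<delta>>0. \<forall>s\<in>{0..\<delta>}. t + s \<le> b \<longrightarrow> P (t + s) = P t" using assms(1)[of t] by blast
    show "\<exists>\<delta>>0. \<forall>s\<in>{0..\<delta>}. a \<le> t - s \<longrightarrow> P (t - s) = P t" using assms(2)[of t] by blast
  qed
  then show ?thesis by (metis nle_le)
qed

section \<open>Gluing classes and operations on trajectories\<close>

definition glue_rel :: "'l glued_surface \<Rightarrow> (('l \<times> complex) \<times> ('l \<times> complex)) set" where
  "glue_rel M = gluing M \<union> (gluing M)\<inverse>"

lemma surface_pt_eq: "surface_pt M a = (glue_rel M)\<^sup>* `` {a}"
  by (simp add: surface_pt_def glue_rel_def)

lemma sym_glue_rel: "sym (glue_rel M)"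
  by (auto simp: sym_def glue_rel_def)

lemma surface_pt_mem_iff: "b \<in> surface_pt M a \<longleftrightarrow> (a, b) \<in> (glue_rel M)\<^sup>*"
  by (simp add: surface_pt_eq)

lemma surface_pt_self [simp]: "a \<in> surface_pt M a"
  by (simp add: surface_pt_mem_iff)

lemma surface_pt_mem_eq: "b \<in> surface_pt M a \<longleftrightarrow> surface_pt M b = surface_pt M a"
proof
  assume "b \<in> surface_pt M a"
  then have ab: "(a, b) \<in> (glue_rel M)\<^sup>*" by (simp add: surface_pt_mem_iff)
  then have ba: "(b, a) \<in> (glue_rel M)\<^sup>*" using sym_rtrancl[OF sym_glue_rel] by (metis symD)
  show "surface_pt M b = surface_pt M a"
    unfolding surface_pt_eq using ab ba by (auto intro: rtrancl_trans)
qed (metis surface_pt_self)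

lemma surface_pt_glue: "(a, b) \<in> glue_rel M \<Longrightarrow> surface_pt M a = surface_pt M b"
  using surface_pt_mem_eq[of b M a] surface_pt_mem_iff[of b M a] by (simp add: r_into_rtrancl)

text \<open>The sign \<epsilon> treats the germs after and before t together: a germ before t is a
  germ of velocity -d in reversed time.\<close>

lemma straight_trajectoryD_dir:
  assumes "straight_trajectory M d \<gamma>" "\<epsilon> = 1 \<or> \<epsilon> = - 1"
  obtains \<delta> l y where "\<delta> > 0" "l \<in> faces M" "\<gamma> t = surface_pt M (l, y)"
    "\<And>s. 0 \<le> s \<Longrightarrow> s \<le> \<delta> \<Longrightarrow> y + of_real s * (of_real \<epsilon> * d) \<in> face M l"
    "\<And>s. 0 \<le> s \<Longrightarrow> s \<le> \<delta> \<Longrightarrow> \<gamma> (t + \<epsilon> * s) = surface_pt M (l, y + of_real s * (of_real \<epsilon> * d))"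
proof -
  obtain \<delta> l l' y y' where *: "\<delta> > 0" "l \<in> faces M" "l' \<in> faces M"
    "\<gamma> t = surface_pt M (l, y)" "\<gamma> t = surface_pt M (l', y')"
    "\<forall>s\<in>{0..\<delta>}. y - of_real s * d \<in> face M l \<and> \<gamma> (t - s) = surface_pt M (l, y - of_real s * d) \<and>
      y' + of_real s * d \<in> face M l' \<and> \<gamma> (t + s) = surface_pt M (l', y' + of_real s * d)"
    using assms(1) unfolding straight_trajectory_def by meson
  show thesis using assms(2)
  proof
    assume "\<epsilon> = 1"
    then show thesis using * by (intro that[of \<delta> l' y']) auto
  next
    assume "\<epsilon> = - 1"
    then show thesis using * by (intro that[of \<delta> l y]) auto
  qed
qed

lemma straight_trajectoryI:
  assumes "\<And>t l c. l \<in> faces M \<Longrightarrow> c \<in> corners M l \<Longrightarrow> (l, c) \<notin> \<gamma> t"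
    and "\<And>t \<epsilon> :: real. \<epsilon> = 1 \<or> \<epsilon> = - 1 \<Longrightarrow> \<exists>\<delta>>0. \<exists>l\<in>faces M. \<exists>y. \<forall>s. 0 \<le> s \<longrightarrow> s \<le> \<delta> \<longrightarrow>
      y + of_real s * (of_real \<epsilon> * d) \<in> face M l \<and>
      \<gamma> (t + \<epsilon> * s) = surface_pt M (l, y + of_real s * (of_real \<epsilon> * d))"
  shows "straight_trajectory M d \<gamma>"
  unfolding straight_trajectory_def
proof (intro allI conjI ballI)
  fix t
  obtain \<delta>1 l y where 1: "\<delta>1 > 0" "l \<in> faces M"
    "\<And>s. 0 \<le> s \<Longrightarrow> s \<le> \<delta>1 \<Longrightarrow> y - of_real s * d \<in> face M l \<and> \<gamma> (t - s) = surface_pt M (l, y - of_real s * d)"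
    using assms(2)[of "- 1" t] by auto
  obtain \<delta>2 l' y' where 2: "\<delta>2 > 0" "l' \<in> faces M"
    "\<And>s. 0 \<le> s \<Longrightarrow> s \<le> \<delta>2 \<Longrightarrow> y' + of_real s * d \<in> face M l' \<and> \<gamma> (t + s) = surface_pt M (l', y' + of_real s * d)"
    using assms(2)[of 1 t] by auto
  show "\<exists>\<delta>>0. \<exists>l\<in>faces M. \<exists>l'\<in>faces M. \<exists>y y'.
        \<gamma> t = surface_pt M (l, y) \<and> \<gamma> t = surface_pt M (l', y') \<and>
        (\<forall>s\<in>{0..\<delta>}. y - of_real s * d \<in> face M l \<and>
          \<gamma> (t - s) = surface_pt M (l, y - of_real s * d) \<and>
          y' + of_real s * d \<in> face M l' \<and> \<gamma> (t + s) = surface_pt M (l', y' + of_real s * d))"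
    using 1 2 1(3)[of 0] 2(3)[of 0]
    by (intro exI[of _ "min \<delta>1 \<delta>2"] conjI bexI[of _ l] bexI[of _ l'] exI[of _ y] exI[of _ y']) auto
qed (use assms(1) in auto)

lemma straight_trajectory_shift:
  assumes "straight_trajectory M d \<gamma>" shows "straight_trajectory M d (\<lambda>t. \<gamma> (t + T))"
proof (rule straight_trajectoryI)
  show "(l, c) \<notin> \<gamma> (t + T)" if "l \<in> faces M" "c \<in> corners M l" for t l c
    using assms that unfolding straight_trajectory_def by blast
  fix t \<epsilon> :: real assume "\<epsilon> = 1 \<or> \<epsilon> = - 1"
  then obtain \<delta> l y where "\<delta> > 0" "l \<in> faces M" 
    "\<And>s. 0 \<le> s \<Longrightarrow> s \<le> \<delta> \<Longrightarrow> y + of_real s * (of_real \<epsilon> * d) \<in> face M l"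
    "\<And>s. 0 \<le> s \<Longrightarrow> s \<le> \<delta> \<Longrightarrow> \<gamma> (t + T + \<epsilon> * s) = surface_pt M (l, y + of_real s * (of_real \<epsilon> * d))"
    using straight_trajectoryD_dir[OF assms, of \<epsilon> "t + T"] by metis
  then show "\<exists>\<delta>>0. \<exists>l\<in>faces M. \<exists>y. \<forall>s. 0 \<le> s \<longrightarrow> s \<le> \<delta> \<longrightarrow>
      y + of_real s * (of_real \<epsilon> * d) \<in> face M l \<and>
      \<gamma> (t + \<epsilon> * s + T) = surface_pt M (l, y + of_real s * (of_real \<epsilon> * d))"
    by (intro exI[of _ \<delta>] conjI bexI[of _ l] exI[of _ y]) (auto simp: ac_simps)
qed

lemma straight_trajectory_reverse:
  assumes "straight_trajectory M d \<gamma>" shows "straight_trajectory M (- d) (\<lambda>t. \<gamma> (- t))"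
proof (rule straight_trajectoryI)
  show "(l, c) \<notin> \<gamma> (- t)" if "l \<in> faces M" "c \<in> corners M l" for t l c
    using assms that unfolding straight_trajectory_def by blast
  fix t \<epsilon> :: real assume "\<epsilon> = 1 \<or> \<epsilon> = - 1"
  then have "- \<epsilon> = 1 \<or> - \<epsilon> = - 1" by auto
  then obtain \<delta> l y where "\<delta> > 0" "l \<in> faces M" 
    "\<And>s. 0 \<le> s \<Longrightarrow> s \<le> \<delta> \<Longrightarrow> y + of_real s * (of_real (- \<epsilon>) * d) \<in> face M l"
    "\<And>s. 0 \<le> s \<Longrightarrow> s \<le> \<delta> \<Longrightarrow> \<gamma> (- t + - \<epsilon> * s) = surface_pt M (l, y + of_real s * (of_real (- \<epsilon>) * d))"
    using straight_trajectoryD_dir[OF assms, of "- \<epsilon>" "- t"] by metis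
  then show "\<exists>\<delta>>0. \<exists>l\<in>faces M. \<exists>y. \<forall>s. 0 \<le> s \<longrightarrow> s \<le> \<delta> \<longrightarrow>
      y + of_real s * (of_real \<epsilon> * - d) \<in> face M l \<and>
      \<gamma> (- (t + \<epsilon> * s)) = surface_pt M (l, y + of_real s * (of_real \<epsilon> * - d))"
    by (intro exI[of _ \<delta>] conjI bexI[of _ l] exI[of _ y]) (auto simp: ac_simps)
qed

text \<open>A relabeling f together with a map A of the plane acts on classes. The inverse pair g, B
  has to preserve the gluing as well, so that the image of a class is a full class.\<close>

lemma straight_trajectory_image:
  fixes f g :: "'l \<Rightarrow> 'l" and A B :: "complex \<Rightarrow> complex"
  assumes st: "straight_trajectory M d \<gamma>"
    and lin: "\<And>y s. A (y + of_real s * d) = A y + of_real s * d'"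
    and inv: "\<And>l. g (f l) = l" "\<And>l. f (g l) = l" "\<And>y. B (A y) = y" "\<And>y. A (B y) = y"
    and fA: "\<And>l y l' y'. ((l, y), (l', y')) \<in> glue_rel M \<Longrightarrow> ((f l, A y), (f l', A y')) \<in> glue_rel M"
    and gB: "\<And>l y l' y'. ((l, y), (l', y')) \<in> glue_rel M \<Longrightarrow> ((g l, B y), (g l', B y')) \<in> glue_rel M"
    and face: "\<And>l. l \<in> faces M \<Longrightarrow> f l \<in> faces M" "\<And>l y. l \<in> faces M \<Longrightarrow> y \<in> face M l \<Longrightarrow> A y \<in> face M (f l)"
    and corner: "\<And>l. l \<in> faces M \<Longrightarrow> g l \<in> faces M"
      "\<And>l y. l \<in> faces M \<Longrightarrow> y \<in> corners M l \<Longrightarrow> B y \<in> corners M (g l)"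
  shows "straight_trajectory M d' (\<lambda>t. map_prod f A ` \<gamma> t)"
    and "map_prod f A ` surface_pt M (l, y) = surface_pt M (f l, A y)"
proof -
  have r1: "(map_prod f A a, map_prod f A b) \<in> (glue_rel M)\<^sup>*" if "(a, b) \<in> (glue_rel M)\<^sup>*" for a b
    using that
  proof (induction rule: rtrancl_induct)
    case (step b c)
    then have "(map_prod f A b, map_prod f A c) \<in> glue_rel M"
      using fA[of "fst b" "snd b" "fst c" "snd c"] by (cases b; cases c) simp
    then show ?case using step by simp
  qed simp
  have r2: "(map_prod g B a, map_prod g B b) \<in> (glue_rel M)\<^sup>*" if "(a, b) \<in> (glue_rel M)\<^sup>*" for a b
    using that
  proof (induction rule: rtrancl_induct)
    case (step b c)
    then have "(map_prod g B b, map_prod g B c) \<in> glue_rel M"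
      using gB[of "fst b" "snd b" "fst c" "snd c"] by (cases b; cases c) simp
    then show ?case using step by simp
  qed simp
  have gf: "map_prod g B (map_prod f A a) = a" "map_prod f A (map_prod g B a) = a" for a
    using inv by (cases a; simp)+
  show img: "map_prod f A ` surface_pt M (l, y) = surface_pt M (f l, A y)" for l y
  proof
    show "map_prod f A ` surface_pt M (l, y) \<subseteq> surface_pt M (f l, A y)"
      using r1[of "(l, y)"] by (auto simp: surface_pt_mem_iff)
    show "surface_pt M (f l, A y) \<subseteq> map_prod f A ` surface_pt M (l, y)"
    proof
      fix b assume "b \<in> surface_pt M (f l, A y)"
      then have "map_prod g B b \<in> surface_pt M (l, y)"
        using r2[of "(f l, A y)" b] inv by (simp add: surface_pt_mem_iff)
      then show "b \<in> map_prod f A ` surface_pt M (l, y)" using gf(2)[of b] by (metis image_eqI)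
    qed
  qed
  show "straight_trajectory M d' (\<lambda>t. map_prod f A ` \<gamma> t)"
  proof (rule straight_trajectoryI)
    fix t l c assume l: "l \<in> faces M" "c \<in> corners M l"
    show "(l, c) \<notin> map_prod f A ` \<gamma> t"
    proof
      assume "(l, c) \<in> map_prod f A ` \<gamma> t"
      then obtain l0 y0 where "(l0, y0) \<in> \<gamma> t" "l = f l0" "c = A y0" by auto
      then have "(g l, B c) \<in> \<gamma> t" using inv by simp
      moreover have "g l \<in> faces M" "B c \<in> corners M (g l)" using corner l by auto
      ultimately show False using st unfolding straight_trajectory_def by blast
    qed
  next
    fix t \<epsilon> :: real assume \<epsilon>: "\<epsilon> = 1 \<or> \<epsilon> = - 1"
    obtain \<delta> l y where *: "\<delta> > 0" "l \<in> faces M" 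
      "\<And>s. 0 \<le> s \<Longrightarrow> s \<le> \<delta> \<Longrightarrow> y + of_real s * (of_real \<epsilon> * d) \<in> face M l"
      "\<And>s. 0 \<le> s \<Longrightarrow> s \<le> \<delta> \<Longrightarrow> \<gamma> (t + \<epsilon> * s) = surface_pt M (l, y + of_real s * (of_real \<epsilon> * d))"
      using straight_trajectoryD_dir[OF st \<epsilon>, of t] by metis
    have A: "A (y + of_real s * (of_real \<epsilon> * d)) = A y + of_real s * (of_real \<epsilon> * d')" for s
      using lin[of y "s * \<epsilon>"] by (simp add: mult.assoc)
    show "\<exists>\<delta>>0. \<exists>l\<in>faces M. \<exists>y. \<forall>s. 0 \<le> s \<longrightarrow> s \<le> \<delta> \<longrightarrow>
      y + of_real s * (of_real \<epsilon> * d') \<in> face M l \<and>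
      map_prod f A ` \<gamma> (t + \<epsilon> * s) = surface_pt M (l, y + of_real s * (of_real \<epsilon> * d'))"
    proof (intro exI[of _ \<delta>] conjI bexI[of _ "f l"] exI[of _ "A y"] allI impI)
      fix s assume s: "0 \<le> s" "s \<le> \<delta>"
      show "A y + of_real s * (of_real \<epsilon> * d') \<in> face M (f l)"
        using face(2)[OF *(2) *(3)[OF s]] by (simp add: A)
      show "map_prod f A ` \<gamma> (t + \<epsilon> * s) = surface_pt M (f l, A y + of_real s * (of_real \<epsilon> * d'))"
        unfolding *(4)[OF s] img A ..
    qed (use * face in auto)
  qed
qed

section \<open>Surfaces tiled by copies of Q and -Q\<close>

text \<open>The common frame of the double pentagon and the necklace: face l is Q or -Q according to
  the sign \<open>e l\<close>, and \<open>nb i l\<close> is the face across side i. Multiplication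
  by the sign normalizes all faces to Q and makes crossing side i the map z -> mid2 i - z.\<close>

locale pentagon_surface =
  fixes M :: "'l glued_surface" and e :: "'l \<Rightarrow> real" and nb :: "int \<Rightarrow> 'l \<Rightarrow> 'l"
  assumes e: "l \<in> faces M \<Longrightarrow> e l = 1 \<or> e l = - 1"
    and face: "l \<in> faces M \<Longrightarrow> face M l = {y. of_real (e l) * y \<in> pent}"
    and corners: "l \<in> faces M \<Longrightarrow> corners M l = {y. of_real (e l) * y \<in> range vtx}"
    and nb_face: "l \<in> faces M \<Longrightarrow> nb i l \<in> faces M"
    and e_nb: "l \<in> faces M \<Longrightarrow> e (nb i l) = - e l"
    and nb_nb: "l \<in> faces M \<Longrightarrow> nb i (nb i l) = l"
    and nb_mod: "l \<in> faces M \<Longrightarrow> nb (i mod 5) l = nb i l"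
    and glue_iff: "(a, b) \<in> glue_rel M \<longleftrightarrow>
      (\<exists>l\<in>faces M. \<exists>i y. a = (l, y) \<and> of_real (e l) * y \<in> edge i \<and> b = (nb i l, y - of_real (e l) * mid2 i))"
begin

definition regular :: "'l \<times> complex \<Rightarrow> bool" where
  "regular a \<longleftrightarrow> fst a \<in> faces M \<and> of_real (e (fst a)) * snd a \<in> pent - range vtx"

lemma glue_regular:
  assumes "((l, y), (l', y')) \<in> glue_rel M"
  shows "l \<in> faces M" "l' \<in> faces M" "of_real (e l) * y \<in> pent" "of_real (e l') * y' \<in> pent"
    "of_real (e l) * y \<in> range vtx \<longleftrightarrow> of_real (e l') * y' \<in> range vtx"
proof -
  obtain i where i: "l \<in> faces M" "of_real (e l) * y \<in> edge i" "l' = nb i l" "y' = y - of_real (e l) * mid2 i"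
    using assms unfolding glue_iff by auto
  have y': "of_real (e l') * y' = mid2 i - of_real (e l) * y"
    using i e[of l] by (auto simp: e_nb)
  show "l \<in> faces M" "l' \<in> faces M" using i nb_face by auto
  show "of_real (e l) * y \<in> pent" "of_real (e l') * y' \<in> pent"
    unfolding y' using edge_reflect[OF i(2)] i(2) edge_subset_pent by auto
  show "of_real (e l) * y \<in> range vtx \<longleftrightarrow> of_real (e l') * y' \<in> range vtx"
    unfolding y' using edge_reflect_vertex[OF i(2)] by simp
qed

text \<open>A point that is not a vertex lies on at most one side, and crossing that side twice
  leads back. Hence its class has at most two representatives, although the gluing is closed
  transitively.\<close>

lemma class_cases:
  assumes "regular (l, y)" "(l', y') \<in> surface_pt M (l, y)"
  shows "regular (l', y')"
    "(l', y') = (l, y) \<or> (\<exists>i. of_real (e l) * y \<in> edge i \<and> l' = nb i l \<and> y' = y - of_real (e l) * mid2 i)"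
proof -
  have "((l, y), (l', y')) \<in> (glue_rel M)\<^sup>*" using assms(2) by (simp add: surface_pt_mem_iff)
  then have "regular (l', y') \<and> ((l', y') = (l, y) \<or> ((l, y), (l', y')) \<in> glue_rel M)"
  proof (induction "(l', y')" arbitrary: l' y' rule: rtrancl_induct)
    case base
    then show ?case using assms(1) by simp
  next
    case (step b l'' y'')
    obtain l' y' where b: "b = (l', y')" by (cases b)
    have reg: "regular (l', y')" using step b by blast
    then have reg2: "regular (l'', y'')" using glue_regular[of l' y' l'' y''] step(2) b by (auto simp: regular_def)
    have "(l', y') = (l, y) \<or> ((l, y), (l', y')) \<in> glue_rel M" using step b by blast
    then show ?case
    proof
      assume "(l', y') = (l, y)" then show ?thesis using step(2) b reg2 by simp
    next
      assume "((l, y), (l', y')) \<in> glue_rel M"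
      then obtain i where i: "l \<in> faces M" "of_real (e l) * y \<in> edge i" "l' = nb i l" "y' = y - of_real (e l) * mid2 i"
        unfolding glue_iff by auto
      obtain j where j: "of_real (e l') * y' \<in> edge j" "l'' = nb j l'" "y'' = y' - of_real (e l') * mid2 j"
        using step(2) b unfolding glue_iff by auto
      have y': "of_real (e l') * y' = mid2 i - of_real (e l) * y"
        using i e[of l] by (auto simp: e_nb)
      then have "of_real (e l') * y' \<in> edge i" using edge_reflect[OF i(2)] by simp
      then have ij: "i mod 5 = j mod 5" using edge_inter[OF _ j(1)] reg by (auto simp: regular_def)
      have "l' \<in> faces M" using i nb_face by auto
      then have "l'' = nb i l'" using j(2) ij nb_mod by metis
      then have "l'' = l" using i nb_nb by simp
      moreover have "mid2 j = mid2 i" using ij mid2_mod by metis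
      then have "y'' = y" using j(3) i e_nb by simp
      ultimately show ?thesis using reg2 by simp
    qed
  qed
  then show "regular (l', y')"
    "(l', y') = (l, y) \<or> (\<exists>i. of_real (e l) * y \<in> edge i \<and> l' = nb i l \<and> y' = y - of_real (e l) * mid2 i)"
    unfolding glue_iff by auto
qed

lemma surface_pt_nb:
  assumes "l \<in> faces M" "of_real (e l) * y \<in> edge i"
  shows "surface_pt M (nb i l, y - of_real (e l) * mid2 i) = surface_pt M (l, y)"
  using assms by (intro surface_pt_glue[symmetric]) (auto simp: glue_iff)

lemma regular_no_corner:
  assumes "regular a" "l \<in> faces M" "c \<in> corners M l" shows "(l, c) \<notin> surface_pt M a"
proof
  assume "(l, c) \<in> surface_pt M a"
  then have "regular (l, c)" using class_cases(1) assms(1) by (metis surj_pair)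
  then show False using assms corners by (auto simp: regular_def)
qed

lemma trajectory_regular:
  assumes "straight_trajectory M d \<gamma>" "(l, y) \<in> \<gamma> t"
  shows "regular (l, y)" "\<gamma> t = surface_pt M (l, y)"
proof -
  obtain \<delta> l0 y0 where *: "\<delta> > 0" "l0 \<in> faces M" "\<gamma> t = surface_pt M (l0, y0)"
    "\<And>s. 0 \<le> s \<Longrightarrow> s \<le> \<delta> \<Longrightarrow> y0 + of_real s * (of_real 1 * d) \<in> face M l0"
    using straight_trajectoryD_dir[OF assms(1), of 1 t] by metis
  have "y0 \<in> face M l0" using *(1) *(4)[of 0] by simp
  moreover have "y0 \<notin> corners M l0"
    using assms(1) *(2,3) surface_pt_self unfolding straight_trajectory_def by metis
  ultimately have "regular (l0, y0)" using *(2) face corners by (simp add: regular_def)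
  then show "regular (l, y)" using class_cases(1) assms(2) *(3) by simp
  show "\<gamma> t = surface_pt M (l, y)" using assms(2) *(3) by (simp add: surface_pt_mem_eq)
qed

text \<open>
  Two faces glued along a side lie, after the gluing translation, on different sides of its line.
  So parallel paths inside them can only have glued points if both run inside that side.
\<close>

lemma piece_agree:
  assumes l: "l \<in> faces M" "l2 \<in> faces M"
    and y: "\<And>s. 0 \<le> s \<Longrightarrow> s \<le> \<delta> \<Longrightarrow> y + of_real s * u \<in> face M l"
    and y2: "\<And>s. 0 \<le> s \<Longrightarrow> s \<le> \<delta> \<Longrightarrow> y2 + of_real s * u \<in> face M l2"
    and s0: "0 \<le> s0" "s0 \<le> \<delta>" "regular (l, y + of_real s0 * u)"
      "surface_pt M (l2, y2 + of_real s0 * u) = surface_pt M (l, y + of_real s0 * u)"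
    and s: "0 \<le> s" "s \<le> \<delta>"
  shows "surface_pt M (l2, y2 + of_real s * u) = surface_pt M (l, y + of_real s * u)"
proof -
  have "(l2, y2 + of_real s0 * u) \<in> surface_pt M (l, y + of_real s0 * u)"
    using s0(4) surface_pt_self by metis
  from class_cases(2)[OF s0(3) this] show ?thesis
  proof
    assume "\<exists>i. of_real (e l) * (y + of_real s0 * u) \<in> edge i \<and> l2 = nb i l \<and>
      y2 + of_real s0 * u = y + of_real s0 * u - of_real (e l) * mid2 i"
    then obtain i where i: "l2 = nb i l" "y2 = y - of_real (e l) * mid2 i" by auto
    define z where "z = of_real (e l) * (y + of_real s * u)"
    have z: "z \<in> pent" using y[OF s] l face by (simp add: z_def)
    have "of_real (e l2) * (y2 + of_real s * u) = mid2 i - z"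
      using e[OF l(1)] e_nb[OF l(1), of i] i by (auto simp: z_def algebra_simps)
    then have z2: "mid2 i - z \<in> pent" using y2[OF s] l face by simp
    \<comment> \<open>Both z and mid2 i - z have inner product at most 2 apo^2 with mid2 i, and the
      two add up to 4 apo^2; so both bounds are attained.\<close>
    have "Re (mid2 i * cnj (mid2 i)) = 4 * apo\<^sup>2"
      by (simp add: complex_mult_cnj cmod_power2[symmetric] norm_mid2 flip: power2_eq_square)
    then have "Re (z * cnj (mid2 i)) = 2 * apo\<^sup>2"
      using pent_halfplane(1)[OF z, of i] pent_halfplane(1)[OF z2, of i] by (simp add: ring_distribs)
    then have "z \<in> edge i" using pent_halfplane(2)[OF z] by blast
    moreover have "y2 + of_real s * u = y + of_real s * u - of_real (e l) * mid2 i" using i by simp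
    ultimately show ?thesis
      using surface_pt_nb[OF l(1), of "y + of_real s * u" i] i by (simp only: z_def)
  qed simp
qed

text \<open>By \<open>piece_agree\<close>, following the segment is a locally constant property of
  the time. Used to drive a trajectory into a vertex.\<close>

lemma trajectory_follows_segment:
  assumes st: "straight_trajectory M d \<gamma>" and "a \<le> b" and l: "l \<in> faces M"
    and y: "\<And>s. a \<le> s \<Longrightarrow> s \<le> b \<Longrightarrow> y + of_real s * d \<in> face M l"
    and s0: "s0 = a \<or> s0 = b" "\<gamma> s0 = surface_pt M (l, y + of_real s0 * d)"
  shows "\<gamma> a = surface_pt M (l, y + of_real a * d) \<and> \<gamma> b = surface_pt M (l, y + of_real b * d)"
proof -
  define P where "P t \<longleftrightarrow> \<gamma> t = surface_pt M (l, y + of_real t * d)" for t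
  have one_side: "\<exists>\<delta>>0. \<forall>s\<in>{0..\<delta>}. t + \<epsilon> * s \<in> {a..b} \<longrightarrow> P (t + \<epsilon> * s) = P t"
    if \<epsilon>: "\<epsilon> = 1 \<or> \<epsilon> = - 1" and t: "t \<in> {a..b}" for t \<epsilon>
  proof -
    obtain \<delta> l' y' where *: "\<delta> > 0" "l' \<in> faces M"
      "\<And>s. 0 \<le> s \<Longrightarrow> s \<le> \<delta> \<Longrightarrow> y' + of_real s * (of_real \<epsilon> * d) \<in> face M l'"
      "\<And>s. 0 \<le> s \<Longrightarrow> s \<le> \<delta> \<Longrightarrow> \<gamma> (t + \<epsilon> * s) = surface_pt M (l', y' + of_real s * (of_real \<epsilon> * d))"
      using straight_trajectoryD_dir[OF st \<epsilon>, of t] by metis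
    have reg: "regular (l', y' + of_real s * (of_real \<epsilon> * d))" if "0 \<le> s" "s \<le> \<delta>" for s
      using trajectory_regular(1)[OF st] *(4)[OF that] surface_pt_self by metis
    show ?thesis
    proof (intro exI[of _ \<delta>] conjI ballI impI *(1))
      fix s assume s: "s \<in> {0..\<delta>}" "t + \<epsilon> * s \<in> {a..b}"
      define y0 where "y0 = y + of_real t * d"
      have eq: "y + of_real (t + \<epsilon> * r) * d = y0 + of_real r * (of_real \<epsilon> * d)" for r
        by (simp add: y0_def algebra_simps)
      have in_ab: "t + \<epsilon> * r \<in> {a..b}" if "0 \<le> r" "r \<le> s" for r using \<epsilon> s t that by auto
      have f1: "y' + of_real r * (of_real \<epsilon> * d) \<in> face M l'" if "0 \<le> r" "r \<le> s" for r
        using *(3) s that by auto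
      have f2: "y0 + of_real r * (of_real \<epsilon> * d) \<in> face M l" if "0 \<le> r" "r \<le> s" for r
        using y[of "t + \<epsilon> * r"] in_ab[OF that] unfolding eq by simp
      have P_iff: "P (t + \<epsilon> * r) \<longleftrightarrow>
          surface_pt M (l, y0 + of_real r * (of_real \<epsilon> * d)) = surface_pt M (l', y' + of_real r * (of_real \<epsilon> * d))"
        if "0 \<le> r" "r \<le> s" for r
        unfolding P_def eq using *(4)[of r] s that by auto
      have s': "0 \<le> s" "s \<le> s" "s \<le> \<delta>" "(0::real) \<le> 0" "0 \<le> \<delta>" using s *(1) by auto
      have "P (t + \<epsilon> * s) = P (t + \<epsilon> * 0)"
        unfolding P_iff[OF s'(1,2)] P_iff[OF s'(4,1)]
        using piece_agree[OF *(2) l f1 f2 s'(1,2) reg[OF s'(1,3)] _ s'(4,1)]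
          piece_agree[OF *(2) l f1 f2 s'(4,1) reg[OF s'(4,5)] _ s'(1,2)] by blast
      then show "P (t + \<epsilon> * s) = P t" by simp
    qed
  qed
  have "P a = P b"
  proof (rule const_on_interval[OF \<open>a \<le> b\<close>])
    fix t assume "a \<le> t" "t < b"
    then obtain \<delta> where "\<delta> > 0" "\<forall>s\<in>{0..\<delta>}. t + 1 * s \<in> {a..b} \<longrightarrow> P (t + 1 * s) = P t"
      using one_side[of 1 t] by auto
    then show "\<exists>\<delta>>0. \<forall>s\<in>{0..\<delta>}. t + s \<le> b \<longrightarrow> P (t + s) = P t" using \<open>a \<le> t\<close> by (intro exI[of _ \<delta>]) auto
  next
    fix t assume "a < t" "t \<le> b"
    then obtain \<delta> where "\<delta> > 0" "\<forall>s\<in>{0..\<delta>}. t + (- 1) * s \<in> {a..b} \<longrightarrow> P (t + (- 1) * s) = P t"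
      using one_side[of "- 1" t] by auto
    then show "\<exists>\<delta>>0. \<forall>s\<in>{0..\<delta>}. a \<le> t - s \<longrightarrow> P (t - s) = P t" using \<open>t \<le> b\<close> by (intro exI[of _ \<delta>]) auto
  qed
  then show ?thesis using s0 unfolding P_def by auto
qed

text \<open>Agreement is locally constant by \<open>piece_agree\<close>. This is how closing up,
  deck transformations and reversals can be checked at a single time.\<close>

lemma trajectory_unique:
  assumes st: "straight_trajectory M d \<gamma>" "straight_trajectory M d \<gamma>'" and t0: "\<gamma> t0 = \<gamma>' t0"
  shows "\<gamma> = \<gamma>'"
proof -
  define P where "P t \<longleftrightarrow> \<gamma> t = \<gamma>' t" for t
  have one_side: "\<exists>\<delta>>0. \<forall>s\<in>{0..\<delta>}. P (t + \<epsilon> * s) = P t" if \<epsilon>: "\<epsilon> = 1 \<or> \<epsilon> = - 1" for t \<epsilon>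
  proof -
    obtain \<delta>1 l y where *: "\<delta>1 > 0" "l \<in> faces M"
      "\<And>s. 0 \<le> s \<Longrightarrow> s \<le> \<delta>1 \<Longrightarrow> y + of_real s * (of_real \<epsilon> * d) \<in> face M l"
      "\<And>s. 0 \<le> s \<Longrightarrow> s \<le> \<delta>1 \<Longrightarrow> \<gamma> (t + \<epsilon> * s) = surface_pt M (l, y + of_real s * (of_real \<epsilon> * d))"
      using straight_trajectoryD_dir[OF st(1) \<epsilon>, of t] by metis
    obtain \<delta>2 l' y' where **: "\<delta>2 > 0" "l' \<in> faces M"
      "\<And>s. 0 \<le> s \<Longrightarrow> s \<le> \<delta>2 \<Longrightarrow> y' + of_real s * (of_real \<epsilon> * d) \<in> face M l'"
      "\<And>s. 0 \<le> s \<Longrightarrow> s \<le> \<delta>2 \<Longrightarrow> \<gamma>' (t + \<epsilon> * s) = surface_pt M (l', y' + of_real s * (of_real \<epsilon> * d))"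
      using straight_trajectoryD_dir[OF st(2) \<epsilon>, of t] by metis
    define \<delta> where "\<delta> = min \<delta>1 \<delta>2"
    have \<delta>: "\<delta> > 0" using * ** by (simp add: \<delta>_def)
    have reg: "regular (l, y + of_real s * (of_real \<epsilon> * d))" if "0 \<le> s" "s \<le> \<delta>" for s
      using trajectory_regular(1)[OF st(1)] *(4)[of s] that surface_pt_self unfolding \<delta>_def by (metis min.boundedE)
    have f: "y + of_real s * (of_real \<epsilon> * d) \<in> face M l" "y' + of_real s * (of_real \<epsilon> * d) \<in> face M l'"
      if "0 \<le> s" "s \<le> \<delta>" for s using * ** that by (auto simp: \<delta>_def)
    have P_iff: "P (t + \<epsilon> * s) \<longleftrightarrow>
        surface_pt M (l', y' + of_real s * (of_real \<epsilon> * d)) = surface_pt M (l, y + of_real s * (of_real \<epsilon> * d))"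
      if "0 \<le> s" "s \<le> \<delta>" for s
      unfolding P_def using *(4)[of s] **(4)[of s] that by (auto simp: \<delta>_def)
    show ?thesis
    proof (intro exI[of _ \<delta>] conjI ballI \<delta>)
      fix s assume "s \<in> {0..\<delta>}"
      then have s: "0 \<le> s" "s \<le> \<delta>" "(0::real) \<le> 0" "0 \<le> \<delta>" by auto
      have "P (t + \<epsilon> * s) = P (t + \<epsilon> * 0)"
        unfolding P_iff[OF s(1,2)] P_iff[OF s(3,4)]
        using piece_agree[OF *(2) **(2) f(1) f(2) s(1,2) reg[OF s(1,2)] _ s(3,4)]
          piece_agree[OF *(2) **(2) f(1) f(2) s(3,4) reg[OF s(3,4)] _ s(1,2)] by blast
      then show "P (t + \<epsilon> * s) = P t" by simp
    qed
  qed
  have "P t0 = P t" for t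
    by (rule const_on_reals) (use one_side[of 1] one_side[of "- 1"] in auto)
  then show ?thesis using t0 unfolding P_def by auto
qed

end

section \<open>Horizontal strips of the double pentagon\<close>

text \<open>Decides to which of two adjacent convex pieces a segment germ belongs; if the germ
  starts on their common boundary, the slope b decides.\<close>

lemma affine_sign:
  fixes a b \<delta> :: real
  assumes "\<delta> > 0"
  shows "(\<exists>\<delta>'>0. \<delta>' \<le> \<delta> \<and> (\<forall>s. 0 \<le> s \<longrightarrow> s \<le> \<delta>' \<longrightarrow> a + s * b \<le> 0)) \<or>
    (\<exists>\<delta>'>0. \<delta>' \<le> \<delta> \<and> (\<forall>s. 0 \<le> s \<longrightarrow> s \<le> \<delta>' \<longrightarrow> a + s * b \<ge> 0))"
    and "a > 0 \<Longrightarrow> \<exists>\<delta>'>0. \<delta>' \<le> \<delta> \<and> (\<forall>s. 0 \<le> s \<longrightarrow> s \<le> \<delta>' \<longrightarrow> a + s * b \<ge> 0)"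
proof -
  have pos: "\<exists>\<delta>'>0. \<delta>' \<le> \<delta> \<and> (\<forall>s. 0 \<le> s \<longrightarrow> s \<le> \<delta>' \<longrightarrow> a + s * b \<ge> 0)" if "a > 0" for a b :: real
  proof (intro exI[of _ "min \<delta> (a / (\<bar>b\<bar> + 1))"] conjI allI impI)
    show "0 < min \<delta> (a / (\<bar>b\<bar> + 1))" using that assms by simp
    fix s assume s: "0 \<le> s" "s \<le> min \<delta> (a / (\<bar>b\<bar> + 1))"
    then have "s * (\<bar>b\<bar> + 1) \<le> a" by (simp add: pos_le_divide_eq)
    moreover have "s * - (\<bar>b\<bar> + 1) \<le> s * b" using s by (intro mult_left_mono) auto
    ultimately show "a + s * b \<ge> 0" by (simp add: algebra_simps)
  qed simp
  then show "a > 0 \<Longrightarrow> \<exists>\<delta>'>0. \<delta>' \<le> \<delta> \<and> (\<forall>s. 0 \<le> s \<longrightarrow> s \<le> \<delta>' \<longrightarrow> a + s * b \<ge> 0)" .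
  consider "a > 0" | "a < 0" | "a = 0" "b \<ge> 0" | "a = 0" "b \<le> 0" by linarith
  then show "(\<exists>\<delta>'>0. \<delta>' \<le> \<delta> \<and> (\<forall>s. 0 \<le> s \<longrightarrow> s \<le> \<delta>' \<longrightarrow> a + s * b \<le> 0)) \<or>
    (\<exists>\<delta>'>0. \<delta>' \<le> \<delta> \<and> (\<forall>s. 0 \<le> s \<longrightarrow> s \<le> \<delta>' \<longrightarrow> a + s * b \<ge> 0))"
  proof cases
    case 1
    then show ?thesis using pos by blast
  next
    case 2
    have "- a + s * - b \<ge> 0 \<longleftrightarrow> a + s * b \<le> 0" for s by auto
    then show ?thesis using pos[of "- a" "- b"] 2 by auto
  next
    case 3
    then show ?thesis using assms by (intro disjI2 exI[of _ \<delta>]) auto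
  next
    case 4
    then show ?thesis using assms by (intro disjI1 exI[of _ \<delta>]) (auto simp: mult_nonneg_nonpos)
  qed
qed

text \<open>
  A horizontal cylinder is the quotient of the strip \<open>lo \<le> Im z \<le> hi\<close> by the translation by \<open>C\<close>.  It is
  tiled alternately by parts of \<open>Q\<close> (centered at \<open>n C\<close>) and of \<open>-Q\<close> (centered at \<open>K + n C\<close>); \<open>half_width h\<close>
  is half the width of \<open>Q\<close> at height \<open>h\<close>, and \<open>rt\<close>, \<open>lf\<close> are the two sides that are crossed.
\<close>

locale strip_geometry =
  fixes lo hi C A B :: real and K :: complex and rt lf :: int and half_width :: "real \<Rightarrow> real"
  assumes lo_less_hi: "lo < hi" and C_pos: "C > 0" and Im_K: "Im K = lo + hi"
    and Q_section: "lo \<le> Im z \<Longrightarrow> Im z \<le> hi \<Longrightarrow> z \<in> pent \<longleftrightarrow> \<bar>Re z\<bar> \<le> half_width (Im z)"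
    and minus_Q_section: "lo \<le> Im z \<Longrightarrow> Im z \<le> hi \<Longrightarrow>
      K - z \<in> pent \<longleftrightarrow> \<bar>Re z - C / 2\<bar> \<le> C / 2 - half_width (Im z)"
    and half_width_affine: "half_width h = A + B * h"
    and half_width_bounds: "lo \<le> h \<Longrightarrow> h \<le> hi \<Longrightarrow> 0 \<le> half_width h \<and> half_width h \<le> C / 2"
    and right_edge: "lo \<le> Im z \<Longrightarrow> Im z \<le> hi \<Longrightarrow> Re z = half_width (Im z) \<Longrightarrow> z \<in> edge rt"
    and left_edge: "lo \<le> Im z \<Longrightarrow> Im z \<le> hi \<Longrightarrow> Re z = - half_width (Im z) \<Longrightarrow> z \<in> edge lf"
    and mid2_rt: "mid2 rt = K" and mid2_lf: "mid2 lf = K - of_real C"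
    and extreme_width: "lo \<le> Im z \<Longrightarrow> Im z \<le> hi \<Longrightarrow> \<bar>Re z\<bar> = half_width (Im z) \<Longrightarrow>
      half_width (Im z) = 0 \<or> half_width (Im z) = C / 2 \<Longrightarrow> z \<in> range vtx"
    and vertex_level: "z \<in> range vtx \<Longrightarrow> lo \<le> Im z \<Longrightarrow> Im z \<le> hi \<Longrightarrow> Im z = lo \<or> Im z = hi"

lemma Re_Im_mid2: "Re (mid2 1) = golden / 2" "Im (mid2 1) = sn - 2 * apo"
    "Re (mid2 4) = - golden / 2" "Im (mid2 4) = sn - 2 * apo"
    "Re (mid2 2) = 1 / 2" "Im (mid2 2) = (1 + golden) * sn - 2 * apo"
    "Re (mid2 3) = - 1 / 2" "Im (mid2 3) = (1 + golden) * sn - 2 * apo"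
proof -
  have q5: "vtx 5 = vtx 0" using vtx_mod[of 5] by simp
  show "Re (mid2 1) = golden / 2" "Im (mid2 1) = sn - 2 * apo"
    "Re (mid2 4) = - golden / 2" "Im (mid2 4) = sn - 2 * apo"
    "Re (mid2 2) = 1 / 2" "Im (mid2 2) = (1 + golden) * sn - 2 * apo"
    "Re (mid2 3) = - 1 / 2" "Im (mid2 3) = (1 + golden) * sn - 2 * apo"
    unfolding mid2_def by (simp_all add: vtx_0 vtx_1 vtx_2 vtx_3 vtx_4 q5 field_simps)
qed

lemma vertex_Im: "z \<in> range vtx \<Longrightarrow> Im z = - apo \<or> Im z = sn - apo \<or> Im z = golden * sn - apo"
  unfolding range_vtx by (auto simp: Im_vtx)

text \<open>The long cylinder, from the bottom side up to the horizontal diagonal, of circumference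
  phi; \<open>mid2 1\<close> and \<open>mid2 4\<close> are the centers of the copies of -Q to the
  right and to the left.\<close>

interpretation low: strip_geometry "- apo" "sn - apo" golden "low_half 0" "(2 - golden) / (2 * sn)"
  "mid2 1" 1 4 low_half
proof
  have pos: "0 < sn" "0 < golden" "sn < golden * sn" using sn_pos golden_gt_1 sn_golden by auto
  show "- apo < sn - apo" "golden > 0" using pos by auto
  show "Im (mid2 1) = - apo + (sn - apo)" by (simp add: Re_Im_mid2)
  show "low_half h = low_half 0 + (2 - golden) / (2 * sn) * h" for h
    using pos by (simp add: low_half_def field_simps)
  show "mid2 1 = mid2 1" ..
  show "mid2 4 = mid2 1 - of_real golden" by (simp add: complex_eq_iff Re_Im_mid2)
  show "0 \<le> low_half h \<and> low_half h \<le> golden / 2" if "- apo \<le> h" "h \<le> sn - apo" for h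
    using low_half_bounds[OF that] golden_gt_1 by auto
  fix z assume z: "- apo \<le> Im z" "Im z \<le> sn - apo"
  show sec: "z \<in> pent \<longleftrightarrow> \<bar>Re z\<bar> \<le> low_half (Im z)" 
  proof -
    have "z \<in> pent" if "\<bar>Re z\<bar> \<le> low_half (Im z)"
      using segment_in_pent[of "low_half (Im z)" "Im z" "Re z"] that low_half_edges[OF z] edge_subset_pent by auto
    then show ?thesis using pent_section_bounds(3) z by blast
  qed
  show "mid2 1 - z \<in> pent \<longleftrightarrow> \<bar>Re z - golden / 2\<bar> \<le> golden / 2 - low_half (Im z)"
  proof -
    define w where "w = mid2 1 - z"
    have Imw: "Im w = sn - 2 * apo - Im z" and Rew: "Re w = golden / 2 - Re z"
      by (simp_all add: w_def Re_Im_mid2)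
    have "w \<in> pent \<longleftrightarrow> \<bar>Re w\<bar> \<le> low_half (Im w)"
    proof -
      have w: "- apo \<le> Im w" "Im w \<le> sn - apo" using z by (auto simp: Imw)
      have "w \<in> pent" if "\<bar>Re w\<bar> \<le> low_half (Im w)"
        using segment_in_pent[of "low_half (Im w)" "Im w" "Re w"] that low_half_edges[OF w] edge_subset_pent by auto
      then show ?thesis using pent_section_bounds(3) w by blast
    qed
    moreover have "low_half (Im w) = golden / 2 - low_half (Im z)"
      using pos by (simp add: Imw low_half_def field_simps)
    ultimately show ?thesis unfolding Rew by (simp add: w_def abs_minus_commute)
  qed
  show "z \<in> edge 1" if "Re z = low_half (Im z)"
    using low_half_edges(1)[OF z] that by (metis complex_surj)
  show "z \<in> edge 4" if "Re z = - low_half (Im z)"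
    using low_half_edges(2)[OF z] that by (metis complex_surj)
  \<comment> \<open>Vacuous: in this strip the half width lies between (phi - 1)/2 and 1/2, strictly
    between 0 and phi/2.\<close>
  show "z \<in> range vtx" if "low_half (Im z) = 0 \<or> low_half (Im z) = golden / 2"
    using low_half_bounds[OF z] golden_gt_1 that by auto
  show "Im z = - apo \<or> Im z = sn - apo" if "z \<in> range vtx"
    using vertex_Im[OF that] z pos by auto
qed

text \<open>The short cylinder, from the diagonal up to the top vertex, of circumference 1. Here the
  width does degenerate: to 0 at the top vertex and to the full circumference along the
  diagonal.\<close>

interpretation high: strip_geometry "sn - apo" "golden * sn - apo" 1 "high_half 0" "- 1 / (2 * ((golden - 1) * sn))"
  "mid2 2" 2 3 high_half
proof
  have pos: "0 < sn" "0 < golden" "sn < golden * sn" "(golden - 1) * sn > 0"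
    using sn_pos golden_gt_1 sn_golden by auto
  show "sn - apo < golden * sn - apo" "(1::real) > 0" using pos by auto
  show "Im (mid2 2) = sn - apo + (golden * sn - apo)" by (simp add: Re_Im_mid2 algebra_simps)
  show "high_half h = high_half 0 + - 1 / (2 * ((golden - 1) * sn)) * h" for h
    using pos by (simp add: high_half_def diff_divide_distrib)
  show "mid2 2 = mid2 2" ..
  show "mid2 3 = mid2 2 - of_real 1" by (simp add: complex_eq_iff Re_Im_mid2)
  show "0 \<le> high_half h \<and> high_half h \<le> 1 / 2" if "sn - apo \<le> h" "h \<le> golden * sn - apo" for h
    using high_half_bounds[OF that] by auto
  fix z assume z: "sn - apo \<le> Im z" "Im z \<le> golden * sn - apo"
  show sec: "z \<in> pent \<longleftrightarrow> \<bar>Re z\<bar> \<le> high_half (Im z)" 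
  proof -
    have "z \<in> pent" if "\<bar>Re z\<bar> \<le> high_half (Im z)"
      using segment_in_pent[of "high_half (Im z)" "Im z" "Re z"] that high_half_edges[OF z] edge_subset_pent by auto
    then show ?thesis using pent_section_bounds(4) z by blast
  qed
  show "mid2 2 - z \<in> pent \<longleftrightarrow> \<bar>Re z - 1 / 2\<bar> \<le> 1 / 2 - high_half (Im z)"
  proof -
    define w where "w = mid2 2 - z"
    have Imw: "Im w = (1 + golden) * sn - 2 * apo - Im z" and Rew: "Re w = 1 / 2 - Re z"
      by (simp_all add: w_def Re_Im_mid2)
    have "w \<in> pent \<longleftrightarrow> \<bar>Re w\<bar> \<le> high_half (Im w)"
    proof -
      have w: "sn - apo \<le> Im w" "Im w \<le> golden * sn - apo" using z by (auto simp: Imw algebra_simps)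
      have "w \<in> pent" if "\<bar>Re w\<bar> \<le> high_half (Im w)"
        using segment_in_pent[of "high_half (Im w)" "Im w" "Re w"] that high_half_edges[OF w] edge_subset_pent by auto
      then show ?thesis using pent_section_bounds(4) w by blast
    qed
    moreover have "high_half (Im w) = 1 / 2 - high_half (Im z)"
    proof -
      define k X where "k = (golden - 1) * sn" and "X = golden * sn - apo - Im z"
      have "golden * sn - apo - Im w = k - X"
        by (simp add: Imw k_def X_def algebra_simps)
      moreover have "(k - X) / k = 1 - X / k" using pos by (simp add: k_def[symmetric] diff_divide_distrib)
      ultimately have "(golden * sn - apo - Im w) / k = 1 - X / k" by simp
      then show ?thesis unfolding high_half_def k_def[symmetric] X_def[symmetric] by simp
    qed
    ultimately show ?thesis unfolding Rew by (simp add: w_def abs_minus_commute)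
  qed
  show "z \<in> edge 2" if "Re z = high_half (Im z)"
    using high_half_edges(1)[OF z] that by (metis complex_surj)
  show "z \<in> edge 3" if "Re z = - high_half (Im z)"
    using high_half_edges(2)[OF z] that by (metis complex_surj)
  show "Im z = sn - apo \<or> Im z = golden * sn - apo" if "z \<in> range vtx"
    using vertex_Im[OF that] z pos by auto
  show "z \<in> range vtx" if x: "\<bar>Re z\<bar> = high_half (Im z)" and "high_half (Im z) = 0 \<or> high_half (Im z) = 1 / 2"
    using that(2)
  proof
    assume h: "high_half (Im z) = 0"
    then have "Im z = golden * sn - apo" using pos by (simp add: high_half_def)
    then have "z = vtx 3" using x h by (simp add: vtx_3 complex_eq_iff)
    then show ?thesis by simp
  next
    assume h: "high_half (Im z) = 1 / 2"
    then have "(golden * sn - apo - Im z) / ((golden - 1) * sn) = 1" by (simp add: high_half_def)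
    then have "golden * sn - apo - Im z = (golden - 1) * sn" using pos by (metis divide_eq_1_iff)
    then have "Im z = sn - apo" by (simp add: algebra_simps)
    moreover have "Re z = 1 / 2 \<or> Re z = - 1 / 2" using x h by auto
    ultimately have "z = vtx 2 \<or> z = vtx 4" by (auto simp: vtx_2 vtx_4 complex_eq_iff)
    then show ?thesis by auto
  qed
qed

section \<open>The double pentagon and its developed strips\<close>

definition dp_sign :: "complex set \<Rightarrow> real" where
  "dp_sign l = (if l = pent then 1 else - 1)"

definition dp_nb :: "int \<Rightarrow> complex set \<Rightarrow> complex set" where
  "dp_nb i l = uminus ` l"

abbreviation minus_pent :: "complex set" where
  "minus_pent \<equiv> uminus ` pent"

lemma minus_pent_neq: "minus_pent \<noteq> pent"
  using vtx_3_pent vtx_in_pent[of 3] by auto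

lemma dp_sign_simps [simp]: "dp_sign pent = 1" "dp_sign minus_pent = - 1"
  using minus_pent_neq by (simp_all add: dp_sign_def)

locale double_pent = pentagon_surface M dp_sign dp_nb for M +
  assumes faces_M: "faces M = {pent, minus_pent}"
begin

lemma regular_iff: "regular (pent, y) \<longleftrightarrow> y \<in> pent - range vtx"
  "regular (minus_pent, y) \<longleftrightarrow> - y \<in> pent - range vtx"
  by (simp_all add: regular_def faces_M)

lemma pt_glue: "y \<in> edge i \<Longrightarrow> surface_pt M (minus_pent, y - mid2 i) = surface_pt M (pent, y)"
  using surface_pt_nb[of pent y i] by (simp add: faces_M dp_nb_def)

lemma face_M: "y \<in> face M pent \<longleftrightarrow> y \<in> pent" "y \<in> face M minus_pent \<longleftrightarrow> - y \<in> pent"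
  using face[of pent] face[of minus_pent] by (simp_all add: faces_M)

lemma class_regular_eq:
  assumes "regular a" "surface_pt M a = surface_pt M b" shows "regular b"
  using assms class_cases(1)[of "fst a" "snd a" "fst b" "snd b"] by (metis prod.collapse surface_pt_self)

end

locale strip_surface = double_pent + strip_geometry
begin

definition in_strip :: "complex \<Rightarrow> bool" where
  "in_strip z \<longleftrightarrow> lo \<le> Im z \<and> Im z \<le> hi"

text \<open>Relates a point of the developed strip to its representatives on the surface. It is a
  relation because a point on the border of two tiles has a representative in each; for regular
  points these are glued, by \<open>tile_unique\<close>.\<close>

definition tile :: "complex \<Rightarrow> complex set \<times> complex \<Rightarrow> bool" where
  "tile z a \<longleftrightarrow> in_strip z \<and> (\<exists>n::int.
    (a = (pent, z - of_int n * of_real C) \<and> z - of_int n * of_real C \<in> pent) \<or>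
    (a = (minus_pent, z - of_int n * of_real C - K) \<and> K - (z - of_int n * of_real C) \<in> pent))"

lemma tile_face: "tile z (l, y) \<Longrightarrow> l \<in> faces M \<and> y \<in> face M l"
  unfolding tile_def using faces_M face_M by auto

lemma tile_cases:
  assumes "tile z a"
  obtains n :: int where "a = (pent, z - of_int n * of_real C)" "\<bar>Re z - of_int n * C\<bar> \<le> half_width (Im z)"
      "z - of_int n * of_real C \<in> pent"
  | n :: int where "a = (minus_pent, z - of_int n * of_real C - K)"
      "\<bar>Re z - of_int n * C - C / 2\<bar> \<le> C / 2 - half_width (Im z)" "K - (z - of_int n * of_real C) \<in> pent"
  using assms Q_section[of "z - of_int n * of_real C" for n :: int]
    minus_Q_section[of "z - of_int n * of_real C" for n :: int]
  unfolding tile_def in_strip_def by auto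

lemma tile_Q:
  assumes "in_strip z" "\<bar>Re z - of_int n * C\<bar> \<le> half_width (Im z)"
  shows "tile z (pent, z - of_int n * of_real C)"
  using assms Q_section[of "z - of_int n * of_real C"] unfolding tile_def in_strip_def by auto

lemma tile_minus_Q:
  assumes "in_strip z" "\<bar>Re z - of_int n * C - C / 2\<bar> \<le> C / 2 - half_width (Im z)"
  shows "tile z (minus_pent, z - of_int n * of_real C - K)"
  using assms minus_Q_section[of "z - of_int n * of_real C"] unfolding tile_def in_strip_def by auto

lemma tile_base:
  shows "in_strip z \<Longrightarrow> z \<in> pent \<Longrightarrow> tile z (pent, z)"
    and "in_strip z \<Longrightarrow> K - z \<in> pent \<Longrightarrow> tile z (minus_pent, z - K)"
proof -
  assume z: "in_strip z"
  have 0: "z - of_int 0 * of_real C = z" by simp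
  show "z \<in> pent \<Longrightarrow> tile z (pent, z)" unfolding tile_def using z 0 by metis
  show "K - z \<in> pent \<Longrightarrow> tile z (minus_pent, z - K)" unfolding tile_def using z 0 by metis
qed

lemma tile_shift: "tile (z + of_int m * of_real C) = tile z"
proof -
  have *: "tile z a" if asm: "tile (z + of_int m * of_real C) a" for z a m
  proof -
    obtain n :: int where
      "(a = (pent, z + of_int m * of_real C - of_int n * of_real C) \<and> z + of_int m * of_real C - of_int n * of_real C \<in> pent) \<or>
       (a = (minus_pent, z + of_int m * of_real C - of_int n * of_real C - K) \<and>
        K - (z + of_int m * of_real C - of_int n * of_real C) \<in> pent)"
      using asm unfolding tile_def by blast
    moreover have "z + of_int m * of_real C - of_int n * of_real C = z - of_int (n - m) * of_real C"
      by (simp add: algebra_simps)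
    moreover have "in_strip z" using asm by (simp add: tile_def in_strip_def)
    ultimately show ?thesis unfolding tile_def by metis
  qed
  have "tile z a \<longleftrightarrow> tile (z + of_int m * of_real C) a" for a
    using *[of z m a] *[of "z + of_int m * of_real C" "- m" a] by auto
  then show ?thesis by auto
qed

lemma half_width_in: "in_strip z \<Longrightarrow> 0 \<le> half_width (Im z) \<and> half_width (Im z) \<le> C / 2"
  using half_width_bounds by (simp add: in_strip_def)

text \<open>Translates by different multiples of C share a point only where Q is as wide as the
  circumference, and then the point is a vertex, which regularity excludes.\<close>

lemma tile_unique_Q_Q:
  assumes z: "in_strip z" and n: "\<bar>Re z - of_int n * C\<bar> \<le> half_width (Im z)" "\<bar>Re z - of_int m * C\<bar> \<le> half_width (Im z)"
    and reg: "regular (pent, z - of_int n * of_real C)"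
  shows "n = m"
proof (rule ccontr)
  assume "n \<noteq> m"
  then have "1 \<le> \<bar>n - m\<bar>" by auto
  then have "1 * C \<le> real_of_int \<bar>n - m\<bar> * C" using C_pos by (intro mult_right_mono) auto
  also have "\<dots> = \<bar>of_int n * C - of_int m * C\<bar>" using C_pos by (simp add: abs_mult left_diff_distrib[symmetric])
  finally have *: "C \<le> \<bar>of_int n * C - of_int m * C\<bar>" by simp
  then have hw: "half_width (Im z) = C / 2" "\<bar>Re z - of_int n * C\<bar> = half_width (Im z)"
    using * n half_width_in[OF z] by linarith+
  have "z - of_int n * of_real C \<in> range vtx"
    using extreme_width[of "z - of_int n * of_real C"] hw z by (simp add: in_strip_def)
  then show False using reg by (simp add: regular_iff)
qed

text \<open>Different copies of -Q touch each other only where Q has width 0, and there again the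
  point is a vertex.\<close>

lemma tile_unique_mQ_mQ:
  assumes z: "in_strip z" and n: "\<bar>Re z - of_int n * C - C / 2\<bar> \<le> C / 2 - half_width (Im z)"
      "\<bar>Re z - of_int m * C - C / 2\<bar> \<le> C / 2 - half_width (Im z)"
    and reg: "regular (minus_pent, z - of_int n * of_real C - K)"
  shows "n = m"
proof (rule ccontr)
  assume "n \<noteq> m"
  then have "1 \<le> \<bar>n - m\<bar>" by auto
  then have "1 * C \<le> real_of_int \<bar>n - m\<bar> * C" using C_pos by (intro mult_right_mono) auto
  also have "\<dots> = \<bar>of_int n * C - of_int m * C\<bar>" using C_pos by (simp add: abs_mult left_diff_distrib[symmetric])
  finally have *: "C \<le> \<bar>of_int n * C - of_int m * C\<bar>" by simp
  then have hw: "half_width (Im z) = 0" "Re z - of_int n * C = 0 \<or> Re z - of_int n * C = C"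
    using * n half_width_in[OF z] by linarith+
  define z' where "z' = z - of_int n * of_real C"
  have z': "lo \<le> Im z'" "Im z' \<le> hi" "Im z' = Im z" "Re z' = 0 \<or> Re z' = C"
    using z hw by (auto simp: in_strip_def z'_def)
  have "K - z' \<in> range vtx"
    using z'(4)
  proof
    assume "Re z' = 0"
    then have "z' \<in> edge rt" "z' \<in> range vtx"
      using right_edge[of z'] extreme_width[of z'] z' hw by auto
    then show ?thesis using edge_reflect_vertex[of z' rt] mid2_rt by simp
  next
    assume "Re z' = C"
    define w where "w = z' - of_real C"
    have "w \<in> edge lf" "w \<in> range vtx"
      using left_edge[of w] extreme_width[of w] z' hw \<open>Re z' = C\<close> by (auto simp: w_def)
    then show ?thesis using edge_reflect_vertex[of w lf] mid2_lf by (simp add: w_def)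
  qed
  then show False using reg by (simp add: regular_iff z'_def)
qed

text \<open>The copies of -Q that touch the n-th Q have index n on its right and n - 1 on its left.
  The common points lie on the sides \<open>rt\<close> and \<open>lf\<close>, and the gluing across
  these identifies the representatives.\<close>

lemma tile_unique_Q_mQ:
  assumes z: "in_strip z" and n: "\<bar>Re z - of_int n * C\<bar> \<le> half_width (Im z)"
      "\<bar>Re z - of_int m * C - C / 2\<bar> \<le> C / 2 - half_width (Im z)"
  shows "surface_pt M (minus_pent, z - of_int m * of_real C - K) = surface_pt M (pent, z - of_int n * of_real C)"
proof -
  define z' where "z' = z - of_int n * of_real C"
  have z': "lo \<le> Im z'" "Im z' \<le> hi" "Im z' = Im z" using z by (auto simp: in_strip_def z'_def)
  have "\<bar>(of_int m - of_int n) * C + C / 2\<bar> \<le> C / 2" using n by (simp add: left_diff_distrib; argo)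
  then have "(of_int m - of_int n) * C \<le> 0 * C" "(- 1) * C \<le> (of_int m - of_int n) * C" by argo+
  then have "of_int m - of_int n \<le> (0::real)" "- 1 \<le> of_int m - (of_int n :: real)"
    using mult_le_cancel_right_pos[OF C_pos] by blast+
  then consider "m = n" | "m = n - 1" by linarith
  then show ?thesis
  proof cases
    case 1
    then have "Re z' = half_width (Im z')" using n z' by (simp add: z'_def; argo)
    then have "z' \<in> edge rt" using right_edge z' by blast
    from pt_glue[OF this] show ?thesis using 1 mid2_rt by (simp add: z'_def)
  next
    case 2
    then have "Re z' = - half_width (Im z')" using n z' by (simp add: z'_def left_diff_distrib; argo)
    then have "z' \<in> edge lf" using left_edge z' by blast
    moreover have "z - of_int m * of_real C - K = z' - mid2 lf" by (simp add: z'_def 2 mid2_lf algebra_simps)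
    ultimately show ?thesis using pt_glue[of z' lf] by (simp only: z'_def)
  qed
qed

lemma tile_unique:
  assumes "tile z a" "tile z b" "regular a"
  shows "surface_pt M a = surface_pt M b"
proof -
  have z: "in_strip z" using assms(1) by (simp add: tile_def)
  show ?thesis
    using assms(1)
  proof (cases rule: tile_cases)
    case a: (1 n)
    show ?thesis using assms(2)
    proof (cases rule: tile_cases)
      case (1 m)
      then show ?thesis using tile_unique_Q_Q[OF z a(2) 1(2)] assms(3) a by simp
    next
      case (2 m)
      then show ?thesis using tile_unique_Q_mQ[OF z a(2) 2(2)] a by simp
    qed
  next
    case a: (2 n)
    show ?thesis using assms(2)
    proof (cases rule: tile_cases)
      case (1 m)
      then show ?thesis using tile_unique_Q_mQ[OF z 1(2) a(2)] a by simp
    next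
      case (2 m)
      then show ?thesis using tile_unique_mQ_mQ[OF z a(2) 2(2)] assms(3) a by simp
    qed
  qed
qed

definition regular_z :: "complex \<Rightarrow> bool" where
  "regular_z z \<longleftrightarrow> in_strip z \<and> (\<forall>a. tile z a \<longrightarrow> regular a)"

lemma regular_zI: "tile z a \<Longrightarrow> regular a \<Longrightarrow> regular_z z"
  unfolding regular_z_def using tile_unique class_regular_eq tile_def by metis

lemma regular_z_shift: "regular_z (z + of_int m * of_real C) = regular_z z"
  by (simp add: regular_z_def tile_shift in_strip_def)

lemma regular_z_interior:
  assumes "lo < Im z" "Im z < hi" shows "regular_z z"
  unfolding regular_z_def
proof (intro conjI allI impI)
  show "in_strip z" using assms by (simp add: in_strip_def)
  fix a assume "tile z a"
  then show "regular a"
  proof (cases rule: tile_cases)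
    case (1 n)
    have "Im (z - of_int n * of_real C) = Im z" by simp
    then have "z - of_int n * of_real C \<notin> range vtx" using vertex_level assms by fastforce
    then show ?thesis using 1 by (simp add: regular_iff)
  next
    case (2 n)
    have "Im (K - (z - of_int n * of_real C)) = lo + hi - Im z" by (simp add: Im_K)
    then have "K - (z - of_int n * of_real C) \<notin> range vtx" using vertex_level assms by fastforce
    then show ?thesis using 2 by (simp add: regular_iff)
  qed
qed

text \<open>A germ at z stays in the nearest copy of Q, or in the -Q to its right or left, according
  to the signs of the offsets of the moving point from the two crossed sides of that Q.\<close>

lemma tile_local:
  assumes reg: "regular_z z" and "\<delta> > 0"
    and strip: "\<And>s. 0 \<le> s \<Longrightarrow> s \<le> \<delta> \<Longrightarrow> in_strip (z + of_real s * u)"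
  shows "\<exists>\<delta>'>0. \<delta>' \<le> \<delta> \<and> (\<exists>l y. \<forall>s. 0 \<le> s \<longrightarrow> s \<le> \<delta>' \<longrightarrow> tile (z + of_real s * u) (l, y + of_real s * u))"
proof -
  \<comment> \<open>Rounding picks the copy of Q whose center is horizontally nearest, so the offset
    \<open>x\<close> from it is at most C/2 in absolute value.\<close>
  define n where "n = round (Re z / C)"
  define x where "x = Re z - of_int n * C"
  define h where "h = half_width (Im z)"
  have z: "in_strip z" using reg by (simp add: regular_z_def)
  have "\<bar>of_int n - Re z / C\<bar> \<le> 1 / 2" unfolding n_def by (rule of_int_round_abs_le)
  then have "\<bar>of_int n - Re z / C\<bar> * C \<le> 1 / 2 * C" using C_pos by (intro mult_right_mono) auto
  moreover have "\<bar>of_int n - Re z / C\<bar> * C = \<bar>x\<bar>"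
  proof -
    have "x = - ((of_int n - Re z / C) * C)" using C_pos by (simp add: x_def left_diff_distrib)
    then show ?thesis using C_pos by (simp only: abs_minus abs_mult abs_of_pos)
  qed
  ultimately have x: "\<bar>x\<bar> \<le> C / 2" by simp
  have h: "0 \<le> h" "h \<le> C / 2" using half_width_in[OF z] by (auto simp: h_def)
  have hs: "half_width (Im (z + of_real s * u)) = h + s * (B * Im u)" for s
    by (simp add: h_def half_width_affine algebra_simps)
  have xs: "Re (z + of_real s * u) - of_int n * C = x + s * Re u" for s by (simp add: x_def)
  \<comment> \<open>The offset and the half width cannot both be C/2, since z would be a vertex.
    This makes the distance to the next copy of Q strictly positive in the cases
    \<open>right\<close> and \<open>left\<close>.\<close>
  have corner: False if "\<bar>x\<bar> = h" "h = C / 2"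
  proof -
    have "z - of_int n * of_real C \<in> range vtx"
      using extreme_width[of "z - of_int n * of_real C"] that z by (simp add: in_strip_def x_def h_def)
    moreover have "tile z (pent, z - of_int n * of_real C)"
      using tile_Q[OF z, of n] that by (simp add: x_def h_def)
    ultimately show False using reg regular_iff(1) unfolding regular_z_def by (metis DiffD2)
  qed
  consider (right) \<delta>1 where "\<delta>1 > 0" "\<delta>1 \<le> \<delta>" "\<forall>s. 0 \<le> s \<longrightarrow> s \<le> \<delta>1 \<longrightarrow> (x - h) + s * (Re u - B * Im u) \<ge> 0"
    | (left) \<delta>2 where "\<delta>2 > 0" "\<delta>2 \<le> \<delta>" "\<forall>s. 0 \<le> s \<longrightarrow> s \<le> \<delta>2 \<longrightarrow> (- x - h) + s * (- Re u - B * Im u) \<ge> 0"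
    | (middle) \<delta>1 \<delta>2 where "\<delta>1 > 0" "\<delta>1 \<le> \<delta>" "\<forall>s. 0 \<le> s \<longrightarrow> s \<le> \<delta>1 \<longrightarrow> (x - h) + s * (Re u - B * Im u) \<le> 0"
       "\<delta>2 > 0" "\<delta>2 \<le> \<delta>" "\<forall>s. 0 \<le> s \<longrightarrow> s \<le> \<delta>2 \<longrightarrow> (- x - h) + s * (- Re u - B * Im u) \<le> 0"
    using affine_sign(1)[OF \<open>\<delta> > 0\<close>, of "x - h" "Re u - B * Im u"]
      affine_sign(1)[OF \<open>\<delta> > 0\<close>, of "- x - h" "- Re u - B * Im u"] by blast
  then show ?thesis
  proof cases
    case right
    have "x - h \<ge> 0" using right(3)[rule_format, of 0] right(1) by simp
    then have "C - x - h > 0" using x h corner by argo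
    then obtain \<delta>3 where \<delta>3: "\<delta>3 > 0" "\<delta>3 \<le> \<delta>1"
      "\<forall>s. 0 \<le> s \<longrightarrow> s \<le> \<delta>3 \<longrightarrow> (C - x - h) + s * (- Re u - B * Im u) \<ge> 0"
      using affine_sign(2)[OF right(1)] by blast
    show ?thesis
    proof (intro exI[of _ \<delta>3] conjI exI[of _ minus_pent] exI[of _ "z - of_int n * of_real C - K"] allI impI)
      show "\<delta>3 > 0" "\<delta>3 \<le> \<delta>" using \<delta>3 right by auto
      fix s assume s: "0 \<le> s" "s \<le> \<delta>3"
      have "(x - h) + s * (Re u - B * Im u) \<ge> 0" "(C - x - h) + s * (- Re u - B * Im u) \<ge> 0"
        using s right(3) \<delta>3 by auto
      then have "\<bar>x + s * Re u - C / 2\<bar> \<le> C / 2 - (h + s * (B * Im u))"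
        unfolding abs_le_iff by (simp add: algebra_simps)
      then have "tile (z + of_real s * u) (minus_pent, z + of_real s * u - of_int n * of_real C - K)"
        using tile_minus_Q[OF strip, of s n] s right \<delta>3 unfolding hs xs by auto
      then show "tile (z + of_real s * u) (minus_pent, z - of_int n * of_real C - K + of_real s * u)"
        by (simp add: algebra_simps)
    qed
  next
    case left
    have "- x - h \<ge> 0" using left(3)[rule_format, of 0] left(1) by simp
    then have "C + x - h > 0" using x h corner by argo
    then obtain \<delta>3 where \<delta>3: "\<delta>3 > 0" "\<delta>3 \<le> \<delta>2"
      "\<forall>s. 0 \<le> s \<longrightarrow> s \<le> \<delta>3 \<longrightarrow> (C + x - h) + s * (Re u - B * Im u) \<ge> 0"
      using affine_sign(2)[OF left(1)] by blast
    show ?thesis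
    proof (intro exI[of _ \<delta>3] conjI exI[of _ minus_pent] exI[of _ "z - of_int (n - 1) * of_real C - K"] allI impI)
      show "\<delta>3 > 0" "\<delta>3 \<le> \<delta>" using \<delta>3 left by auto
      fix s assume s: "0 \<le> s" "s \<le> \<delta>3"
      have "(- x - h) + s * (- Re u - B * Im u) \<ge> 0" "(C + x - h) + s * (Re u - B * Im u) \<ge> 0"
        using s left(3) \<delta>3 by auto
      then have "\<bar>x + s * Re u + C - C / 2\<bar> \<le> C / 2 - (h + s * (B * Im u))"
        unfolding abs_le_iff by (simp add: algebra_simps)
      moreover have "Re (z + of_real s * u) - of_int (n - 1) * C = x + s * Re u + C"
        by (simp add: x_def algebra_simps)
      ultimately have "tile (z + of_real s * u) (minus_pent, z + of_real s * u - of_int (n - 1) * of_real C - K)"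
        using tile_minus_Q[OF strip, of s "n - 1"] s left \<delta>3 unfolding hs by auto
      then show "tile (z + of_real s * u) (minus_pent, z - of_int (n - 1) * of_real C - K + of_real s * u)"
        by (simp add: algebra_simps)
    qed
  next
    case middle
    show ?thesis
    proof (intro exI[of _ "min \<delta>1 \<delta>2"] conjI exI[of _ pent] exI[of _ "z - of_int n * of_real C"] allI impI)
      show "min \<delta>1 \<delta>2 > 0" "min \<delta>1 \<delta>2 \<le> \<delta>" using middle by auto
      fix s assume s: "0 \<le> s" "s \<le> min \<delta>1 \<delta>2"
      have "(x - h) + s * (Re u - B * Im u) \<le> 0" "(- x - h) + s * (- Re u - B * Im u) \<le> 0"
        using s middle by auto
      then have "\<bar>x + s * Re u\<bar> \<le> h + s * (B * Im u)"
        unfolding abs_le_iff by (simp add: algebra_simps)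
      then have "tile (z + of_real s * u) (pent, z + of_real s * u - of_int n * of_real C)"
        using tile_Q[OF strip, of s n] s middle unfolding hs xs by auto
      then show "tile (z + of_real s * u) (pent, z - of_int n * of_real C + of_real s * u)"
        by (simp add: algebra_simps)
    qed
  qed
qed

lemma tile_exists: "regular_z z \<Longrightarrow> \<exists>a. tile z a \<and> regular a"
proof -
  assume reg: "regular_z z"
  then have "in_strip (z + of_real s * 0)" for s by (simp add: regular_z_def)
  from tile_local[OF reg zero_less_one this] obtain l y where "tile z (l, y)" by fastforce
  then show ?thesis using reg regular_z_def by blast
qed

definition strip_pt :: "complex \<Rightarrow> (complex set \<times> complex) set" where
  "strip_pt z = surface_pt M (SOME a. tile z a)"

lemma strip_pt_eq: "tile z a \<Longrightarrow> regular a \<Longrightarrow> strip_pt z = surface_pt M a"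
  unfolding strip_pt_def using tile_unique by (metis someI)

lemma strip_pt_shift: "strip_pt (z + of_int m * of_real C) = strip_pt z"
  by (simp add: strip_pt_def tile_shift)

section \<open>The twist of a single cylinder\<close>

text \<open>Fixes the lower boundary of the strip and moves the upper one by c C, one full turn for
  c = 1 or c = -1. It therefore descends to a Dehn twist of the cylinder.\<close>

definition shear :: "real \<Rightarrow> complex \<Rightarrow> complex" where
  "shear c z = z + of_real (c * C / (hi - lo) * (Im z - lo))"

text \<open>On the surface the twist is the identity on both boundary curves; this allows the twists
  of the two cylinders to be joined.\<close>

lemma shear_ends:
  assumes "c = 1 \<or> c = - 1"
  shows "Im z = lo \<Longrightarrow> shear c z = z"
    and "Im z = hi \<Longrightarrow> strip_pt (shear c z) = strip_pt z" "Im z = hi \<Longrightarrow> regular_z (shear c z) = regular_z z"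
proof -
  show "Im z = lo \<Longrightarrow> shear c z = z" by (simp add: shear_def)
  assume "Im z = hi"
  then have "shear c z = z + of_real (c * C)" using lo_less_hi by (simp add: shear_def)
  then have "shear c z = z + of_int (if c = 1 then 1 else - 1) * of_real C" using assms by auto
  then show "strip_pt (shear c z) = strip_pt z" "regular_z (shear c z) = regular_z z"
    by (simp_all only: strip_pt_shift regular_z_shift)
qed

lemma shear_regular:
  assumes "c = 1 \<or> c = - 1" "regular_z z" shows "regular_z (shear c z)"
proof -
  have "in_strip z" using assms(2) by (simp add: regular_z_def)
  then consider "Im z = lo" | "Im z = hi" | "lo < Im z" "Im z < hi" unfolding in_strip_def by linarith
  then show ?thesis
  proof cases
    case 1
    then show ?thesis using shear_ends(1)[OF assms(1)] assms(2) by simp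
  next
    case 2
    then show ?thesis using shear_ends(3)[OF assms(1)] assms(2) by simp
  next
    case 3
    then show ?thesis by (intro regular_z_interior) (simp_all add: shear_def)
  qed
qed

lemma shear_inverse: "shear (- c) (shear c z) = z"
  by (simp add: shear_def algebra_simps)

lemma shear_translate: "shear c (z - of_int n * of_real C) = shear c z + of_int (- n) * of_real C"
  by (simp add: shear_def)

lemma shear_path: "shear c (z + of_real s * u) = shear c z + of_real s * (u + of_real (c * C / (hi - lo) * Im u))"
proof -
  define k where "k = c * C / (hi - lo)"
  have "k * (Im (z + of_real s * u) - lo) = k * (Im z - lo) + s * (k * Im u)"
    by (simp add: algebra_simps)
  then show ?thesis unfolding shear_def k_def[symmetric] by (simp add: algebra_simps)
qed

end

section \<open>The multi-twist of the double pentagon\<close>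

context double_pent
begin

sublocale lower: strip_surface M "- apo" "sn - apo" golden "low_half 0" "(2 - golden) / (2 * sn)"
  "mid2 1" 1 4 low_half
  by (intro strip_surface.intro double_pent_axioms low.strip_geometry_axioms)

sublocale upper: strip_surface M "sn - apo" "golden * sn - apo" 1 "high_half 0" "- 1 / (2 * ((golden - 1) * sn))"
  "mid2 2" 2 3 high_half
  by (intro strip_surface.intro double_pent_axioms high.strip_geometry_axioms)

text \<open>Each polygon is cut by its horizontal diagonal, at height sn - apo in Q and apo - sn in
  -Q; adding \<open>mid2 1\<close> or \<open>mid2 2\<close> moves a point of -Q to its place in the
  developed strip. Points of the diagonal are assigned to the lower strip.\<close>

definition shear_pt :: "real \<Rightarrow> complex set \<times> complex \<Rightarrow> (complex set \<times> complex) set" where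
  "shear_pt c a = (let y = snd a in
    if fst a = pent then
      (if Im y \<le> sn - apo then lower.strip_pt (lower.shear c y) else upper.strip_pt (upper.shear c y))
    else (if apo - sn \<le> Im y then lower.strip_pt (lower.shear c (y + mid2 1))
      else upper.strip_pt (upper.shear c (y + mid2 2))))"

lemma lower_tile_pent: "y \<in> pent \<Longrightarrow> Im y \<le> sn - apo \<Longrightarrow> lower.tile y (pent, y)"
  using pent_section_bounds(1)[of y] by (intro lower.tile_base) (simp_all add: lower.in_strip_def)

lemma upper_tile_pent: "y \<in> pent \<Longrightarrow> sn - apo \<le> Im y \<Longrightarrow> upper.tile y (pent, y)"
  using pent_section_bounds(2)[of y] by (intro upper.tile_base) (simp_all add: upper.in_strip_def)

lemma lower_tile_minus_pent: "- y \<in> pent \<Longrightarrow> apo - sn \<le> Im y \<Longrightarrow> lower.tile (y + mid2 1) (minus_pent, y)"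
  using pent_section_bounds(1)[of "- y"] lower.tile_base(2)[of "y + mid2 1"]
  by (simp add: lower.in_strip_def Re_Im_mid2)

lemma upper_tile_minus_pent: "- y \<in> pent \<Longrightarrow> Im y \<le> apo - sn \<Longrightarrow> upper.tile (y + mid2 2) (minus_pent, y)"
  using pent_section_bounds(2)[of "- y"] upper.tile_base(2)[of "y + mid2 2"]
  by (simp add: upper.in_strip_def Re_Im_mid2 algebra_simps)

lemma lower_end:
  assumes "c = 1 \<or> c = - 1" "lower.tile z a" "regular a" "Im z = - apo \<or> Im z = sn - apo"
  shows "lower.strip_pt (lower.shear c z) = surface_pt M a"
  using assms(4)
proof
  assume "Im z = - apo"
  show ?thesis
    unfolding lower.shear_ends(1)[OF assms(1) \<open>Im z = - apo\<close>] by (rule lower.strip_pt_eq[OF assms(2,3)])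
next
  assume "Im z = sn - apo"
  show ?thesis
    unfolding lower.shear_ends(2)[OF assms(1) \<open>Im z = sn - apo\<close>] by (rule lower.strip_pt_eq[OF assms(2,3)])
qed

lemma upper_end:
  assumes "c = 1 \<or> c = - 1" "upper.tile z a" "regular a" "Im z = sn - apo \<or> Im z = golden * sn - apo"
  shows "upper.strip_pt (upper.shear c z) = surface_pt M a"
  using assms(4)
proof
  assume "Im z = sn - apo"
  show ?thesis
    unfolding upper.shear_ends(1)[OF assms(1) \<open>Im z = sn - apo\<close>] by (rule upper.strip_pt_eq[OF assms(2,3)])
next
  assume "Im z = golden * sn - apo"
  show ?thesis
    unfolding upper.shear_ends(2)[OF assms(1) \<open>Im z = golden * sn - apo\<close>] by (rule upper.strip_pt_eq[OF assms(2,3)])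
qed

lemma regular_pent_face: "regular (pent, y) \<Longrightarrow> y \<in> pent" "regular (minus_pent, y) \<Longrightarrow> - y \<in> pent"
  by (simp_all add: regular_iff)

lemma shear_pt_lower:
  assumes c: "c = 1 \<or> c = - 1" and t: "lower.tile z a" "regular a"
  shows "shear_pt c a = lower.strip_pt (lower.shear c z)"
  using t(1)
proof (cases rule: lower.tile_cases)
  case (1 n)
  have "Im z \<le> sn - apo" using t(1) by (simp add: lower.tile_def lower.in_strip_def)
  then have "shear_pt c a = lower.strip_pt (lower.shear c (z - of_int n * of_real golden))"
    using 1 by (simp add: shear_pt_def)
  then show ?thesis by (simp only: lower.shear_translate lower.strip_pt_shift)
next
  case (2 n)
  have "- apo \<le> Im z" using t(1) by (simp add: lower.tile_def lower.in_strip_def)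
  then have "shear_pt c a = lower.strip_pt (lower.shear c (z - of_int n * of_real golden))"
    using 2 minus_pent_neq by (simp add: shear_pt_def Re_Im_mid2)
  then show ?thesis by (simp only: lower.shear_translate lower.strip_pt_shift)
qed

text \<open>On the diagonals \<open>shear_pt\<close> computes with the lower strip, although they
  bound the upper one as well. There both twists are the identity on classes, so the results
  agree.\<close>

lemma shear_pt_upper:
  assumes c: "c = 1 \<or> c = - 1" and t: "upper.tile z a" "regular a"
  shows "shear_pt c a = upper.strip_pt (upper.shear c z)"
  using t(1)
proof (cases rule: upper.tile_cases)
  case (1 n)
  have z: "sn - apo \<le> Im z" using t(1) by (simp add: upper.tile_def upper.in_strip_def)
  show ?thesis
  proof (cases "Im z = sn - apo")
    case True
    define y where "y = z - of_int n * of_real 1"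
    have y: "y \<in> pent" "Im y = sn - apo" "a = (pent, y)" using 1 True by (simp_all add: y_def)
    have "shear_pt c a = lower.strip_pt (lower.shear c y)" using y by (simp add: shear_pt_def)
    also have "\<dots> = surface_pt M a" using lower_end[OF c lower_tile_pent[of y]] t(2) y by simp
    also have "\<dots> = upper.strip_pt (upper.shear c z)" using upper_end[OF c t] True by simp
    finally show ?thesis .
  next
    case False
    then have "shear_pt c a = upper.strip_pt (upper.shear c (z - of_int n * of_real 1))"
      using 1 z by (simp add: shear_pt_def)
    then show ?thesis by (simp only: upper.shear_translate upper.strip_pt_shift)
  qed
next
  case (2 n)
  have z: "Im z \<le> golden * sn - apo" using t(1) by (simp add: upper.tile_def upper.in_strip_def)
  define y where "y = z - of_int n * of_real 1 - mid2 2"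
  have y: "- y \<in> pent" "Im y = Im z - (1 + golden) * sn + 2 * apo" "a = (minus_pent, y)"
    using 2 by (simp_all add: y_def Re_Im_mid2)
  show ?thesis
  proof (cases "Im z = golden * sn - apo")
    case True
    then have Imy: "Im y = apo - sn" using y by (simp add: algebra_simps)
    have "shear_pt c a = lower.strip_pt (lower.shear c (y + mid2 1))"
      using y Imy minus_pent_neq by (simp add: shear_pt_def)
    also have "\<dots> = surface_pt M a"
      using lower_end[OF c lower_tile_minus_pent[of y]] t(2) y Imy by (simp add: Re_Im_mid2)
    also have "\<dots> = upper.strip_pt (upper.shear c z)" using upper_end[OF c t] True by simp
    finally show ?thesis .
  next
    case False
    have "\<not> apo - sn \<le> Im y" using False z y(2) by (simp add: algebra_simps)
    then have "shear_pt c a = upper.strip_pt (upper.shear c (y + mid2 2))"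
      using y(3) minus_pent_neq by (simp add: shear_pt_def)
    also have "y + mid2 2 = z - of_int n * of_real 1" by (simp add: y_def)
    finally show ?thesis by (simp only: upper.shear_translate upper.strip_pt_shift)
  qed
qed

lemma low_edge_Im: "y \<in> edge 1 \<or> y \<in> edge 4 \<Longrightarrow> Im y \<le> sn - apo"
  and high_edge_Im: "y \<in> edge 2 \<or> y \<in> edge 3 \<Longrightarrow> sn - apo \<le> Im y"
proof -
  have q5: "vtx 5 = vtx 0" using vtx_mod[of 5] by simp
  note pos = sn_pos sn_golden
  have conv: "(1 - u) * a + u * b \<le> c" if "0 \<le> u" "u \<le> 1" "a \<le> c" "b \<le> c" for a b c u :: real
    using convex_bound_le[of a c b "1 - u" u] that by simp
  have Imu: "Im ((1 - u) *\<^sub>R a + u *\<^sub>R b) = (1 - u) * Im a + u * Im b" for u a b by simp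
  show "y \<in> edge 1 \<or> y \<in> edge 4 \<Longrightarrow> Im y \<le> sn - apo"
  proof (elim disjE edge_cases)
    fix u :: real assume "0 \<le> u" "u \<le> 1" "y = (1 - u) *\<^sub>R vtx 1 + u *\<^sub>R vtx (1 + 1)"
    then show ?thesis using conv[of u "Im (vtx 1)" "sn - apo" "Im (vtx 2)"] pos by (simp add: Im_vtx)
  next
    fix u :: real assume "0 \<le> u" "u \<le> 1" "y = (1 - u) *\<^sub>R vtx 4 + u *\<^sub>R vtx (4 + 1)"
    then show ?thesis using conv[of u "Im (vtx 4)" "sn - apo" "Im (vtx 0)"] pos by (simp add: Im_vtx q5)
  qed
  show "y \<in> edge 2 \<or> y \<in> edge 3 \<Longrightarrow> sn - apo \<le> Im y"
  proof (elim disjE edge_cases)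
    fix u :: real assume "0 \<le> u" "u \<le> 1" "y = (1 - u) *\<^sub>R vtx 2 + u *\<^sub>R vtx (2 + 1)"
    then show ?thesis using conv[of u "- Im (vtx 2)" "apo - sn" "- Im (vtx 3)"] pos by (simp add: Im_vtx, simp add: algebra_simps)
  next
    fix u :: real assume "0 \<le> u" "u \<le> 1" "y = (1 - u) *\<^sub>R vtx 3 + u *\<^sub>R vtx (3 + 1)"
    then show ?thesis using conv[of u "- Im (vtx 3)" "apo - sn" "- Im (vtx 4)"] pos by (simp add: Im_vtx, simp add: algebra_simps)
  qed
qed

lemma mid2_shifts: "mid2 1 - mid2 4 = of_real golden" "mid2 2 - mid2 3 = 1"
  by (simp_all add: complex_eq_iff Re_Im_mid2 field_simps)

text \<open>Compatibility with the gluing, side by side. The bottom side lies on strip boundaries,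
  where the twist is the identity. Across sides 1 and 2 both representatives come from the same
  point of the strip, across sides 3 and 4 from points one circumference apart.\<close>

lemma shear_pt_glue_pent:
  assumes c: "c = 1 \<or> c = - 1" and y: "y \<in> edge i" "regular (pent, y)"
  shows "shear_pt c (minus_pent, y - mid2 i) = shear_pt c (pent, y)"
proof -
  have yp: "y \<in> pent" using y(2) by (rule regular_pent_face)
  have edge_m: "y \<in> edge (i mod 5)" and mid_m: "mid2 (i mod 5) = mid2 i"
    using y(1) by (simp_all add: edge_mod mid2_mod)
  have reg': "regular (minus_pent, y - mid2 i)"
    using class_regular_eq[OF y(2)] pt_glue[OF y(1)] by simp
  have mp: "- (y - mid2 i) \<in> pent" using reg' by (rule regular_pent_face)
  show ?thesis
  proof (cases i rule: mod5_cases)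
    case 1
    then have y0: "y \<in> edge 0" "mid2 i = mid2 0" using edge_m mid_m by auto
    then have Imy: "Im y = - apo" by (simp add: edge_0_iff)
    have tl: "lower.tile y (pent, y)" using lower_tile_pent[OF yp] Imy sn_pos by simp
    have Imy': "Im (y - mid2 i) = apo" by (simp add: y0(2) mid2_0 Imy)
    have tl': "lower.tile (y - mid2 i + mid2 1) (minus_pent, y - mid2 i)"
      by (rule lower_tile_minus_pent[OF mp]) (use Imy' sn_pos in simp)
    have "Im (y - mid2 i + mid2 1) = sn - apo"
      unfolding plus_complex.sel Imy' Re_Im_mid2 by simp
    then have "shear_pt c (minus_pent, y - mid2 i) = surface_pt M (minus_pent, y - mid2 i)"
      using shear_pt_lower[OF c tl' reg'] lower_end[OF c tl' reg'] by simp
    moreover have "shear_pt c (pent, y) = surface_pt M (pent, y)"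
      using shear_pt_lower[OF c tl y(2)] lower_end[OF c tl y(2)] Imy by simp
    ultimately show ?thesis using pt_glue[OF y(1)] by simp
  next
    case 2
    have tl: "lower.tile y (pent, y)" using lower_tile_pent[OF yp] low_edge_Im edge_m 2 by simp
    have "Im (y - mid2 i) \<ge> apo - sn"
      using mid_m 2 pent_section_bounds(1)[OF yp] by (simp add: Re_Im_mid2 flip: mid_m)
    then have tl': "lower.tile (y - mid2 i + mid2 1) (minus_pent, y - mid2 i)"
      by (rule lower_tile_minus_pent[OF mp])
    have "y - mid2 i + mid2 1 = y" using mid_m 2 by simp
    then show ?thesis
      using shear_pt_lower[OF c tl' reg'] shear_pt_lower[OF c tl y(2)] by simp
  next
    case 3
    have tl: "upper.tile y (pent, y)" using upper_tile_pent[OF yp] high_edge_Im edge_m 3 by simp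
    have "Im (y - mid2 i) \<le> apo - sn"
      using mid_m 3 pent_section_bounds(2)[OF yp] by (simp add: Re_Im_mid2 algebra_simps flip: mid_m)
    then have tl': "upper.tile (y - mid2 i + mid2 2) (minus_pent, y - mid2 i)"
      by (rule upper_tile_minus_pent[OF mp])
    have "y - mid2 i + mid2 2 = y" using mid_m 3 by simp
    then show ?thesis
      using shear_pt_upper[OF c tl' reg'] shear_pt_upper[OF c tl y(2)] by simp
  next
    case 4
    have tl: "upper.tile y (pent, y)" using upper_tile_pent[OF yp] high_edge_Im edge_m 4 by simp
    have "Im (y - mid2 i) \<le> apo - sn"
      using mid_m 4 pent_section_bounds(2)[OF yp] by (simp add: Re_Im_mid2 algebra_simps flip: mid_m)
    then have tl': "upper.tile (y - mid2 i + mid2 2) (minus_pent, y - mid2 i)"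
      by (rule upper_tile_minus_pent[OF mp])
    have "y - mid2 i + mid2 2 = y - of_int (- 1) * of_real 1" using mid_m 4 mid2_shifts by (simp add: algebra_simps)
    then show ?thesis
      using shear_pt_upper[OF c tl' reg'] shear_pt_upper[OF c tl y(2)]
      by (simp only: upper.shear_translate upper.strip_pt_shift)
  next
    case 5
    have tl: "lower.tile y (pent, y)" using lower_tile_pent[OF yp] low_edge_Im edge_m 5 by simp
    have "Im (y - mid2 i) \<ge> apo - sn"
      using mid_m 5 pent_section_bounds(1)[OF yp] by (simp add: Re_Im_mid2 flip: mid_m)
    then have tl': "lower.tile (y - mid2 i + mid2 1) (minus_pent, y - mid2 i)"
      by (rule lower_tile_minus_pent[OF mp])
    have "y - mid2 i + mid2 1 = y - of_int (- 1) * of_real golden" using mid_m 5 mid2_shifts by (simp add: algebra_simps)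
    then show ?thesis
      using shear_pt_lower[OF c tl' reg'] shear_pt_lower[OF c tl y(2)]
      by (simp only: lower.shear_translate lower.strip_pt_shift)
  qed
qed

lemma shear_pt_class:
  assumes c: "c = 1 \<or> c = - 1" and "regular a" "surface_pt M a = surface_pt M b"
  shows "shear_pt c a = shear_pt c b"
proof -
  obtain l y l' y' where ab: "a = (l, y)" "b = (l', y')" by (cases a; cases b)
  have reg: "regular (l, y)" "regular (l', y')" using assms(2) class_regular_eq[OF assms(2,3)] ab by auto
  have "(l', y') \<in> surface_pt M (l, y)" using assms(3) ab surface_pt_self by metis
  from class_cases(2)[OF reg(1) this] show ?thesis
  proof
    assume "\<exists>i. of_real (dp_sign l) * y \<in> edge i \<and> l' = dp_nb i l \<and> y' = y - of_real (dp_sign l) * mid2 i"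
    then obtain i where i: "of_real (dp_sign l) * y \<in> edge i" "l' = uminus ` l"
        "y' = y - of_real (dp_sign l) * mid2 i" by (auto simp: dp_nb_def)
    have "l = pent \<or> l = minus_pent" using reg(1) faces_M by (auto simp: regular_def)
    then show ?thesis
    proof
      assume "l = pent"
      then show ?thesis using shear_pt_glue_pent[OF c, of y i] i reg ab by simp
    next
      assume l: "l = minus_pent"
      then have l': "l' = pent" using i(2) by (simp add: image_image)
      have "y' \<in> edge i" "y = y' - mid2 i" using i l edge_reflect[of "- y" i] by (auto simp: add.commute)
      then show ?thesis using shear_pt_glue_pent[OF c, of y' i] reg ab l l' by simp
    qed
  qed (simp add: ab)
qed

definition shear_class :: "real \<Rightarrow> (complex set \<times> complex) set \<Rightarrow> (complex set \<times> complex) set" where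
  "shear_class c X = shear_pt c (SOME a. a \<in> X)"

lemma shear_class_eq:
  assumes "c = 1 \<or> c = - 1" "regular a"
  shows "shear_class c (surface_pt M a) = shear_pt c a"
proof -
  have "(SOME b. b \<in> surface_pt M a) \<in> surface_pt M a" by (rule someI) (rule surface_pt_self)
  then have "surface_pt M a = surface_pt M (SOME b. b \<in> surface_pt M a)" by (simp add: surface_pt_mem_eq)
  from shear_pt_class[OF assms this] show ?thesis by (simp add: shear_class_def)
qed

lemma shear_class_lower:
  "c = 1 \<or> c = - 1 \<Longrightarrow> lower.tile z a \<Longrightarrow> regular a \<Longrightarrow>
    shear_class c (surface_pt M a) = lower.strip_pt (lower.shear c z)"
  by (simp add: shear_class_eq shear_pt_lower)

lemma shear_class_upper:
  "c = 1 \<or> c = - 1 \<Longrightarrow> upper.tile z a \<Longrightarrow> regular a \<Longrightarrow>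
    shear_class c (surface_pt M a) = upper.strip_pt (upper.shear c z)"
  by (simp add: shear_class_eq shear_pt_upper)

lemma regular_label:
  assumes "regular (l, y)" shows "(l = pent \<and> y \<in> pent) \<or> (l = minus_pent \<and> - y \<in> pent)"
proof -
  have "l \<in> {pent, minus_pent}" using assms by (simp add: regular_def flip: faces_M)
  then show ?thesis using assms regular_pent_face by blast
qed

lemma some_tile:
  assumes "regular a" obtains z where "lower.tile z a" | z where "upper.tile z a"
proof -
  obtain l y where a: "a = (l, y)" by (cases a)
  from regular_label[of l y] assms a show thesis
    using that lower_tile_pent[of y] upper_tile_pent[of y] lower_tile_minus_pent[of y] upper_tile_minus_pent[of y]
    by (metis linorder_linear)
qed

lemma shear_class_inverse:
  assumes c: "c = 1 \<or> c = - 1" and a: "regular a"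
  shows "shear_class (- c) (shear_class c (surface_pt M a)) = surface_pt M a"
    and "\<exists>b. regular b \<and> shear_class c (surface_pt M a) = surface_pt M b"
proof -
  have c': "- c = 1 \<or> - c = - 1" using c by auto
  have "shear_class (- c) (shear_class c (surface_pt M a)) = surface_pt M a \<and>
    (\<exists>b. regular b \<and> shear_class c (surface_pt M a) = surface_pt M b)"
    using a
  proof (cases rule: some_tile)
    case (1 z)
    have "lower.regular_z (lower.shear c z)"
      using lower.shear_regular[OF c lower.regular_zI[OF 1 a]] .
    then obtain b where b: "lower.tile (lower.shear c z) b" "regular b" using lower.tile_exists by blast
    have eq: "shear_class c (surface_pt M a) = surface_pt M b"
      using shear_class_lower[OF c 1 a] lower.strip_pt_eq[OF b] by simp
    moreover have "shear_class (- c) (surface_pt M b) = lower.strip_pt z"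
      using shear_class_lower[OF c' b] lower.shear_inverse[of c z] by simp
    ultimately show ?thesis using lower.strip_pt_eq[OF 1 a] b(2) by (intro conjI exI[of _ b]) simp_all
  next
    case (2 z)
    have "upper.regular_z (upper.shear c z)"
      using upper.shear_regular[OF c upper.regular_zI[OF 2 a]] .
    then obtain b where b: "upper.tile (upper.shear c z) b" "regular b" using upper.tile_exists by blast
    have eq: "shear_class c (surface_pt M a) = surface_pt M b"
      using shear_class_upper[OF c 2 a] upper.strip_pt_eq[OF b] by simp
    moreover have "shear_class (- c) (surface_pt M b) = upper.strip_pt z"
      using shear_class_upper[OF c' b] upper.shear_inverse[of c z] by simp
    ultimately show ?thesis using upper.strip_pt_eq[OF 2 a] b(2) by (intro conjI exI[of _ b]) simp_all
  qed
  then show "shear_class (- c) (shear_class c (surface_pt M a)) = surface_pt M a"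
    "\<exists>b. regular b \<and> shear_class c (surface_pt M a) = surface_pt M b" by auto
qed

text \<open>The face is cut by its horizontal diagonal, and the sign of the height above it selects
  one strip for a short time.\<close>

lemma face_path_tile:
  assumes "\<delta> > 0" "\<forall>s. 0 \<le> s \<longrightarrow> s \<le> \<delta> \<longrightarrow> regular (l, y + of_real s * u)"
  obtains \<delta>' z where "\<delta>' > 0" "\<delta>' \<le> \<delta>" "\<And>s. 0 \<le> s \<Longrightarrow> s \<le> \<delta>' \<Longrightarrow> lower.tile (z + of_real s * u) (l, y + of_real s * u)"
  | \<delta>' z where "\<delta>' > 0" "\<delta>' \<le> \<delta>" "\<And>s. 0 \<le> s \<Longrightarrow> s \<le> \<delta>' \<Longrightarrow> upper.tile (z + of_real s * u) (l, y + of_real s * u)"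
proof -
  have "l = pent \<or> l = minus_pent" using regular_label[of l "y + of_real 0 * u"] assms(2)[rule_format, of 0] assms(1)
    by (meson less_imp_le order_refl)
  then show thesis
  proof
    assume l: "l = pent"
    have y: "y + of_real s * u \<in> pent" if "0 \<le> s" "s \<le> \<delta>" for s
      using assms(2) that l regular_pent_face by blast
    from affine_sign(1)[OF assms(1), of "Im y - (sn - apo)" "Im u"] show thesis
    proof (elim disjE exE conjE)
      fix \<delta>' assume \<delta>': "\<delta>' > 0" "\<delta>' \<le> \<delta>" "\<forall>s. 0 \<le> s \<longrightarrow> s \<le> \<delta>' \<longrightarrow> Im y - (sn - apo) + s * Im u \<le> 0"
      show thesis
      proof (rule that(1)[OF \<delta>'(1,2)])
        fix s assume s: "0 \<le> s" "s \<le> \<delta>'"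
        then have "Im (y + of_real s * u) \<le> sn - apo" using \<delta>'(3)[rule_format, of s] by simp
        then show "lower.tile (y + of_real s * u) (l, y + of_real s * u)"
          unfolding l using lower_tile_pent[OF y] s \<delta>' by simp
      qed
    next
      fix \<delta>' assume \<delta>': "\<delta>' > 0" "\<delta>' \<le> \<delta>" "\<forall>s. 0 \<le> s \<longrightarrow> s \<le> \<delta>' \<longrightarrow> Im y - (sn - apo) + s * Im u \<ge> 0"
      show thesis
      proof (rule that(2)[OF \<delta>'(1,2)])
        fix s assume s: "0 \<le> s" "s \<le> \<delta>'"
        then have "sn - apo \<le> Im (y + of_real s * u)" using \<delta>'(3)[rule_format, of s] by simp
        then show "upper.tile (y + of_real s * u) (l, y + of_real s * u)"
          unfolding l using upper_tile_pent[OF y] s \<delta>' by simp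
      qed
    qed
  next
    assume l: "l = minus_pent"
    have y: "- (y + of_real s * u) \<in> pent" if "0 \<le> s" "s \<le> \<delta>" for s
      using assms(2) that l regular_pent_face by blast
    have add: "y + m + of_real s * u = (y + of_real s * u) + m" for m s by simp
    from affine_sign(1)[OF assms(1), of "Im y + (sn - apo)" "Im u"] show thesis
    proof (elim disjE exE conjE)
      fix \<delta>' assume \<delta>': "\<delta>' > 0" "\<delta>' \<le> \<delta>" "\<forall>s. 0 \<le> s \<longrightarrow> s \<le> \<delta>' \<longrightarrow> Im y + (sn - apo) + s * Im u \<ge> 0"
      show thesis
      proof (rule that(1)[OF \<delta>'(1,2)])
        fix s assume s: "0 \<le> s" "s \<le> \<delta>'"
        then have "apo - sn \<le> Im (y + of_real s * u)" using \<delta>'(3)[rule_format, of s] by simp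
        then show "lower.tile (y + mid2 1 + of_real s * u) (l, y + of_real s * u)"
          unfolding l add using lower_tile_minus_pent[OF y] s \<delta>' by simp
      qed
    next
      fix \<delta>' assume \<delta>': "\<delta>' > 0" "\<delta>' \<le> \<delta>" "\<forall>s. 0 \<le> s \<longrightarrow> s \<le> \<delta>' \<longrightarrow> Im y + (sn - apo) + s * Im u \<le> 0"
      show thesis
      proof (rule that(2)[OF \<delta>'(1,2)])
        fix s assume s: "0 \<le> s" "s \<le> \<delta>'"
        then have "Im (y + of_real s * u) \<le> apo - sn" using \<delta>'(3)[rule_format, of s] by simp
        then show "upper.tile (y + mid2 2 + of_real s * u) (l, y + of_real s * u)"
          unfolding l add using upper_tile_minus_pent[OF y] s \<delta>' by simp
      qed
    qed
  qed
qed

end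

context strip_surface
begin

lemma strip_path:
  assumes "\<delta> > 0" and reg: "\<And>s. 0 \<le> s \<Longrightarrow> s \<le> \<delta> \<Longrightarrow> regular_z (z + of_real s * u)"
  shows "\<exists>\<delta>'>0. \<delta>' \<le> \<delta> \<and> (\<exists>l\<in>faces M. \<exists>y. \<forall>s. 0 \<le> s \<longrightarrow> s \<le> \<delta>' \<longrightarrow>
    y + of_real s * u \<in> face M l \<and> strip_pt (z + of_real s * u) = surface_pt M (l, y + of_real s * u))"
proof -
  have "in_strip (z + of_real s * u)" if "0 \<le> s" "s \<le> \<delta>" for s using reg[OF that] by (simp add: regular_z_def)
  then obtain \<delta>' l y where \<delta>': "\<delta>' > 0" "\<delta>' \<le> \<delta>"
    "\<And>s. 0 \<le> s \<Longrightarrow> s \<le> \<delta>' \<Longrightarrow> tile (z + of_real s * u) (l, y + of_real s * u)"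
    using tile_local[of z \<delta> u] reg[of 0] assms(1) by auto
  show ?thesis
  proof (intro exI[of _ \<delta>'] conjI bexI[of _ l] exI[of _ y] allI impI \<delta>')
    fix s assume s: "0 \<le> s" "s \<le> \<delta>'"
    have t: "tile (z + of_real s * u) (l, y + of_real s * u)" using \<delta>'(3)[OF s] .
    then show "y + of_real s * u \<in> face M l" using tile_face by blast
    have "regular (l, y + of_real s * u)" using reg[of s] s \<delta>'(2) t by (simp add: regular_z_def)
    then show "strip_pt (z + of_real s * u) = surface_pt M (l, y + of_real s * u)"
      using strip_pt_eq[OF t] by simp
  next
    show "l \<in> faces M" using tile_face[OF \<delta>'(3)[of 0]] \<delta>'(1) by simp
  qed
qed

end

context double_pent
begin

lemma lower_shear_path:
  "lower.shear c (z + of_real s * u) = lower.shear c z + of_real s * (u + of_real (c * golden / sn * Im u))"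
  using lower.shear_path[of c z s u] by simp

text \<open>Height and circumference are sn and phi below, (phi - 1) sn and 1 above; as phi (phi -
  1) = 1, the twists have the same slope phi / sn and form one affine map. In the basis 1,
  \<open>omega\<close> its derivative for c = 1 is sigma_0.\<close>

lemma upper_shear_path:
  "upper.shear c (z + of_real s * u) = upper.shear c z + of_real s * (u + of_real (c * golden / sn * Im u))"
proof -
  have "1 / (golden * sn - apo - (sn - apo)) = golden / sn"
    using sn_pos golden_gt_1 by (simp add: field_simps golden_mult)
  then have "c * 1 / (golden * sn - apo - (sn - apo)) = c * golden / sn" by (metis times_divide_eq_right)
  then show ?thesis using upper.shear_path[of c z s u] by (simp only:)
qed

text \<open>A short germ lies in one strip, where the twist is an affine map of the developed plane;
  the sheared germ is then shortened to stay in a single tile.\<close>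

lemma straight_trajectory_shear:
  assumes st: "straight_trajectory M d \<gamma>" and c: "c = 1 \<or> c = - 1"
  shows "straight_trajectory M (d + of_real (c * golden / sn * Im d)) (\<lambda>t. shear_class c (\<gamma> t))"
proof (rule straight_trajectoryI)
  fix t l k assume l: "l \<in> faces M" "k \<in> corners M l"
  obtain a where a: "\<gamma> t = surface_pt M a"
    using straight_trajectoryD_dir[OF st, of 1 t] by metis
  then have "regular a" using trajectory_regular(1)[OF st] surface_pt_self by (metis surj_pair)
  then obtain b where "regular b" "shear_class c (\<gamma> t) = surface_pt M b"
    using shear_class_inverse(2)[OF c] a by metis
  then show "(l, k) \<notin> shear_class c (\<gamma> t)" using regular_no_corner l by simp
next
  fix t \<epsilon> :: real assume \<epsilon>: "\<epsilon> = 1 \<or> \<epsilon> = - 1"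
  define u where "u = of_real \<epsilon> * d"
  define u' where "u' = u + of_real (c * golden / sn * Im u)"
  have u': "of_real \<epsilon> * (d + of_real (c * golden / sn * Im d)) = u'"
    by (simp add: u'_def u_def distrib_left)
  obtain \<delta> l y where *: "\<delta> > 0" "l \<in> faces M"
      "\<And>s. 0 \<le> s \<Longrightarrow> s \<le> \<delta> \<Longrightarrow> \<gamma> (t + \<epsilon> * s) = surface_pt M (l, y + of_real s * u)"
    using straight_trajectoryD_dir[OF st \<epsilon>, of t] unfolding u_def by metis
  have reg: "regular (l, y + of_real s * u)" if "0 \<le> s" "s \<le> \<delta>" for s
    using trajectory_regular(1)[OF st] *(3)[OF that] surface_pt_self by metis
  then have regs: "\<forall>s. 0 \<le> s \<longrightarrow> s \<le> \<delta> \<longrightarrow> regular (l, y + of_real s * u)" by blast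
  have "\<exists>\<delta>>0. \<exists>l\<in>faces M. \<exists>y. \<forall>s. 0 \<le> s \<longrightarrow> s \<le> \<delta> \<longrightarrow> y + of_real s * u' \<in> face M l \<and>
      shear_class c (\<gamma> (t + \<epsilon> * s)) = surface_pt M (l, y + of_real s * u')"
    using *(1) regs
  proof (cases rule: face_path_tile)
    case (1 \<delta>' z)
    have regs: "lower.regular_z (lower.shear c z + of_real s * u')" if "0 \<le> s" "s \<le> \<delta>'" for s
      using lower.shear_regular[OF c lower.regular_zI[OF 1(3)[OF that] reg]] that 1(2)
      unfolding lower_shear_path u'_def by simp
    obtain \<delta>2 l2 y2 where 2: "\<delta>2 > 0" "\<delta>2 \<le> \<delta>'" "l2 \<in> faces M"
      "\<And>s. 0 \<le> s \<Longrightarrow> s \<le> \<delta>2 \<Longrightarrow> y2 + of_real s * u' \<in> face M l2 \<and>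
        lower.strip_pt (lower.shear c z + of_real s * u') = surface_pt M (l2, y2 + of_real s * u')"
      using lower.strip_path[OF 1(1) regs] by metis
    show ?thesis
    proof (intro exI[of _ \<delta>2] conjI bexI[of _ l2] exI[of _ y2] allI impI 2(1) 2(3))
      fix s assume s: "0 \<le> s" "s \<le> \<delta>2"
      show "y2 + of_real s * u' \<in> face M l2" using 2(4)[OF s] by simp
      have "shear_class c (\<gamma> (t + \<epsilon> * s)) = lower.strip_pt (lower.shear c (z + of_real s * u))"
        using shear_class_lower[OF c 1(3) reg] *(3)[of s] s 2(2) 1(2) by simp
      then show "shear_class c (\<gamma> (t + \<epsilon> * s)) = surface_pt M (l2, y2 + of_real s * u')"
        using 2(4)[OF s] unfolding lower_shear_path u'_def by simp
    qed
  next
    case (2 \<delta>' z)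
    have regs: "upper.regular_z (upper.shear c z + of_real s * u')" if "0 \<le> s" "s \<le> \<delta>'" for s
      using upper.shear_regular[OF c upper.regular_zI[OF 2(3)[OF that] reg]] that 2(2)
      unfolding upper_shear_path u'_def by simp
    obtain \<delta>2 l2 y2 where 3: "\<delta>2 > 0" "\<delta>2 \<le> \<delta>'" "l2 \<in> faces M"
      "\<And>s. 0 \<le> s \<Longrightarrow> s \<le> \<delta>2 \<Longrightarrow> y2 + of_real s * u' \<in> face M l2 \<and>
        upper.strip_pt (upper.shear c z + of_real s * u') = surface_pt M (l2, y2 + of_real s * u')"
      using upper.strip_path[OF 2(1) regs] by metis
    show ?thesis
    proof (intro exI[of _ \<delta>2] conjI bexI[of _ l2] exI[of _ y2] allI impI 3(1) 3(3))
      fix s assume s: "0 \<le> s" "s \<le> \<delta>2"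
      show "y2 + of_real s * u' \<in> face M l2" using 3(4)[OF s] by simp
      have "shear_class c (\<gamma> (t + \<epsilon> * s)) = upper.strip_pt (upper.shear c (z + of_real s * u))"
        using shear_class_upper[OF c 2(3) reg] *(3)[of s] s 2(2) 3(2) by simp
      then show "shear_class c (\<gamma> (t + \<epsilon> * s)) = surface_pt M (l2, y2 + of_real s * u')"
        using 3(4)[OF s] unfolding upper_shear_path u'_def by simp
    qed
  qed
  then show "\<exists>\<delta>>0. \<exists>l\<in>faces M. \<exists>y. \<forall>s. 0 \<le> s \<longrightarrow> s \<le> \<delta> \<longrightarrow>
      y + of_real s * (of_real \<epsilon> * (d + of_real (c * golden / sn * Im d))) \<in> face M l \<and>
      shear_class c (\<gamma> (t + \<epsilon> * s)) = surface_pt M (l, y + of_real s * (of_real \<epsilon> * (d + of_real (c * golden / sn * Im d))))"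
    unfolding u' .
qed

section \<open>Directions in which all trajectories close up\<close>

text \<open>The times 1 and phi are the circumferences of the horizontal cylinders at velocity 1. An
  affine automorphism does not change the time parameter, so the property passes from d to its image
  under the derivative.\<close>

definition closed_direction :: "complex \<Rightarrow> bool" where
  "closed_direction d \<longleftrightarrow> (\<forall>\<gamma>. straight_trajectory M d \<gamma> \<longrightarrow>
    (\<forall>t. \<gamma> (t + 1) = \<gamma> t) \<or> (\<forall>t. \<gamma> (t + golden) = \<gamma> t))"

lemma closed_direction_shear:
  assumes "closed_direction d" shows "closed_direction (d + of_real (golden / sn * Im d))"
  unfolding closed_direction_def
proof (intro allI impI)
  fix \<gamma> assume st: "straight_trajectory M (d + of_real (golden / sn * Im d)) \<gamma>"
  define \<gamma>' where "\<gamma>' t = shear_class (- 1) (\<gamma> t)" for t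
  have "straight_trajectory M d \<gamma>'"
    using straight_trajectory_shear[OF st, of "- 1"] unfolding \<gamma>'_def by simp
  then have *: "(\<forall>t. \<gamma>' (t + 1) = \<gamma>' t) \<or> (\<forall>t. \<gamma>' (t + golden) = \<gamma>' t)"
    using assms by (simp add: closed_direction_def)
  have eq: "\<gamma> t = shear_class 1 (\<gamma>' t)" for t
  proof -
    obtain a where a: "\<gamma> t = surface_pt M a"
      using straight_trajectoryD_dir[OF st, of 1 t] by metis
    then have "regular a" using trajectory_regular(1)[OF st] surface_pt_self by (metis surj_pair)
    from shear_class_inverse(1)[of "- 1", OF _ this] a show ?thesis by (simp add: \<gamma>'_def)
  qed
  show "(\<forall>t. \<gamma> (t + 1) = \<gamma> t) \<or> (\<forall>t. \<gamma> (t + golden) = \<gamma> t)"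
    using * unfolding eq by (elim disjE) simp_all
qed

end

context strip_surface
begin

lemma strip_trajectory:
  assumes "lo < Im z" "Im z < hi"
  shows "straight_trajectory M 1 (\<lambda>t. strip_pt (z + of_real t))"
proof (rule straight_trajectoryI)
  have reg: "regular_z (z + of_real t)" for t
    by (rule regular_z_interior) (use assms in simp_all)
  show "(l, c) \<notin> strip_pt (z + of_real t)" if "l \<in> faces M" "c \<in> corners M l" for t l c
    using tile_exists[OF reg[of t]] strip_pt_eq regular_no_corner that by metis
  fix t \<epsilon> :: real
  have eq: "z + of_real (t + \<epsilon> * s) = z + of_real t + of_real s * (of_real \<epsilon> * 1)" for s by simp
  have "regular_z (z + of_real t + of_real s * (of_real \<epsilon> * 1))" for s
    using reg[of "t + \<epsilon> * s"] unfolding eq .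
  from strip_path[OF zero_less_one this]
  show "\<exists>\<delta>>0. \<exists>l\<in>faces M. \<exists>y. \<forall>s. 0 \<le> s \<longrightarrow> s \<le> \<delta> \<longrightarrow>
      y + of_real s * (of_real \<epsilon> * 1) \<in> face M l \<and>
      strip_pt (z + of_real (t + \<epsilon> * s)) = surface_pt M (l, y + of_real s * (of_real \<epsilon> * 1))"
    unfolding eq by blast
qed

lemma strip_trajectory_closed:
  assumes "straight_trajectory M 1 \<gamma>" "\<gamma> 0 = surface_pt M a" "tile z a" "regular a" "lo < Im z" "Im z < hi"
  shows "\<gamma> (t + C) = \<gamma> t"
proof -
  have "\<gamma> 0 = strip_pt (z + of_real 0)" using strip_pt_eq[OF assms(3,4)] assms(2) by simp
  then have "\<gamma> = (\<lambda>t. strip_pt (z + of_real t))"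
    using trajectory_unique[OF assms(1) strip_trajectory[OF assms(5,6)], of 0] by simp
  then show ?thesis using strip_pt_shift[of "z + of_real t" 1] by (simp add: add.assoc)
qed

text \<open>Such a trajectory would run into an end of the horizontal section at height h, and both
  ends are vertices.\<close>

lemma horizontal_misses_level:
  assumes st: "straight_trajectory M 1 \<gamma>" and a: "\<gamma> 0 = surface_pt M (l, y)" "regular (l, y)"
    and h: "Im (of_real (dp_sign l) * y) = h" "lo \<le> h" "h \<le> hi"
    and corners: "Complex (half_width h) h \<in> range vtx" "Complex (- half_width h) h \<in> range vtx"
  shows False
proof -
  define e where "e = dp_sign l"
  have l: "l \<in> faces M" using a(2) by (simp add: regular_def)
  have e: "e = 1 \<or> e = - 1" using pentagon_surface.e[OF pentagon_surface_axioms l] by (simp add: e_def)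
  have y: "of_real e * y \<in> pent" using a(2) by (simp add: regular_def e_def)
  have Im_ey: "Im (of_real e * y) = h" using h(1) by (simp add: e_def)
  have x: "\<bar>e * Re y\<bar> \<le> half_width h" using y Q_section[of "of_real e * y"] h Im_ey by simp
  \<comment> \<open>The time until the right end of the section in the face. For the face -Q the
    normalized point is then the left end of the section of Q.\<close>
  define b where "b = half_width h - e * (e * Re y)"
  have b0: "0 \<le> b" using x e by (auto simp: b_def)
  have path: "y + of_real s * 1 \<in> face M l" if "0 \<le> s" "s \<le> b" for s
  proof -
    have "\<bar>e * (Re y + s)\<bar> \<le> half_width h" using that x e unfolding b_def by auto
    then have "of_real e * (y + of_real s * 1) \<in> pent"
      using Q_section[of "of_real e * (y + of_real s * 1)"] Im_ey h by simp
    then show ?thesis using face[OF l] by (simp add: e_def)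
  qed
  have "\<gamma> b = surface_pt M (l, y + of_real b * 1)"
    using trajectory_follows_segment[OF st b0 l path, of 0] a(1) by simp
  then have "regular (l, y + of_real b * 1)" using trajectory_regular(1)[OF st] surface_pt_self by metis
  moreover have "of_real e * (y + of_real b * 1) = Complex (e * half_width h) h"
    using e Im_ey by (auto simp: complex_eq_iff b_def)
  then have "of_real e * (y + of_real b * 1) \<in> range vtx" using e corners by auto
  ultimately show False by (simp add: regular_def e_def)
qed

end

context double_pent
begin

text \<open>The heights of the vertices are excluded by \<open>horizontal_misses_level\<close>, so
  the trajectory runs in the interior of one strip and closes after its circumference.\<close>

lemma closed_direction_1: "closed_direction 1"
  unfolding closed_direction_def
proof (intro allI impI)
  fix \<gamma> assume st: "straight_trajectory M 1 \<gamma>"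
  obtain l y where a: "\<gamma> 0 = surface_pt M (l, y)"
    using straight_trajectoryD_dir[OF st, of 1 0] by metis
  then have reg: "regular (l, y)" using trajectory_regular(1)[OF st] surface_pt_self by metis
  define h where "h = Im (of_real (dp_sign l) * y)"
  have pos: "0 < sn" "sn < golden * sn" using sn_pos sn_golden by auto
  have bottom: "h \<noteq> - apo"
  proof
    assume h: "h = - apo"
    have hw: "low_half (- apo) = (golden - 1) / 2" by (simp add: low_half_def)
    have "Complex (low_half h) h = vtx 1" "Complex (- low_half h) h = vtx 0"
      unfolding h hw vtx_0 vtx_1 by (simp_all only: minus_divide_left)
    then have "Complex (low_half h) h \<in> range vtx" "Complex (- low_half h) h \<in> range vtx" by auto
    then show False
      using lower.horizontal_misses_level[OF st a reg, of h] h_def h pos by simp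
  qed
  have diag: "h \<noteq> sn - apo"
  proof
    assume h: "h = sn - apo"
    have hw: "low_half (sn - apo) = 1 / 2" using pos by (simp add: low_half_def field_simps)
    have "Complex (low_half h) h = vtx 2" "Complex (- low_half h) h = vtx 4"
      unfolding h hw vtx_2 vtx_4 by simp_all
    then have "Complex (low_half h) h \<in> range vtx" "Complex (- low_half h) h \<in> range vtx" by auto
    then show False
      using lower.horizontal_misses_level[OF st a reg, of h] h_def h pos by simp
  qed
  have top: "h \<noteq> golden * sn - apo"
  proof
    assume h: "h = golden * sn - apo"
    have hw: "high_half (golden * sn - apo) = 0" by (simp add: high_half_def)
    have "Complex (high_half h) h = vtx 3" "Complex (- high_half h) h = vtx 3"
      unfolding h hw vtx_3 by simp_all
    then have "Complex (high_half h) h \<in> range vtx" "Complex (- high_half h) h \<in> range vtx" by auto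
    then show False
      using upper.horizontal_misses_level[OF st a reg h_def[symmetric]] h pos by simp
  qed
  have lower_case: "\<forall>t. \<gamma> (t + golden) = \<gamma> t" if "lower.tile z (l, y)" "Im z \<noteq> - apo" "Im z \<noteq> sn - apo" for z
    using lower.strip_trajectory_closed[OF st a that(1) reg] that
    unfolding lower.tile_def lower.in_strip_def by (metis order_le_less)
  have upper_case: "\<forall>t. \<gamma> (t + 1) = \<gamma> t" if "upper.tile z (l, y)" "Im z \<noteq> golden * sn - apo" "Im z \<noteq> sn - apo" for z
    using upper.strip_trajectory_closed[OF st a that(1) reg] that
    unfolding upper.tile_def upper.in_strip_def by (metis order_le_less)
  from regular_label[OF reg] show "(\<forall>t. \<gamma> (t + 1) = \<gamma> t) \<or> (\<forall>t. \<gamma> (t + golden) = \<gamma> t)"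
  proof (elim disjE conjE)
    assume l: "l = pent" "y \<in> pent"
    then have "Im y = h" by (simp add: h_def)
    then show ?thesis
      using lower_case[of y] upper_case[of y] lower_tile_pent[OF l(2)] upper_tile_pent[OF l(2)] l bottom diag top
      by (metis linorder_linear)
  next
    assume l: "l = minus_pent" "- y \<in> pent"
    then have Imy: "Im y = - h" by (simp add: h_def)
    show ?thesis
    proof (cases "apo - sn \<le> Im y")
      case True
      have "Im (y + mid2 1) \<noteq> - apo" "Im (y + mid2 1) \<noteq> sn - apo"
        using diag bottom Imy by (auto simp: Re_Im_mid2)
      then show ?thesis using lower_case[of "y + mid2 1"] lower_tile_minus_pent[OF l(2) True] l by simp
    next
      case False
      have "Im (y + mid2 2) \<noteq> golden * sn - apo" "Im (y + mid2 2) \<noteq> sn - apo"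
        using diag top Imy by (auto simp: Re_Im_mid2 algebra_simps)
      then show ?thesis using upper_case[of "y + mid2 2"] upper_tile_minus_pent[OF l(2)] False l by simp
    qed
  qed
qed

text \<open>Multiplication by - zeta^j exchanges Q and -Q and shifts the numbers of the sides by
  j.\<close>

lemma glue_rel_rotate:
  assumes "((l, y), (l', y')) \<in> glue_rel M"
  shows "((uminus ` l, - zeta j * y), (uminus ` l', - zeta j * y')) \<in> glue_rel M"
proof -
  obtain i where i: "l \<in> faces M" "of_real (dp_sign l) * y \<in> edge i" "l' = uminus ` l"
    "y' = y - of_real (dp_sign l) * mid2 i"
    using assms unfolding glue_iff dp_nb_def by auto
  have l: "uminus ` l \<in> faces M" "dp_sign (uminus ` l) = - dp_sign l"
    using nb_face[OF i(1)] e_nb[OF i(1)] by (simp_all add: dp_nb_def)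
  have "of_real (dp_sign (uminus ` l)) * (- zeta j * y) = zeta j * (of_real (dp_sign l) * y)"
    unfolding l by simp
  then have "of_real (dp_sign (uminus ` l)) * (- zeta j * y) \<in> edge (i + j)"
    using i(2) by (simp add: edge_rot_iff)
  moreover have "- zeta j * y' = - zeta j * y - of_real (dp_sign (uminus ` l)) * mid2 (i + j)"
    unfolding i(4) l mid2_add by (simp add: algebra_simps)
  ultimately show ?thesis
    unfolding glue_iff dp_nb_def i(3) using l(1) by blast
qed

text \<open>Since omega = - zeta^3, the rotation by pi/5 is one of those in
  \<open>glue_rel_rotate\<close>. A trajectory in direction omega d is pulled back by the inverse -
  zeta^2.\<close>

lemma closed_direction_rotate:
  assumes "closed_direction d" shows "closed_direction (omega * d)"
  unfolding closed_direction_def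
proof (intro allI impI)
  fix \<gamma> assume st: "straight_trajectory M (omega * d) \<gamma>"
  have om: "omega = - zeta 3" "- zeta 2 * omega = 1"
    using zeta_add[of 2 3] zeta_5[of 1] by (simp_all add: zeta_3)
  have inv: "- zeta 2 * (- zeta 3 * y) = y" "- zeta 3 * (- zeta 2 * y) = y" for y
    using zeta_add[of 2 3] zeta_5[of 1] by (simp_all add: mult.commute[of "zeta 3"] flip: mult.assoc)
  define A where "A = map_prod ((`) uminus :: complex set \<Rightarrow> _) (\<lambda>y. - zeta 2 * y)"
  have face_rot: "(\<lambda>y. - zeta j * y) y \<in> face M (uminus ` l)" if "l \<in> faces M" "y \<in> face M l" for j y l
  proof -
    have l: "uminus ` l \<in> faces M" "dp_sign (uminus ` l) = - dp_sign l"
      using nb_face[OF that(1)] e_nb[OF that(1)] by (simp_all add: dp_nb_def)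
    have "of_real (dp_sign (uminus ` l)) * (- zeta j * y) = zeta j * (of_real (dp_sign l) * y)"
      unfolding l by simp
    then show ?thesis using face[OF that(1)] face[OF l(1)] that(2) by (simp add: pent_rot_iff)
  qed
  have corner_rot: "(\<lambda>y. - zeta j * y) y \<in> corners M (uminus ` l)" if "l \<in> faces M" "y \<in> corners M l" for j y l
  proof -
    have l: "uminus ` l \<in> faces M" "dp_sign (uminus ` l) = - dp_sign l"
      using nb_face[OF that(1)] e_nb[OF that(1)] by (simp_all add: dp_nb_def)
    have "of_real (dp_sign (uminus ` l)) * (- zeta j * y) = zeta j * (of_real (dp_sign l) * y)"
      unfolding l by simp
    then show ?thesis using corners[OF that(1)] corners[OF l(1)] that(2) by (simp add: vtx_rot_range)
  qed
  have st': "straight_trajectory M d (\<lambda>t. A ` \<gamma> t)"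
    unfolding A_def
  proof (rule straight_trajectory_image(1)[OF st, where g = "(`) uminus" and B = "\<lambda>y. - zeta 3 * y"])
    show "- zeta 2 * (y + of_real s * (omega * d)) = - zeta 2 * y + of_real s * d" for y s
    proof -
      have "- zeta 2 * (of_real s * (omega * d)) = of_real s * ((- zeta 2 * omega) * d)" by simp
      then show ?thesis unfolding om(2) by (simp add: distrib_left)
    qed
    show "uminus ` uminus ` l = l" "uminus ` uminus ` l = l" for l :: "complex set" by (simp_all add: image_image)
    show "- zeta 3 * (- zeta 2 * y) = y" "- zeta 2 * (- zeta 3 * y) = y" for y using inv by auto
    show "uminus ` l \<in> faces M" "uminus ` l \<in> faces M" if "l \<in> faces M" for l
      using nb_face[OF that] by (simp_all add: dp_nb_def)
  qed (use face_rot corner_rot glue_rel_rotate in auto)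
  have *: "(\<forall>t. A ` \<gamma> (t + 1) = A ` \<gamma> t) \<or> (\<forall>t. A ` \<gamma> (t + golden) = A ` \<gamma> t)"
    by (rule assms[unfolded closed_direction_def, rule_format, OF st'])
  have "inj A"
    unfolding A_def
    by (intro prod.inj_map injI) (auto dest: arg_cong[of _ _ "(`) uminus"] simp: image_image)
  then show "(\<forall>t. \<gamma> (t + 1) = \<gamma> t) \<or> (\<forall>t. \<gamma> (t + golden) = \<gamma> t)"
    using * by (simp add: inj_image_eq_iff)
qed

text \<open>In the basis 1, \<open>omega\<close> the rotation by pi/5 is R: (x, y) -> (- y, x + phi
  y) and the multi-twist is T = sigma_0; then sigma_k = T R^k for k = 0, ..., 3.\<close>

lemma closed_direction_sigma:
  assumes "k \<in> {0, 1, 2, 3}" "closed_direction (cpl (u $ 1) (u $ 2))"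
  shows "closed_direction (cpl ((sigma k *v u) $ 1) ((sigma k *v u) $ 2))"
proof -
  have shear: "closed_direction (cpl (x + golden * y) y)" if "closed_direction (cpl x y)" for x y
  proof -
    have "golden / sn * Im (cpl x y) = golden * y" using sn_pos by (simp add: cpl_def omega_eq)
    then have "cpl x y + of_real (golden / sn * Im (cpl x y)) = cpl (x + golden * y) y"
      by (simp add: cpl_def)
    then show ?thesis using closed_direction_shear[OF that] by simp
  qed
  have rotate: "closed_direction (cpl (- y) (x + golden * y))" if "closed_direction (cpl x y)" for x y
  proof -
    have "omega * cpl x y = cpl (- y) (x + golden * y)"
      by (simp add: cpl_def algebra_simps omega_mult)
    then show ?thesis using closed_direction_rotate[OF that] by simp
  qed
  consider "k = 0" | "k = 1" | "k = 2" | "k = 3" using assms(1) by blast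
  then show ?thesis
  proof cases
    case 1
    then show ?thesis using shear[OF assms(2)] by (simp add: sigma_mult)
  next
    case 2
    then show ?thesis using shear[OF rotate[OF assms(2)]]
      by (simp add: sigma_mult algebra_simps golden_mult)
  next
    case 3
    then show ?thesis using shear[OF rotate[OF rotate[OF assms(2)]]]
      by (simp add: sigma_mult algebra_simps golden_mult)
  next
    case 4
    then show ?thesis using shear[OF rotate[OF rotate[OF rotate[OF assms(2)]]]]
      by (simp add: sigma_mult algebra_simps golden_mult)
  qed
qed

lemma closed_direction_tree:
  assumes "tree_word ks"
  shows "closed_direction (cpl (tree_vector ks $ 1) (tree_vector ks $ 2))"
  using assms
proof (induction rule: tree_vector_induct)
  case Nil
  then show ?case using closed_direction_1 by (simp add: cpl_def)
next
  case (snoc k u)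
  then show ?case using closed_direction_sigma by blast
qed

end

lemma mod5_rules:
  fixes x y m n :: int
  shows "x mod 5 = y mod 5 \<Longrightarrow> (2 * x) mod 5 = (2 * y) mod 5"
    and "x mod 5 = (3 * y) mod 5 \<Longrightarrow> (2 * x) mod 5 = y mod 5"
    and "x mod 5 = (n - m) mod 5 \<Longrightarrow> (x + m) mod 5 = n mod 5"
    and "x mod 5 = (m - n) mod 5 \<Longrightarrow> (m - x) mod 5 = n mod 5"
proof -
  have *: "(2 * x) mod 5 = (2 * y) mod 5" if "x mod 5 = y mod 5" for x y :: int
    using that by (metis mod_mult_right_eq)
  then show "x mod 5 = y mod 5 \<Longrightarrow> (2 * x) mod 5 = (2 * y) mod 5" .
  have "2 * (3 * y) = y + y * 5" by simp
  then have "(2 * (3 * y)) mod 5 = y mod 5" by (metis mod_mult_self1)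
  then show "x mod 5 = (3 * y) mod 5 \<Longrightarrow> (2 * x) mod 5 = y mod 5" using *[of x "3 * y"] by simp
  show "x mod 5 = (n - m) mod 5 \<Longrightarrow> (x + m) mod 5 = n mod 5"
    by (metis mod_add_left_eq diff_add_cancel)
  have "m - x - n = - (x - (m - n))" by simp
  then show "x mod 5 = (m - n) mod 5 \<Longrightarrow> (m - x) mod 5 = n mod 5"
    unfolding mod_eq_dvd_iff by (metis dvd_minus_iff)
qed

section \<open>The two surfaces of the pentagon table\<close>

definition sgn_set :: "real \<Rightarrow> complex set \<Rightarrow> complex set" where
  "sgn_set e S = {y. of_real e * y \<in> S}"

lemma sgn_set_image:
  assumes "e = 1 \<or> e = - 1" shows "(\<lambda>z. of_real e * z) ` S = sgn_set e S"
proof -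
  have ee: "of_real e * (of_real e * z) = z" for z :: complex using assms by auto
  show ?thesis
  proof
    show "(\<lambda>z. of_real e * z) ` S \<subseteq> sgn_set e S" by (auto simp: sgn_set_def ee)
    show "sgn_set e S \<subseteq> (\<lambda>z. of_real e * z) ` S"
    proof
      fix y assume "y \<in> sgn_set e S"
      then show "y \<in> (\<lambda>z. of_real e * z) ` S"
        by (intro image_eqI[of _ _ "of_real e * y"]) (simp_all add: sgn_set_def ee)
    qed
  qed
qed

lemma uminus_sgn_set: "uminus ` sgn_set e S = sgn_set (- e) S"
proof
  show "uminus ` sgn_set e S \<subseteq> sgn_set (- e) S" by (auto simp: sgn_set_def)
  show "sgn_set (- e) S \<subseteq> uminus ` sgn_set e S"
  proof
    fix y assume "y \<in> sgn_set (- e) S"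
    then show "y \<in> uminus ` sgn_set e S" by (intro image_eqI[of _ _ "- y"]) (simp_all add: sgn_set_def)
  qed
qed

text \<open>A horizontal side forces its midpoint, at the angle a + pi/5, to lie on the vertical
  axis. So the table is Q or -Q up to the numbering of its vertices; the unit diagonal fixes the
  radius.\<close>

lemma pentagon_table_form:
  assumes "pentagon_table p"
  obtains \<epsilon> :: real and k :: int where "\<epsilon> = 1 \<or> \<epsilon> = - 1" "\<And>j. p j = of_real \<epsilon> * vtx (int j + k)"
proof -
  obtain r \<theta> K where r: "r > 0" and p: "\<And>k. p k = of_real r * cis (\<theta> + 2 * pi * real k / 5)"
    and K: "Im (p K) = Im (p (Suc K))" and dist: "dist (p 0) (p 2) = 1"
    using assms unfolding pentagon_table_def by auto
  define a where "a = \<theta> + 2 * pi * real K / 5"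
  have aS: "\<theta> + 2 * pi * real (Suc K) / 5 = a + 2 * pi / 5" by (simp add: a_def field_simps)
  have "sin a = sin (a + 2 * pi / 5)" using K r unfolding p aS by (simp add: a_def)
  then have "sin (a + 2 * pi / 5) - sin a = 0" by simp
  then have "2 * sin ((a + 2 * pi / 5 - a) / 2) * cos ((a + 2 * pi / 5 + a) / 2) = 0"
    unfolding sin_diff_sin .
  moreover have eqs: "(a + 2 * pi / 5 - a) / 2 = pi / 5" "(a + 2 * pi / 5 + a) / 2 = a + pi / 5" by simp_all
  ultimately have "2 * sn * cos (a + pi / 5) = 0" by (simp only:)
  then have cos0: "cos (a + pi / 5) = 0" using sn_pos by simp
  \<comment> \<open>The sign is 1 if the horizontal side is below the center and -1 if it is
    above.\<close>
  define \<epsilon> where "\<epsilon> = - sin (a + pi / 5)"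
  have "(sin (a + pi / 5))\<^sup>2 = 1" using sin_cos_squared_add[of "a + pi / 5"] cos0 by simp
  then have \<epsilon>: "\<epsilon> = 1 \<or> \<epsilon> = - 1" by (auto simp: \<epsilon>_def power2_eq_1_iff)
  have cis_a: "cis (a + pi / 5) = - of_real \<epsilon> * \<i>" by (simp add: complex_eq_iff cos0 \<epsilon>_def)
  have p2: "p j = of_real \<epsilon> * (- \<i> * of_real r * cnj omega * zeta (int j - int K))" for j
  proof -
    have "\<theta> + 2 * pi * real j / 5 = (a + pi / 5) + (- (pi / 5)) + 2 * pi * of_int (int j - int K) / 5"
      by (simp add: a_def field_simps)
    then have "cis (\<theta> + 2 * pi * real j / 5) = cis (a + pi / 5) * cnj omega * zeta (int j - int K)"
      by (simp only: cis_mult[symmetric] zeta_def omega_def cis_cnj)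
    then show ?thesis unfolding p cis_a by simp
  qed
  have om: "omega * cnj omega = 1" using complex_norm_square[of omega] by simp
  have z1: "zeta 1 - 1 = omega * (2 * \<i> * of_real sn)"
    by (simp add: zeta_1 omega_eq complex_eq_iff field_simps sn_mult golden_mult)
  have "norm (zeta 1 - 1) = 2 * sn" unfolding z1 using sn_pos by (simp add: norm_mult)
  moreover have "norm (zeta 1 + 1) = golden" using golden_gt_1 by (simp add: zeta_1 norm_mult)
  moreover have "zeta 2 - 1 = (zeta 1 - 1) * (zeta 1 + 1)"
    using zeta_add[of 1 1] by (simp add: algebra_simps)
  ultimately have n2: "norm (zeta 2 - 1) = 2 * sn * golden" by (simp add: norm_mult)
  have "p 2 - p 0 = of_real \<epsilon> * (- \<i> * of_real r * cnj omega * zeta (- int K)) * (zeta 2 - 1)"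
    using zeta_add[of 2 "- int K"] unfolding p2 by (simp add: algebra_simps)
  then have "norm (p 2 - p 0) = r * (2 * sn * golden)"
    using \<epsilon> r by (auto simp: norm_mult n2)
  then have r1: "r * (2 * sn * golden) = 1" using dist by (simp add: dist_norm norm_minus_commute)
  have r2: "2 * sn * r = golden - 1"
  proof -
    have "2 * sn * r = (r * (2 * sn * golden)) * (golden - 1)"
      using golden_mult_minus_1 by (simp add: algebra_simps golden_mult)
    then show ?thesis by (simp add: r1)
  qed
  have "(- \<i> * of_real r * cnj omega) * (zeta 1 - 1) = of_real (2 * sn * r) * (omega * cnj omega)"
    unfolding z1 by (simp add: algebra_simps)
  then have "- \<i> * of_real r * cnj omega = of_real (golden - 1) / (zeta 1 - 1)"
    unfolding r2 om using zeta_1_neq_1 by (simp add: field_simps)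
  then have "p j = of_real \<epsilon> * vtx (int j + - int K)" for j
    unfolding p2 by (simp add: vtx_def)
  then show thesis using \<epsilon> that by blast
qed

text \<open>Matching the endpoints in the order of the boundary would give zeta^i = - zeta^j, which
  is impossible. So they are matched in the reverse order, and this determines j modulo 5 and
  c.\<close>

lemma sgn_set_edge_translate:
  assumes e: "e = 1 \<or> e = - 1"
  shows "(\<lambda>z. z + c) ` sgn_set e (edge i) = sgn_set (- e) (edge j) \<longleftrightarrow> zeta i = zeta j \<and> c = - of_real e * mid2 i"
proof -
  have e': "- e = 1 \<or> - e = - 1" using e by auto
  have g: "complex_of_real (golden - 1) \<noteq> 0" using golden_gt_1 by simp
  have seg: "sgn_set e (edge i) = closed_segment (of_real e * vtx i) (of_real e * vtx (i + 1))"
    if "e = 1 \<or> e = - 1" for e i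
    unfolding sgn_set_image[OF that, symmetric] edge_def
    by (rule closed_segment_linear_image[symmetric]) (simp add: linear_times)
  have tr: "(\<lambda>z. z + c) ` sgn_set e (edge i) = closed_segment (c + of_real e * vtx i) (c + of_real e * vtx (i + 1))"
    unfolding seg[OF e] closed_segment_translation by (simp add: add.commute)
  \<comment> \<open>The endpoints of a segment are its extreme points, so the set determines them up
    to order.\<close>
  have seg_eq: "{a, b} = {a', b'}" if "closed_segment a b = closed_segment a' b'" for a b a' b' :: complex
  proof -
    have "{a, b} = {x. x extreme_point_of (closed_segment a b)}" for a b :: complex
      by (auto simp: extreme_point_of_segment)
    then show ?thesis using that by metis
  qed
  show ?thesis
  proof
    assume "(\<lambda>z. z + c) ` sgn_set e (edge i) = sgn_set (- e) (edge j)"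
    then have "closed_segment (c + of_real e * vtx i) (c + of_real e * vtx (i + 1)) =
        closed_segment (of_real (- e) * vtx j) (of_real (- e) * vtx (j + 1))"
      unfolding tr seg[OF e'] .
    from seg_eq[OF this, unfolded doubleton_eq_iff]
    consider "c + of_real e * vtx i = of_real (- e) * vtx j" "c + of_real e * vtx (i + 1) = of_real (- e) * vtx (j + 1)"
      | "c + of_real e * vtx i = of_real (- e) * vtx (j + 1)" "c + of_real e * vtx (i + 1) = of_real (- e) * vtx j"
      by blast
    then show "zeta i = zeta j \<and> c = - of_real e * mid2 i"
    proof cases
      case 1
      then have "(c + of_real e * vtx (i + 1)) - (c + of_real e * vtx i) = of_real (- e) * vtx (j + 1) - of_real (- e) * vtx j"
        by simp
      then have "of_real e * (vtx (i + 1) - vtx i) = of_real e * - (vtx (j + 1) - vtx j)" by (simp add: algebra_simps)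
      then have "vtx (i + 1) - vtx i = - (vtx (j + 1) - vtx j)" using e by auto
      then have "of_real (golden - 1) * zeta i = of_real (golden - 1) * - zeta j" unfolding vtx_diff by simp
      then have "zeta i = - zeta j" using g unfolding mult_cancel_left by blast
      then show ?thesis using zeta_neq_minus by blast
    next
      case 2
      then have "(c + of_real e * vtx (i + 1)) - (c + of_real e * vtx i) = of_real (- e) * vtx j - of_real (- e) * vtx (j + 1)"
        by simp
      then have "of_real e * (vtx (i + 1) - vtx i) = of_real e * (vtx (j + 1) - vtx j)" by (simp add: algebra_simps)
      then have "vtx (i + 1) - vtx i = vtx (j + 1) - vtx j" using e by auto
      then have "of_real (golden - 1) * zeta i = of_real (golden - 1) * zeta j" unfolding vtx_diff by simp
      then have "zeta i = zeta j" using g unfolding mult_cancel_left by blast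
      then have "vtx j = vtx i" by (simp add: vtx_def)
      then have "c = - of_real e * mid2 i" using 2(2) by (simp add: mid2_def algebra_simps eq_neg_iff_add_eq_0)
      then show ?thesis using \<open>zeta i = zeta j\<close> by simp
    qed
  next
    assume asm: "zeta i = zeta j \<and> c = - of_real e * mid2 i"
    then have "edge j = edge i" by (metis edge_mod zeta_eq_iff)
    moreover have "c + of_real e * vtx i = of_real (- e) * vtx (i + 1)" "c + of_real e * vtx (i + 1) = of_real (- e) * vtx i"
    proof -
      have c: "c = - (of_real e * vtx i) - of_real e * vtx (i + 1)" using asm by (simp add: mid2_def ring_distribs)
      show "c + of_real e * vtx i = of_real (- e) * vtx (i + 1)" "c + of_real e * vtx (i + 1) = of_real (- e) * vtx i"
        by (simp_all add: c)
    qed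
    ultimately show "(\<lambda>z. z + c) ` sgn_set e (edge i) = sgn_set (- e) (edge j)"
      unfolding tr using seg[OF e'] by (simp add: closed_segment_commute)
  qed
qed

lemma glue_sides_sgn_set:
  assumes "e = 1 \<or> e = - 1"
  shows "(a, b) \<in> glue_sides l (sgn_set e (edge i)) l' (sgn_set (- e) (edge j)) \<longleftrightarrow>
    zeta i = zeta j \<and> (\<exists>y. of_real e * y \<in> edge i \<and> a = (l, y) \<and> b = (l', y - of_real e * mid2 i))"
  unfolding glue_sides_def sgn_set_edge_translate[OF assms] by (auto simp: sgn_set_def)

text \<open>\<epsilon> says whether the table is Q or -Q, and k is the shift between its vertex
  numbering and that of the upright pentagon: side i of the table is side i + k in absolute
  position.\<close>

locale table_form =
  fixes p :: "nat \<Rightarrow> complex" and \<epsilon> :: real and k :: int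
  assumes \<epsilon>: "\<epsilon> = 1 \<or> \<epsilon> = - 1" and p_eq: "p j = of_real \<epsilon> * vtx (int j + k)"
begin

lemma minus_\<epsilon>: "- \<epsilon> = 1 \<or> - \<epsilon> = - 1"
  using \<epsilon> by auto

lemma nat_index: obtains i :: nat where "i < 5" "(int i + k) mod 5 = n mod 5"
proof
  show "nat ((n - k) mod 5) < 5" by simp
  show "(int (nat ((n - k) mod 5)) + k) mod 5 = n mod 5" by (simp add: mod_add_left_eq)
qed

lemma vertices_eq: "vertices p = sgn_set \<epsilon> (range vtx)"
proof -
  have "p ` {..<5} = (\<lambda>z. of_real \<epsilon> * z) ` range vtx"
  proof
    show "p ` {..<5} \<subseteq> (\<lambda>z. of_real \<epsilon> * z) ` range vtx" by (auto simp: p_eq)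
    show "(\<lambda>z. of_real \<epsilon> * z) ` range vtx \<subseteq> p ` {..<5}"
    proof clarify
      fix n :: int
      obtain i :: nat where "i < 5" "(int i + k) mod 5 = n mod 5" by (rule nat_index)
      then show "of_real \<epsilon> * vtx n \<in> p ` {..<5}"
        by (intro image_eqI[of _ _ i]) (auto simp: p_eq, metis vtx_mod)
    qed
  qed
  then show ?thesis by (simp add: vertices_def sgn_set_image[OF \<epsilon>])
qed

lemma table_eq: "table p = sgn_set \<epsilon> pent"
  unfolding table_def vertices_eq sgn_set_image[OF \<epsilon>, symmetric] pent_def
  by (rule convex_hull_linear_image[symmetric]) (simp add: linear_times)

lemma side_eq: "side p i = sgn_set \<epsilon> (edge (int i + k))"
proof -
  have "int i + k + 1 = int (Suc i) + k" by simp
  then show ?thesis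
    unfolding side_def p_eq sgn_set_image[OF \<epsilon>, symmetric] edge_def
    by (metis (no_types, lifting) closed_segment_linear_image linear_times)
qed

lemma table_cases: "table p = pent \<and> \<epsilon> = 1 \<or> table p = minus_pent \<and> \<epsilon> = - 1"
proof -
  have "sgn_set 1 pent = pent" by (simp add: sgn_set_def)
  then show ?thesis using \<epsilon> uminus_sgn_set[of 1 pent] unfolding table_eq by metis
qed

lemma dp_sign_table: "dp_sign (table p) = \<epsilon>" "dp_sign (uminus ` table p) = - \<epsilon>"
  using table_cases by (auto simp: image_image)

lemma double_pentagon_gluing:
  "(a, b) \<in> gluing (double_pentagon p) \<longleftrightarrow>
    (\<exists>n y. of_real \<epsilon> * y \<in> edge n \<and> a = (table p, y) \<and> b = (uminus ` table p, y - of_real \<epsilon> * mid2 n))"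
proof -
  have "(a, b) \<in> gluing (double_pentagon p) \<longleftrightarrow> (\<exists>i<5. \<exists>j<5. zeta (int i + k) = zeta (int j + k) \<and>
    (\<exists>y. of_real \<epsilon> * y \<in> edge (int i + k) \<and> a = (table p, y) \<and>
      b = (uminus ` table p, y - of_real \<epsilon> * mid2 (int i + k))))"
    unfolding double_pentagon_def glued_surface.simps side_eq uminus_sgn_set UN_iff glue_sides_sgn_set[OF \<epsilon>]
    by auto
  also have "\<dots> \<longleftrightarrow> (\<exists>n y. of_real \<epsilon> * y \<in> edge n \<and> a = (table p, y) \<and> b = (uminus ` table p, y - of_real \<epsilon> * mid2 n))"
  proof
    assume "\<exists>n y. of_real \<epsilon> * y \<in> edge n \<and> a = (table p, y) \<and> b = (uminus ` table p, y - of_real \<epsilon> * mid2 n)"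
    then obtain n y where n: "of_real \<epsilon> * y \<in> edge n" "a = (table p, y)" "b = (uminus ` table p, y - of_real \<epsilon> * mid2 n)"
      by blast
    obtain i :: nat where i: "i < 5" "(int i + k) mod 5 = n mod 5" by (rule nat_index)
    then have "edge (int i + k) = edge n" "mid2 (int i + k) = mid2 n" by (metis edge_mod, metis mid2_mod)
    then show "\<exists>i<5. \<exists>j<5. zeta (int i + k) = zeta (int j + k) \<and>
      (\<exists>y. of_real \<epsilon> * y \<in> edge (int i + k) \<and> a = (table p, y) \<and>
        b = (uminus ` table p, y - of_real \<epsilon> * mid2 (int i + k)))"
      using n i by metis
  qed blast
  finally show ?thesis .
qed

sublocale dp: double_pent "double_pentagon p"
proof
  let ?D = "double_pentagon p"
  have F: "faces ?D = {table p, uminus ` table p}" by (simp add: double_pentagon_def)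
  show F': "faces ?D = {pent, minus_pent}"
    unfolding F using table_cases by (auto simp: image_image)
  have uu: "uminus ` uminus ` l = l" for l :: "complex set" by (simp add: image_image)
  have neq: "uminus ` table p \<noteq> table p" using table_cases minus_pent_neq uu by metis
  fix l assume l: "l \<in> faces ?D"
  show "dp_sign l = 1 \<or> dp_sign l = - 1" by (simp add: dp_sign_def)
  show "face ?D l = {y. of_real (dp_sign l) * y \<in> pent}"
  proof -
    have "face ?D l = l" by (simp add: double_pentagon_def)
    moreover have "l = sgn_set (dp_sign l) pent"
    proof -
      have "table p = sgn_set (dp_sign (table p)) pent"
        "uminus ` table p = sgn_set (dp_sign (uminus ` table p)) pent"
        unfolding dp_sign_table by (simp_all add: table_eq uminus_sgn_set)
      then show ?thesis using l unfolding F by blast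
    qed
    ultimately show ?thesis by (simp add: sgn_set_def)
  qed
  show "corners ?D l = {y. of_real (dp_sign l) * y \<in> range vtx}"
  proof -
    have "corners ?D l = sgn_set (dp_sign l) (range vtx)"
    proof -
      have "corners ?D (table p) = sgn_set (dp_sign (table p)) (range vtx)"
        "corners ?D (uminus ` table p) = sgn_set (dp_sign (uminus ` table p)) (range vtx)"
        unfolding dp_sign_table using neq by (simp_all add: double_pentagon_def vertices_eq uminus_sgn_set)
      then show ?thesis using l unfolding F by blast
    qed
    then show ?thesis by (simp add: sgn_set_def)
  qed
  show "dp_nb i l \<in> faces ?D" for i using l unfolding F dp_nb_def by (auto simp: uu)
  show "dp_sign (dp_nb i l) = - dp_sign l" for i
    using l unfolding F dp_nb_def by (auto simp: uu dp_sign_table)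
  show "dp_nb i (dp_nb i l) = l" for i by (simp add: dp_nb_def uu)
  show "dp_nb (i mod 5) l = dp_nb i l" for i by (simp add: dp_nb_def)
next
  let ?D = "double_pentagon p"
  have uu: "uminus ` uminus ` l = l" for l :: "complex set" by (simp add: image_image)
  have ee: "of_real \<epsilon> * (of_real \<epsilon> * z) = z" for z :: complex using \<epsilon> by auto
  fix a b
  have F: "faces ?D = {table p, uminus ` table p}" by (simp add: double_pentagon_def)
  show "(a, b) \<in> glue_rel ?D \<longleftrightarrow> (\<exists>l\<in>faces ?D. \<exists>i y. a = (l, y) \<and> of_real (dp_sign l) * y \<in> edge i \<and>
      b = (dp_nb i l, y - of_real (dp_sign l) * mid2 i))"
  proof -
    \<comment> \<open>The reversed pairs are rewritten with the opposite polygon as starting face,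
      the form required by the locale.\<close>
    have refl: "(\<exists>n y. of_real \<epsilon> * y \<in> edge n \<and> b = (table p, y) \<and> a = (uminus ` table p, y - of_real \<epsilon> * mid2 n)) \<longleftrightarrow>
      (\<exists>n y. - of_real \<epsilon> * y \<in> edge n \<and> a = (uminus ` table p, y) \<and> b = (table p, y + of_real \<epsilon> * mid2 n))"
    proof
      assume "\<exists>n y. of_real \<epsilon> * y \<in> edge n \<and> b = (table p, y) \<and> a = (uminus ` table p, y - of_real \<epsilon> * mid2 n)"
      then obtain n y where n: "of_real \<epsilon> * y \<in> edge n" "b = (table p, y)" "a = (uminus ` table p, y - of_real \<epsilon> * mid2 n)" by blast
      have "- of_real \<epsilon> * (y - of_real \<epsilon> * mid2 n) = mid2 n - of_real \<epsilon> * y" by (simp add: right_diff_distrib distrib_left ee)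
      then have "- of_real \<epsilon> * (y - of_real \<epsilon> * mid2 n) \<in> edge n" using edge_reflect[OF n(1)] by simp
      then show "\<exists>n y. - of_real \<epsilon> * y \<in> edge n \<and> a = (uminus ` table p, y) \<and> b = (table p, y + of_real \<epsilon> * mid2 n)"
        using n by (intro exI[of _ n] exI[of _ "y - of_real \<epsilon> * mid2 n"]) simp
    next
      assume "\<exists>n y. - of_real \<epsilon> * y \<in> edge n \<and> a = (uminus ` table p, y) \<and> b = (table p, y + of_real \<epsilon> * mid2 n)"
      then obtain n y where n: "- of_real \<epsilon> * y \<in> edge n" "a = (uminus ` table p, y)" "b = (table p, y + of_real \<epsilon> * mid2 n)" by blast
      have "of_real \<epsilon> * (y + of_real \<epsilon> * mid2 n) = mid2 n - - of_real \<epsilon> * y" by (simp add: right_diff_distrib distrib_left ee)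
      then have "of_real \<epsilon> * (y + of_real \<epsilon> * mid2 n) \<in> edge n" using edge_reflect[OF n(1)] by simp
      then show "\<exists>n y. of_real \<epsilon> * y \<in> edge n \<and> b = (table p, y) \<and> a = (uminus ` table p, y - of_real \<epsilon> * mid2 n)"
        using n by (intro exI[of _ n] exI[of _ "y + of_real \<epsilon> * mid2 n"]) simp
    qed
    have "(a, b) \<in> glue_rel ?D \<longleftrightarrow>
      (\<exists>n y. of_real \<epsilon> * y \<in> edge n \<and> a = (table p, y) \<and> b = (uminus ` table p, y - of_real \<epsilon> * mid2 n)) \<or>
      (\<exists>n y. - of_real \<epsilon> * y \<in> edge n \<and> a = (uminus ` table p, y) \<and> b = (table p, y + of_real \<epsilon> * mid2 n))"
      unfolding glue_rel_def Un_iff converse_iff double_pentagon_gluing refl ..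
    then show ?thesis
      unfolding F dp_nb_def by (auto simp: dp_sign_table uu)
  qed
qed

end

section \<open>The dihedral group\<close>

definition rot :: "int \<Rightarrow> complex \<Rightarrow> complex" where
  "rot a = (\<lambda>z. zeta a * z)"

text \<open>The reflection in the line of argument pi b / 5. Like those of the rotations, its index
  matters modulo 5 only.\<close>

definition refl :: "int \<Rightarrow> complex \<Rightarrow> complex" where
  "refl b = (\<lambda>z. zeta b * cnj z)"

lemma rot_refl_comp:
  "rot a \<circ> rot b = rot (a + b)" "rot a \<circ> refl b = refl (a + b)"
  "refl a \<circ> rot b = refl (a - b)" "refl a \<circ> refl b = rot (a - b)"
  by (auto simp: rot_def refl_def fun_eq_iff zeta_add cnj_zeta zeta_add[of a "- b", simplified])

lemma rot_eq_iff: "rot a = rot b \<longleftrightarrow> a mod 5 = b mod 5"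
proof
  assume "rot a = rot b"
  then have "rot a 1 = rot b 1" by simp
  then show "a mod 5 = b mod 5" by (simp add: rot_def zeta_eq_iff)
qed (simp add: rot_def flip: zeta_eq_iff)

lemma refl_eq_iff: "refl a = refl b \<longleftrightarrow> a mod 5 = b mod 5"
proof
  assume "refl a = refl b"
  then have "refl a 1 = refl b 1" by simp
  then show "a mod 5 = b mod 5" by (simp add: refl_def zeta_eq_iff)
qed (simp add: refl_def flip: zeta_eq_iff)

lemma rot_neq_refl [simp]: "rot a \<noteq> refl b" "refl b \<noteq> rot a"
proof -
  have "rot a \<noteq> refl b"
  proof
    assume *: "rot a = refl b"
    have "zeta a = zeta b" using fun_cong[OF *, of 1] by (simp add: rot_def refl_def)
    moreover have "zeta a * zeta 1 = zeta b * zeta (- 1)" using fun_cong[OF *, of "zeta 1"] by (simp add: rot_def refl_def cnj_zeta)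
    ultimately have "zeta 1 = zeta (- 1)" by simp
    then show False by (simp add: zeta_eq_iff)
  qed
  then show "rot a \<noteq> refl b" "refl b \<noteq> rot a" by auto
qed

text \<open>On the dihedral group this is the determinant. As z -> - cnj z preserves Q, the
  reflections in the group carry Q to -Q, so it also tells which of the two a copy is.\<close>

definition gsign :: "(complex \<Rightarrow> complex) \<Rightarrow> real" where
  "gsign g = (if g \<in> range rot then 1 else - 1)"

lemma gsign_simps [simp]: "gsign (rot a) = 1" "gsign (refl b) = - 1"
  by (auto simp: gsign_def)

lemma rot_image_sgn_set:
  assumes "e = 1 \<or> e = - 1"
  shows "rot a ` sgn_set e (edge n) = sgn_set e (edge (n + a))" "rot a ` sgn_set e pent = sgn_set e pent"
    "rot a ` sgn_set e (range vtx) = sgn_set e (range vtx)"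
proof -
  have *: "rot a ` sgn_set e S = sgn_set e T" if "\<And>z. zeta a * z \<in> T \<longleftrightarrow> z \<in> S" for S T
  proof
    have comm: "of_real e * (zeta c * z) = zeta c * (of_real e * z)" for c z by (rule mult.left_commute)
    show "rot a ` sgn_set e S \<subseteq> sgn_set e T"
      unfolding sgn_set_def rot_def using that comm by (metis (no_types, lifting) image_subsetI mem_Collect_eq)
    show "sgn_set e T \<subseteq> rot a ` sgn_set e S"
    proof
      fix y assume y: "y \<in> sgn_set e T"
      have eq: "zeta a * (of_real e * (zeta (- a) * y)) = of_real e * y" unfolding comm by simp
      have "of_real e * (zeta (- a) * y) \<in> S"
        unfolding that[symmetric] eq using y by (simp add: sgn_set_def)
      then show "y \<in> rot a ` sgn_set e S" by (intro image_eqI[of _ _ "zeta (- a) * y"]) (simp_all add: rot_def sgn_set_def)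
    qed
  qed
  show "rot a ` sgn_set e (edge n) = sgn_set e (edge (n + a))" "rot a ` sgn_set e pent = sgn_set e pent"
    "rot a ` sgn_set e (range vtx) = sgn_set e (range vtx)"
    by (rule *, simp add: edge_rot_iff pent_rot_iff vtx_rot_range)+
qed

lemma neg_cnj_iff: "- cnj z \<in> pent \<longleftrightarrow> z \<in> pent" "- cnj z \<in> edge (- n) \<longleftrightarrow> z \<in> edge n"
  "- cnj z \<in> range vtx \<longleftrightarrow> z \<in> range vtx"
proof -
  show "- cnj z \<in> pent \<longleftrightarrow> z \<in> pent" using pent_neg_cnj[of z] pent_neg_cnj[of "- cnj z"] by auto
  show "- cnj z \<in> edge (- n) \<longleftrightarrow> z \<in> edge n" using edge_neg_cnj[of z n] edge_neg_cnj[of "- cnj z" "- n"] by auto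
  have "- cnj z \<in> range vtx" if "z \<in> range vtx" for z using that by (auto simp: cnj_vtx)
  from this[of z] this[of "- cnj z"] show "- cnj z \<in> range vtx \<longleftrightarrow> z \<in> range vtx" by auto
qed

lemma refl_image_sgn_set:
  assumes "e = 1 \<or> e = - 1"
  shows "refl b ` sgn_set e (edge n) = sgn_set (- e) (edge (b - n))" "refl b ` sgn_set e pent = sgn_set (- e) pent"
    "refl b ` sgn_set e (range vtx) = sgn_set (- e) (range vtx)"
proof -
  have *: "refl b ` sgn_set e S = sgn_set (- e) T" if "\<And>z. zeta b * (- cnj z) \<in> T \<longleftrightarrow> z \<in> S" for S T
  proof
    have eq: "of_real (- e) * refl b z = zeta b * (- cnj (of_real e * z))" for z
      by (simp add: refl_def)
    show "refl b ` sgn_set e S \<subseteq> sgn_set (- e) T"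
      unfolding sgn_set_def using that eq by (metis (no_types, lifting) image_subsetI mem_Collect_eq)
    show "sgn_set (- e) T \<subseteq> refl b ` sgn_set e S"
    proof
      fix y assume y: "y \<in> sgn_set (- e) T"
      have eq: "zeta b * (- cnj (of_real e * (zeta b * cnj y))) = of_real (- e) * y"
      proof -
        have "zeta b * (of_real e * (zeta (- b) * y)) = of_real e * (zeta b * (zeta (- b) * y))" by (rule mult.left_commute)
        then show ?thesis by (simp add: cnj_zeta)
      qed
      have "of_real e * (zeta b * cnj y) \<in> S"
        unfolding that[symmetric] eq using y by (simp add: sgn_set_def)
      then show "y \<in> refl b ` sgn_set e S"
        by (intro image_eqI[of _ _ "zeta b * cnj y"]) (simp_all add: refl_def sgn_set_def cnj_zeta)
    qed
  qed
  have "zeta b * (- cnj z) \<in> edge (b - n) \<longleftrightarrow> z \<in> edge n" for z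
    using edge_rot_iff[of b "- cnj z" "- n"] neg_cnj_iff(2)[of z n] by (simp add: add.commute)
  then show "refl b ` sgn_set e (edge n) = sgn_set (- e) (edge (b - n))" by (rule *)
  show "refl b ` sgn_set e pent = sgn_set (- e) pent" "refl b ` sgn_set e (range vtx) = sgn_set (- e) (range vtx)"
    by (rule *, simp only: pent_rot_iff vtx_rot_range neg_cnj_iff)+
qed

context table_form
begin

text \<open>Up to a real factor the side is the vector zeta^n with n = i + k, and zeta^n / cnj
  (zeta^n) = zeta^(2 n).\<close>

lemma side_reflection_eq: "side_reflection p i = refl (2 * (int i + k))"
proof -
  define n where "n = int i + k"
  have "p (Suc i) - p i = of_real \<epsilon> * (vtx (n + 1) - vtx n)"
    by (simp add: p_eq n_def algebra_simps)
  then have u: "p (Suc i) - p i = of_real (\<epsilon> * (golden - 1)) * zeta n"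
    unfolding vtx_diff by simp
  have nz: "of_real (\<epsilon> * (golden - 1)) \<noteq> (0::complex)" using \<epsilon> golden_gt_1 by auto
  have "zeta n / zeta (- n) = zeta (2 * n)"
  proof -
    have "zeta (2 * n) * zeta (- n) = zeta n" by (simp flip: zeta_add)
    then show ?thesis by (simp add: divide_eq_eq)
  qed
  then have "(p (Suc i) - p i) / cnj (p (Suc i) - p i) = zeta (2 * n)"
    unfolding u using nz by (simp add: cnj_zeta)
  then show ?thesis by (simp only: side_reflection_def refl_def n_def fun_eq_iff Let_def simp_thms)
qed

lemma dihedral_eq: "dihedral p = range rot \<union> range refl"
proof
  show "dihedral p \<subseteq> range rot \<union> range refl"
  proof
    fix g assume "g \<in> dihedral p"
    then show "g \<in> range rot \<union> range refl"
    proof induction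
      case one
      have "id = rot 0" by (simp add: rot_def fun_eq_iff)
      then show ?case by (metis UnI1 rangeI)
    next
      case (mult g i)
      then show ?case
        unfolding side_reflection_eq by (metis UnE UnI1 UnI2 rangeE rangeI rot_refl_comp(2,4))
    qed
  qed
  have refl: "refl b \<in> dihedral p" for b
  proof -
    \<comment> \<open>3 is the inverse of 2 modulo 5, so the side reflections
      \<open>refl (2 * n)\<close> are all five reflections.\<close>
    obtain i :: nat where i: "i < 5" "(int i + k) mod 5 = (3 * b) mod 5" by (rule nat_index)
    have "(2 * (int i + k)) mod 5 = b mod 5" using i(2) by (rule mod5_rules(2))
    then have "refl (2 * (int i + k)) = refl b" by (simp add: refl_eq_iff)
    moreover have "id \<circ> side_reflection p i \<in> dihedral p" by (rule dihedral.mult[OF dihedral.one i(1)])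
    ultimately show ?thesis by (simp add: side_reflection_eq)
  qed
  have rot: "rot a \<in> dihedral p" for a
  proof -
    have "refl (a + 2 * k) \<circ> side_reflection p 0 \<in> dihedral p" by (rule dihedral.mult[OF refl]) simp
    then show ?thesis by (simp add: side_reflection_eq rot_refl_comp)
  qed
  show "range rot \<union> range refl \<subseteq> dihedral p" using refl rot by auto
qed

lemma dihedral_cases:
  assumes "g \<in> dihedral p" obtains a where "g = rot a" | b where "g = refl b"
  using assms unfolding dihedral_eq by auto

definition nk_sign :: "(complex \<Rightarrow> complex) \<Rightarrow> real" where
  "nk_sign g = \<epsilon> * gsign g"

definition nk_nb :: "int \<Rightarrow> (complex \<Rightarrow> complex) \<Rightarrow> complex \<Rightarrow> complex" where
  "nk_nb i g = refl (2 * i) \<circ> g"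

lemma nk_sign_simps [simp]: "nk_sign (rot a) = \<epsilon>" "nk_sign (refl b) = - \<epsilon>"
  by (simp_all add: nk_sign_def)

lemma nk_nb_simps [simp]: "nk_nb i (rot a) = refl (2 * i - a)" "nk_nb i (refl b) = rot (2 * i - b)"
  by (simp_all add: nk_nb_def rot_refl_comp)

lemma dihedral_image:
  assumes "g \<in> dihedral p"
  shows "g ` table p = sgn_set (nk_sign g) pent" "g ` vertices p = sgn_set (nk_sign g) (range vtx)"
  using assms by (cases rule: dihedral_cases;
    simp add: table_eq vertices_eq rot_image_sgn_set[OF \<epsilon>] refl_image_sgn_set[OF \<epsilon>])+

text \<open>
  The side \<open>i\<close> of the copy \<open>gQ\<close> is its side number \<open>n\<close> in absolute position, and the neighboring copy
  \<open>g s\<^sub>i Q\<close> is obtained from \<open>gQ\<close> by the reflection \<open>g s\<^sub>i g\<^sup>-\<^sup>1 = refl (2 n)\<close>.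
\<close>

lemma necklace_gluing:
  "(a, b) \<in> gluing (necklace p) \<longleftrightarrow> (\<exists>g\<in>dihedral p. \<exists>n y. a = (g, y) \<and> of_real (nk_sign g) * y \<in> edge n \<and>
    b = (nk_nb n g, y - of_real (nk_sign g) * mid2 n))" (is "_ \<longleftrightarrow> ?R")
proof -
  have one: "(\<exists>j<5. (a, b) \<in> glue_sides g (g ` side p i) (g \<circ> side_reflection p i) ((g \<circ> side_reflection p i) ` side p j))
     \<longleftrightarrow> (\<exists>y. a = (g, y) \<and> of_real (nk_sign g) * y \<in> edge n \<and> b = (nk_nb n g, y - of_real (nk_sign g) * mid2 n))"
    if g: "g = rot m \<and> n = int i + k + m \<or> g = refl m \<and> n = m - (int i + k)" and i: "i < 5" for g i m n
    using g
  proof (elim disjE conjE)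
    assume g: "g = rot m" and n: "n = int i + k + m"
    have eq: "g ` side p i = sgn_set \<epsilon> (edge n)" "g \<circ> side_reflection p i = nk_nb n g"
      "nk_nb n g ` side p j = sgn_set (- \<epsilon>) (edge (2 * n - m - (int j + k)))" for j
      unfolding g n by (simp_all add: side_eq rot_image_sgn_set[OF \<epsilon>] refl_image_sgn_set[OF \<epsilon>] side_reflection_eq
        rot_refl_comp algebra_simps)
    \<comment> \<open>Among the sides of the neighbor only the one with the same number i is
      glued.\<close>
    have "zeta n = zeta (2 * n - m - (int j + k)) \<longleftrightarrow> int i mod 5 = int j mod 5" for j
    proof -
      have "n - (2 * n - m - (int j + k)) = int j - int i" using n by simp
      then show ?thesis unfolding zeta_eq_iff mod_eq_dvd_iff by (metis dvd_diff_commute)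
    qed
    then show ?thesis unfolding eq glue_sides_sgn_set[OF \<epsilon>] using i g by auto
  next
    assume g: "g = refl m" and n: "n = m - (int i + k)"
    have eq: "g ` side p i = sgn_set (- \<epsilon>) (edge n)" "g \<circ> side_reflection p i = nk_nb n g"
      "nk_nb n g ` side p j = sgn_set (- (- \<epsilon>)) (edge ((int j + k) + (2 * n - m)))" for j
      unfolding g n by (simp_all add: side_eq rot_image_sgn_set[OF \<epsilon>] refl_image_sgn_set[OF \<epsilon>] side_reflection_eq
        rot_refl_comp algebra_simps)
    have "zeta n = zeta ((int j + k) + (2 * n - m)) \<longleftrightarrow> int i mod 5 = int j mod 5" for j
    proof -
      have "n - ((int j + k) + (2 * n - m)) = int i - int j" using n by simp
      then show ?thesis unfolding zeta_eq_iff mod_eq_dvd_iff by metis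
    qed
    then show ?thesis unfolding eq glue_sides_sgn_set[OF minus_\<epsilon>] using i g by auto
  qed
  have unf: "(a, b) \<in> gluing (necklace p) \<longleftrightarrow> (\<exists>g\<in>dihedral p. \<exists>i<5. \<exists>j<5.
    (a, b) \<in> glue_sides g (g ` side p i) (g \<circ> side_reflection p i) ((g \<circ> side_reflection p i) ` side p j))"
    unfolding necklace_def glued_surface.simps UN_iff by auto
  show ?thesis
  proof
    assume "(a, b) \<in> gluing (necklace p)"
    then obtain g i where g: "g \<in> dihedral p" "i < 5" and ex: "\<exists>j<5.
      (a, b) \<in> glue_sides g (g ` side p i) (g \<circ> side_reflection p i) ((g \<circ> side_reflection p i) ` side p j)"
      unfolding unf by blast
    obtain n m where "g = rot m \<and> n = int i + k + m \<or> g = refl m \<and> n = m - (int i + k)"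
      using g(1) by (cases rule: dihedral_cases) auto
    from ex[unfolded one[OF this g(2)]] show ?R using g(1) by blast
  next
    assume ?R
    then obtain g n y where g: "g \<in> dihedral p" and y: "a = (g, y)" "of_real (nk_sign g) * y \<in> edge n"
      "b = (nk_nb n g, y - of_real (nk_sign g) * mid2 n)" by blast
    obtain m i n' where m: "i < 5" "g = rot m \<and> n' = int i + k + m \<or> g = refl m \<and> n' = m - (int i + k)" "n' mod 5 = n mod 5"
      using g
    proof (cases rule: dihedral_cases)
      case (1 m)
      obtain i :: nat where i: "i < 5" "(int i + k) mod 5 = (n - m) mod 5" by (rule nat_index)
      have "(int i + k + m) mod 5 = n mod 5" using i(2) by (rule mod5_rules(3))
      then show thesis using that[of i m "int i + k + m"] 1 i by blast
    next
      case (2 m)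
      obtain i :: nat where i: "i < 5" "(int i + k) mod 5 = (m - n) mod 5" by (rule nat_index)
      have "(m - (int i + k)) mod 5 = n mod 5" using i(2) by (rule mod5_rules(4))
      then show thesis using that[of i m "m - (int i + k)"] 2 i by blast
    qed
    have "edge n' = edge n" "mid2 n' = mid2 n" using m(3) by (metis edge_mod, metis mid2_mod)
    moreover have "nk_nb n' g = nk_nb n g"
    proof -
      have "(2 * n') mod 5 = (2 * n) mod 5" using m(3) by (rule mod5_rules(1))
      then have "refl (2 * n') = refl (2 * n)" by (simp add: refl_eq_iff)
      then show ?thesis by (simp add: nk_nb_def)
    qed
    ultimately have "\<exists>y. a = (g, y) \<and> of_real (nk_sign g) * y \<in> edge n' \<and>
        b = (nk_nb n' g, y - of_real (nk_sign g) * mid2 n')" using y by auto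
    then show "(a, b) \<in> gluing (necklace p)" unfolding unf one[OF m(2,1), symmetric] using g m(1) by blast
  qed
qed

sublocale nk: pentagon_surface "necklace p" nk_sign nk_nb
proof
  let ?N = "necklace p"
  have F: "faces ?N = dihedral p" by (simp add: necklace_def)
  fix g assume "g \<in> faces ?N"
  then have g: "g \<in> dihedral p" by (simp add: F)
  show e: "nk_sign g = 1 \<or> nk_sign g = - 1" using \<epsilon> by (auto simp: nk_sign_def gsign_def)
  show "face ?N g = {y. of_real (nk_sign g) * y \<in> pent}"
    using dihedral_image(1)[OF g] by (simp add: necklace_def sgn_set_def)
  show "corners ?N g = {y. of_real (nk_sign g) * y \<in> range vtx}"
    using dihedral_image(2)[OF g] by (simp add: necklace_def sgn_set_def)
  show "nk_nb i g \<in> faces ?N" for i using g by (cases rule: dihedral_cases) (auto simp: F dihedral_eq)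
  show "nk_sign (nk_nb i g) = - nk_sign g" for i using g by (cases rule: dihedral_cases) auto
  show "nk_nb i (nk_nb i g) = g" for i using g by (cases rule: dihedral_cases) auto
  show "nk_nb (i mod 5) g = nk_nb i g" for i
  proof -
    have "(2 * (i mod 5)) mod 5 = (2 * i) mod 5" by (rule mod5_rules(1)) simp
    then have "refl (2 * (i mod 5)) = refl (2 * i)" by (simp only: refl_eq_iff)
    then show ?thesis by (simp add: nk_nb_def)
  qed
next
  let ?N = "necklace p"
  have F: "faces ?N = dihedral p" by (simp add: necklace_def)
  have sym: "(b, a) \<in> gluing ?N" if asm: "(a, b) \<in> gluing ?N" for a b
  proof -
    obtain g n y where g: "g \<in> dihedral p" and y: "a = (g, y)" "of_real (nk_sign g) * y \<in> edge n"
      "b = (nk_nb n g, y - of_real (nk_sign g) * mid2 n)" using asm unfolding necklace_gluing by blast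
    have nb: "nk_nb n g \<in> dihedral p" "nk_sign (nk_nb n g) = - nk_sign g" "nk_nb n (nk_nb n g) = g"
      using g by (cases rule: dihedral_cases; auto simp: dihedral_eq)+
    have e: "nk_sign g = 1 \<or> nk_sign g = - 1" using \<epsilon> by (auto simp: nk_sign_def gsign_def)
    have "of_real (nk_sign (nk_nb n g)) * (y - of_real (nk_sign g) * mid2 n) = mid2 n - of_real (nk_sign g) * y"
      unfolding nb(2) using e by auto
    then have "of_real (nk_sign (nk_nb n g)) * (y - of_real (nk_sign g) * mid2 n) \<in> edge n"
      using edge_reflect[OF y(2)] by simp
    then show ?thesis
      unfolding necklace_gluing y using nb
      by (intro bexI[of _ "nk_nb n g"] exI[of _ n] exI[of _ "y - of_real (nk_sign g) * mid2 n"]) auto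
  qed
  fix a b
  have "(a, b) \<in> glue_rel ?N \<longleftrightarrow> (a, b) \<in> gluing ?N" unfolding glue_rel_def Un_iff converse_iff using sym by blast
  then show "(a, b) \<in> glue_rel ?N \<longleftrightarrow> (\<exists>g\<in>faces ?N. \<exists>i y. a = (g, y) \<and> of_real (nk_sign g) * y \<in> edge i \<and>
      b = (nk_nb i g, y - of_real (nk_sign g) * mid2 i))"
    unfolding F necklace_gluing by blast
qed

end

section \<open>Congruences modulo 1 - zeta and the folding\<close>

lemma one_minus_zeta_in_ideal5: "1 - zeta m \<in> ideal5"
proof -
  have r: "gold_res (- golden) = - 3" "gold_res (1 + golden) = 4" "gold_res (1 - golden) = - 2"
      "gold_res 2 = 2" "gold_res (- 1) = - 1"
    using gold_res_uminus[of golden] gold_res_add[of 1 golden] gold_res_diff[of 1 golden]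
      gold_res_of_int[of 2] gold_res_of_int[of "- 1"] by simp_all
  have g: "2 \<in> gold_ints" "- golden \<in> gold_ints" "1 + golden \<in> gold_ints" "1 - golden \<in> gold_ints" "- 1 \<in> gold_ints"
    using gold_ints_of_int[of 2] gold_ints_of_int[of "- 1"] by (simp_all add: gold_ints_add gold_ints_diff gold_ints_uminus)
  have "1 - zeta 1 = cpl 2 (- golden)" "1 - zeta 2 = cpl (1 + golden) (- 1)" "1 - zeta 3 = cpl 1 1"
    "1 - zeta 4 = cpl (1 - golden) golden"
    by (simp_all add: cpl_def zeta_1 zeta_2 zeta_3 zeta_4)
  then have "1 - zeta 1 \<in> ideal5" "1 - zeta 2 \<in> ideal5" "1 - zeta 3 \<in> ideal5" "1 - zeta 4 \<in> ideal5"
    using g by (simp_all add: cpl_in_ideal5_iff r)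
  moreover have "1 - zeta 0 \<in> ideal5" by simp
  moreover have "zeta m = zeta (m mod 5)" by (simp add: zeta_mod)
  ultimately show ?thesis by (cases m rule: mod5_cases) simp_all
qed

text \<open>Consecutive values differ by omega zeta^i = - zeta^(i + 3), which is -1 modulo 1 -
  zeta.\<close>

lemma mid2_ideal5: "mid2 n - mid2 0 + of_int n \<in> ideal5"
proof -
  have step: "mid2 (i + 1) - mid2 0 + of_int (i + 1) = (mid2 i - mid2 0 + of_int i) + (1 - zeta (i + 3))" for i
    using mid2_diff[of i] omega_zeta[of i] by (simp add: algebra_simps)
  show ?thesis
  proof (induction n rule: int_induct[where k = 0])
    case base
    then show ?case by simp
  next
    case (step1 i)
    show ?case unfolding step by (rule ideal5_add[OF step1(2) one_minus_zeta_in_ideal5])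
  next
    case (step2 i)
    have "mid2 (i - 1) - mid2 0 + of_int (i - 1) = (mid2 i - mid2 0 + of_int i) - (1 - zeta (i - 1 + 3))"
      using step[of "i - 1"] by simp
    then show ?case using ideal5_diff[OF step2(2) one_minus_zeta_in_ideal5] by metis
  qed
qed

text \<open>On side n the linear reflection in its direction agrees with the translation across it.
  This is why gluing by translations is compatible with folding by reflections.\<close>

lemma refl_edge: "z \<in> edge n \<Longrightarrow> refl (2 * n) z = z - mid2 n"
proof -
  assume "z \<in> edge n"
  then obtain u where z: "z = (1 - u) *\<^sub>R vtx n + u *\<^sub>R vtx (n + 1)" by (rule edge_cases)
  have 1: "zeta (2 * n) * vtx (1 - n) = vtx (n + 1)" "zeta (2 * n) * vtx (- n) = vtx n"
    by (simp_all flip: vtx_add)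
  have "refl (2 * n) z = - ((1 - u) *\<^sub>R (zeta (2 * n) * vtx (1 - n)) + u *\<^sub>R (zeta (2 * n) * vtx (- n)))"
    by (simp add: refl_def z cnj_vtx algebra_simps)
  also have "\<dots> = z - mid2 n" unfolding 1 by (simp add: z mid2_def algebra_simps)
  finally show ?thesis .
qed

lemma refl_scale: "refl b (of_real e * z) = of_real e * refl b z"
  by (simp add: refl_def mult.left_commute)

context table_form
begin

lemma nk_sign_cases: "nk_sign g = 1 \<or> nk_sign g = - 1"
  using \<epsilon> by (auto simp: nk_sign_def gsign_def)

lemma nk_sign_sq: "of_real (nk_sign g) * (of_real (nk_sign g) * z) = (z :: complex)"
  using nk_sign_cases[of g] by auto

lemma faces_nk: "faces (necklace p) = dihedral p"
  by (simp add: necklace_def)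

lemma rot_in_dihedral [simp]: "rot a \<in> dihedral p" and refl_in_dihedral [simp]: "refl b \<in> dihedral p"
  by (auto simp: dihedral_eq)

lemma dihedral_comp: "g \<in> dihedral p \<Longrightarrow> h \<in> dihedral p \<Longrightarrow> g \<circ> h \<in> dihedral p"
  by (elim dihedral_cases) (simp_all add: rot_refl_comp)

lemma dihedral_inverse:
  assumes "g \<in> dihedral p"
  obtains h where "h \<in> dihedral p" "\<And>z. h (g z) = z" "\<And>z. g (h z) = z"
  using assms
proof (cases rule: dihedral_cases)
  case (1 a)
  show ?thesis by (rule that[of "rot (- a)"]) (simp_all add: 1, simp_all add: rot_def)
next
  case (2 b)
  show ?thesis by (rule that[of "refl b"]) (simp_all add: 2, simp_all add: refl_def cnj_zeta)
qed

lemma dihedral_linear: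
  assumes "g \<in> dihedral p"
  shows "g (x + of_real s * w) = g x + of_real s * g w" "g (of_real s * w) = of_real s * g w"
    "norm (g w) = norm w" "g x = g y \<longleftrightarrow> x = y"
proof -
  show "g (x + of_real s * w) = g x + of_real s * g w"
    using assms by (cases rule: dihedral_cases) (simp_all add: rot_def refl_def algebra_simps)
  show "g (of_real s * w) = of_real s * g w"
    using assms by (cases rule: dihedral_cases) (simp_all add: rot_def refl_def)
  show "norm (g w) = norm w" using assms by (cases rule: dihedral_cases) (simp_all add: rot_def refl_def norm_mult)
  show "g x = g y \<longleftrightarrow> x = y" using dihedral_inverse[OF assms] by metis
qed

lemma nk_step_folded:
  assumes "g \<in> dihedral p" "of_real (nk_sign g) * y \<in> edge n"
  shows "y - of_real (nk_sign g) * mid2 n = refl (2 * n) y"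
proof -
  have "refl (2 * n) (of_real (nk_sign g) * y) = of_real (nk_sign g) * y - mid2 n"
    by (rule refl_edge[OF assms(2)])
  then have "of_real (nk_sign g) * (of_real (nk_sign g) * refl (2 * n) y) =
      of_real (nk_sign g) * (of_real (nk_sign g) * y) - of_real (nk_sign g) * mid2 n"
    unfolding refl_scale by (simp add: right_diff_distrib)
  then show ?thesis unfolding nk_sign_sq by simp
qed

text \<open>A crossing of side n composes g with \<open>refl (2 * n)\<close> and applies the same
  reflection to y, so x is the same for all representatives.\<close>

lemma fold_class:
  assumes "g \<in> dihedral p" "(g', y') \<in> surface_pt (necklace p) (g, g x)"
  shows "g' \<in> dihedral p \<and> y' = g' x"
proof -
  have "((g, g x), (g', y')) \<in> (glue_rel (necklace p))\<^sup>*" using assms(2) by (simp add: surface_pt_mem_iff)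
  then show ?thesis
  proof (induction "(g', y')" arbitrary: g' y' rule: rtrancl_induct)
    case base
    then show ?case using assms(1) by simp
  next
    case (step b g'' y'')
    obtain g' y' where b: "b = (g', y')" by (cases b)
    have IH: "g' \<in> dihedral p" "y' = g' x" using step(3) b by blast+
    obtain n where n: "of_real (nk_sign g') * y' \<in> edge n" "g'' = nk_nb n g'" "y'' = y' - of_real (nk_sign g') * mid2 n"
      using step(2) unfolding b nk.glue_iff by auto
    have "y'' = refl (2 * n) y'" using n nk_step_folded[OF IH(1) n(1)] by simp
    moreover have "g'' \<in> dihedral p" using nk.nb_face[of g' n] IH(1) n(2) by (simp add: faces_nk)
    ultimately show ?case using n(2) IH by (simp add: nk_nb_def)
  qed
qed

lemma folding_map_eq:
  assumes st: "straight_trajectory (necklace p) d \<eta>" and g: "(g, g x) \<in> \<eta> t"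
  shows "folding_map (\<eta> t) = x"
proof -
  have eq: "\<eta> t = surface_pt (necklace p) (g, g x)" and reg: "nk.regular (g, g x)"
    using nk.trajectory_regular[OF st g] by auto
  have gD: "g \<in> dihedral p" using reg by (simp add: nk.regular_def faces_nk)
  show ?thesis
    unfolding folding_map_def
  proof (rule the_equality)
    show "\<exists>g. (g, g x) \<in> \<eta> t" using g by blast
    fix x' assume "\<exists>g. (g, g x') \<in> \<eta> t"
    then obtain g' where "(g', g' x') \<in> surface_pt (necklace p) (g, g x)" using eq by auto
    from fold_class[OF gD this] show "x' = x" using dihedral_linear(4) by blast
  qed
qed

lemma trajectory_face:
  assumes "straight_trajectory (necklace p) d \<eta>" "(g, y) \<in> \<eta> t"
  shows "g \<in> dihedral p"
  using nk.trajectory_regular(1)[OF assms] by (simp add: nk.regular_def faces_nk)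

section \<open>The holonomy of the covering by the necklace\<close>

definition \<epsilon>i :: int where
  "\<epsilon>i = (if \<epsilon> = 1 then 1 else - 1)"

lemma \<epsilon>i: "of_int \<epsilon>i = (of_real \<epsilon> :: complex)" "\<epsilon>i = 1 \<or> \<epsilon>i = - 1"
  using \<epsilon> by (auto simp: \<epsilon>i_def)

text \<open>
  Here \<open>z\<close> is the developed position of the center of the copy \<open>gQ\<close>, which determines \<open>g\<close> modulo \<open>1 - \<zeta>\<close>.
  The coefficients 3 and 2 are forced by the condition that crossing side \<open>n\<close> of \<open>\<epsilon> Q\<close> moves the
  center by \<open>\<epsilon> mid2 n\<close>, where \<open>mid2 n \<equiv> mid2 0 - n\<close> modulo \<open>1 - \<zeta>\<close>.
\<close>

definition label_rel :: "complex \<Rightarrow> (complex \<Rightarrow> complex) \<Rightarrow> bool" where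
  "label_rel z g \<longleftrightarrow> (\<exists>a. g = rot a \<and> z - of_int (3 * \<epsilon>i * a) \<in> ideal5) \<or>
    (\<exists>b. g = refl b \<and> z - of_real \<epsilon> * mid2 0 - of_int (2 * \<epsilon>i * b) \<in> ideal5)"

lemma ideal5_int_cong:
  assumes "5 dvd m - n" shows "z - of_int m \<in> ideal5 \<longleftrightarrow> z - of_int n \<in> ideal5"
proof -
  have "of_int (m - n) \<in> ideal5" unfolding of_int_in_ideal5_iff by (rule assms)
  then have "z - of_int m + of_int (m - n) \<in> ideal5" if "z - of_int m \<in> ideal5"
    using ideal5_add that by blast
  moreover have "z - of_int n - of_int (m - n) \<in> ideal5" if "z - of_int n \<in> ideal5"
    using ideal5_diff that \<open>of_int (m - n) \<in> ideal5\<close> by blast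
  moreover have "z - of_int m + of_int (m - n) = z - of_int n" "z - of_int n - of_int (m - n) = z - of_int m"
    by simp_all
  ultimately show ?thesis by metis
qed

lemma label_rel_rot: "label_rel z (rot a) \<longleftrightarrow> z - of_int (3 * \<epsilon>i * a) \<in> ideal5"
proof
  assume "label_rel z (rot a)"
  then obtain a' where a': "rot a = rot a'" "z - of_int (3 * \<epsilon>i * a') \<in> ideal5" unfolding label_rel_def by auto
  have "5 dvd a - a'" using a'(1) by (simp add: rot_eq_iff mod_eq_dvd_iff)
  then have "5 dvd 3 * \<epsilon>i * a - 3 * \<epsilon>i * a'" by (simp flip: right_diff_distrib)
  then show "z - of_int (3 * \<epsilon>i * a) \<in> ideal5" using ideal5_int_cong a'(2) by blast
qed (auto simp: label_rel_def)

lemma label_rel_refl: "label_rel z (refl b) \<longleftrightarrow> z - of_real \<epsilon> * mid2 0 - of_int (2 * \<epsilon>i * b) \<in> ideal5"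
proof
  assume "label_rel z (refl b)"
  then obtain b' where b': "refl b = refl b'" "z - of_real \<epsilon> * mid2 0 - of_int (2 * \<epsilon>i * b') \<in> ideal5"
    unfolding label_rel_def by auto
  have "5 dvd b - b'" using b'(1) by (simp add: refl_eq_iff mod_eq_dvd_iff)
  then have "5 dvd 2 * \<epsilon>i * b - 2 * \<epsilon>i * b'" by (simp flip: right_diff_distrib)
  then show "z - of_real \<epsilon> * mid2 0 - of_int (2 * \<epsilon>i * b) \<in> ideal5" using ideal5_int_cong b'(2) by blast
qed (auto simp: label_rel_def)

lemma \<epsilon>_mid2_ideal5: "of_real \<epsilon> * (mid2 n - mid2 0 + of_int n) \<in> ideal5"
  using \<epsilon> mid2_ideal5[of n] ideal5_uminus[OF mid2_ideal5[of n]] by auto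

text \<open>The index of the copy changes from a to 2 n - a. Modulo 5, 2 (2 n - a) = 3 a - n, which
  matches the displacement of the center; for the way back, 3 (2 n - b) = 2 b + n.\<close>

lemma label_rel_step:
  assumes "g \<in> dihedral p" "label_rel z g"
  shows "label_rel (z + of_real (nk_sign g) * mid2 n) (nk_nb n g)"
  using assms(1)
proof (cases rule: dihedral_cases)
  case (1 a)
  have z: "z - of_int (3 * \<epsilon>i * a) \<in> ideal5" using assms(2) 1 by (simp add: label_rel_rot)
  have "z + of_real \<epsilon> * mid2 n - of_real \<epsilon> * mid2 0 - of_int (2 * \<epsilon>i * (2 * n - a)) =
    (z - of_int (3 * \<epsilon>i * a)) + of_real \<epsilon> * (mid2 n - mid2 0 + of_int n) + of_int (5 * (\<epsilon>i * a - \<epsilon>i * n))"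
    by (simp add: algebra_simps flip: \<epsilon>i(1))
  moreover have "of_int (5 * (\<epsilon>i * a - \<epsilon>i * n)) \<in> ideal5" unfolding of_int_in_ideal5_iff by (rule dvd_triv_left)
  ultimately show ?thesis
    using ideal5_add[OF ideal5_add[OF z \<epsilon>_mid2_ideal5[of n]]] 1 by (simp only: nk_sign_simps nk_nb_simps label_rel_refl)
next
  case (2 b)
  have z: "z - of_real \<epsilon> * mid2 0 - of_int (2 * \<epsilon>i * b) \<in> ideal5" using assms(2) 2 by (simp add: label_rel_refl)
  have "z + of_real (- \<epsilon>) * mid2 n - of_int (3 * \<epsilon>i * (2 * n - b)) =
    (z - of_real \<epsilon> * mid2 0 - of_int (2 * \<epsilon>i * b)) - of_real \<epsilon> * (mid2 n - mid2 0 + of_int n) + of_int (5 * (\<epsilon>i * b - \<epsilon>i * n))"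
    by (simp add: algebra_simps flip: \<epsilon>i(1))
  moreover have "of_int (5 * (\<epsilon>i * b - \<epsilon>i * n)) \<in> ideal5" unfolding of_int_in_ideal5_iff by (rule dvd_triv_left)
  ultimately show ?thesis
    using ideal5_add[OF ideal5_diff[OF z \<epsilon>_mid2_ideal5[of n]]] 2 by (simp only: nk_sign_simps nk_nb_simps label_rel_rot)
qed

lemma label_rel_class:
  assumes "g \<in> dihedral p" "(g', y') \<in> surface_pt (necklace p) (g, y)" "label_rel (c - y) g"
  shows "label_rel (c - y') g'"
proof -
  have "((g, y), (g', y')) \<in> (glue_rel (necklace p))\<^sup>*" using assms(2) by (simp add: surface_pt_mem_iff)
  then have "g' \<in> dihedral p \<and> label_rel (c - y') g'"
  proof (induction "(g', y')" arbitrary: g' y' rule: rtrancl_induct)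
    case base
    then show ?case using assms by simp
  next
    case (step b g'' y'')
    obtain g' y' where b: "b = (g', y')" by (cases b)
    have IH: "g' \<in> dihedral p" "label_rel (c - y') g'" using step(3) b by blast+
    obtain n where n: "g'' = nk_nb n g'" "y'' = y' - of_real (nk_sign g') * mid2 n"
      using step(2) unfolding b nk.glue_iff by auto
    have "g'' \<in> dihedral p" using nk.nb_face[of g' n] IH(1) n(1) by (simp add: faces_nk)
    moreover have "c - y'' = c - y' + of_real (nk_sign g') * mid2 n" unfolding n(2) by simp
    ultimately show ?case using label_rel_step[OF IH, of n] n(1) by metis
  qed
  then show ?thesis ..
qed

text \<open>t d - y is the developed center of the face in which the trajectory runs at time t, and
  c shifts the base point. Inside a face it is constant; at a crossing it changes as in
  \<open>label_rel_step\<close>.\<close>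

lemma label_rel_trajectory:
  assumes st: "straight_trajectory (necklace p) d \<eta>" and 1: "(g, y) \<in> \<eta> t" and 2: "(g', y') \<in> \<eta> t'"
    and rel: "label_rel (of_real t * d - y + c) g"
  shows "label_rel (of_real t' * d - y' + c) g'"
proof -
  define P where "P t \<longleftrightarrow> (\<forall>(g, y)\<in>\<eta> t. label_rel (of_real t * d - y + c) g)" for t
  have P_iff: "P t \<longleftrightarrow> label_rel (of_real t * d - y + c) g" if "(g, y) \<in> \<eta> t" for t g y
  proof
    assume "label_rel (of_real t * d - y + c) g"
    then have rel: "label_rel ((of_real t * d + c) - y) g" by (simp add: algebra_simps)
    have "\<eta> t = surface_pt (necklace p) (g, y)" using nk.trajectory_regular(2)[OF st that] .
    then have "label_rel ((of_real t * d + c) - y') g'" if "(g', y') \<in> \<eta> t" for g' y'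
      using label_rel_class[OF trajectory_face[OF st \<open>(g, y) \<in> \<eta> t\<close>] _ rel] that by simp
    then show "P t" unfolding P_def by (auto simp: algebra_simps)
  qed (use that in \<open>auto simp: P_def\<close>)
  have one_side: "\<exists>\<delta>>0. \<forall>s\<in>{0..\<delta>}. P (t + \<sigma> * s) = P t" if \<sigma>: "\<sigma> = 1 \<or> \<sigma> = - 1" for t \<sigma>
  proof -
    obtain \<delta> l y where *: "\<delta> > 0"
      "\<And>s. 0 \<le> s \<Longrightarrow> s \<le> \<delta> \<Longrightarrow> \<eta> (t + \<sigma> * s) = surface_pt (necklace p) (l, y + of_real s * (of_real \<sigma> * d))"
      using straight_trajectoryD_dir[OF st \<sigma>, of t] by metis
    have mem: "(l, y + of_real s * (of_real \<sigma> * d)) \<in> \<eta> (t + \<sigma> * s)" if "0 \<le> s" "s \<le> \<delta>" for s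
      using *(2)[OF that] by simp
    have eq: "of_real (t + \<sigma> * s) * d - (y + of_real s * (of_real \<sigma> * d)) + c = of_real t * d - y + c" for s
      by (simp add: algebra_simps)
    have "P (t + \<sigma> * s) = P (t + \<sigma> * 0)" if "0 \<le> s" "s \<le> \<delta>" for s
      unfolding P_iff[OF mem[OF that]] P_iff[OF mem[of 0, OF order_refl less_imp_le[OF *(1)]]] eq ..
    then show ?thesis using *(1) by (intro exI[of _ \<delta>]) auto
  qed
  have "P t = P t'"
    by (rule const_on_reals) (use one_side[of 1] one_side[of "- 1"] in auto)
  then show ?thesis using P_iff[OF 1] P_iff[OF 2] rel by simp
qed

text \<open>Return to the same position y displaces the developed center by (t' - t) d, while the
  index of the copy changes by m with coefficient 3. For a reflected copy it changes by - m with
  coefficient 2, and -2 = 3 modulo 5.\<close>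

lemma holonomy:
  assumes st: "straight_trajectory (necklace p) d \<eta>" and 1: "(g, y) \<in> \<eta> t" and 2: "(g \<circ> rot m, y) \<in> \<eta> t'"
  shows "of_real (t' - t) * d - of_int (3 * \<epsilon>i * m) \<in> ideal5"
  using trajectory_face[OF st 1]
proof (cases rule: dihedral_cases)
  case (1 a)
  define c where "c = y - of_real t * d + of_int (3 * \<epsilon>i * a)"
  have "label_rel (of_real t * d - y + c) g" by (simp add: 1 label_rel_rot c_def)
  from label_rel_trajectory[OF st assms(2,3) this]
  have "of_real t' * d - y + c - of_int (3 * \<epsilon>i * (a + m)) \<in> ideal5"
    by (simp only: 1 rot_refl_comp label_rel_rot)
  moreover have "of_real t' * d - y + c - of_int (3 * \<epsilon>i * (a + m)) = of_real (t' - t) * d - of_int (3 * \<epsilon>i * m)"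
    by (simp add: c_def algebra_simps)
  ultimately show ?thesis by simp
next
  case (2 b)
  define c where "c = y - of_real t * d + of_real \<epsilon> * mid2 0 + of_int (2 * \<epsilon>i * b)"
  have "label_rel (of_real t * d - y + c) g" by (simp add: 2 label_rel_refl c_def)
  from label_rel_trajectory[OF st assms(2,3) this]
  have "of_real t' * d - y + c - of_real \<epsilon> * mid2 0 - of_int (2 * \<epsilon>i * (b - m)) \<in> ideal5"
    by (simp only: 2 rot_refl_comp label_rel_refl)
  moreover have "of_real t' * d - y + c - of_real \<epsilon> * mid2 0 - of_int (2 * \<epsilon>i * (b - m)) =
      of_real (t' - t) * d - of_int (- 2 * \<epsilon>i * m)"
    by (simp add: c_def algebra_simps)
  moreover have "5 dvd - 2 * \<epsilon>i * m - 3 * \<epsilon>i * m" by simp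
  ultimately show ?thesis using ideal5_int_cong by metis
qed

lemma table_image_sign: "g \<in> dihedral p \<Longrightarrow> dp_sign (g ` table p) = nk_sign g"
proof -
  assume g: "g \<in> dihedral p"
  have "sgn_set 1 pent = pent" by (simp add: sgn_set_def)
  moreover have "sgn_set (- 1) pent = minus_pent" using uminus_sgn_set[of 1 pent] by (simp add: sgn_set_def)
  ultimately show ?thesis unfolding dihedral_image(1)[OF g] using nk_sign_cases[of g] by (metis dp_sign_simps)
qed

text \<open>Path lifting for the covering of the double pentagon by the necklace, one crossing at a
  time.\<close>

lemma lift_path:
  assumes "g \<in> dihedral p" "((g ` table p, y), (B, y')) \<in> (glue_rel (double_pentagon p))\<^sup>*"
  shows "\<exists>g'\<in>dihedral p. ((g, y), (g', y')) \<in> (glue_rel (necklace p))\<^sup>* \<and> g' ` table p = B"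
  using assms(2)
proof (induction "(B, y')" arbitrary: B y' rule: rtrancl_induct)
  case base
  then show ?case using assms(1) by auto
next
  case (step b B y')
  obtain A z where b: "b = (A, z)" by (cases b)
  obtain g' where g': "g' \<in> dihedral p" "((g, y), (g', z)) \<in> (glue_rel (necklace p))\<^sup>*" "g' ` table p = A"
    using step(3)[OF b] by blast
  obtain i where i: "of_real (dp_sign A) * z \<in> edge i" "B = uminus ` A" "y' = z - of_real (dp_sign A) * mid2 i"
    using step(2) unfolding b dp.glue_iff dp_nb_def by auto
  have sg: "dp_sign A = nk_sign g'" using table_image_sign[OF g'(1)] g'(3) by simp
  have nb: "nk_nb i g' \<in> dihedral p" using nk.nb_face[of g' i] g'(1) by (simp add: faces_nk)
  have "((g', z), (nk_nb i g', y')) \<in> glue_rel (necklace p)"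
    unfolding nk.glue_iff using i g'(1) sg by (auto simp: faces_nk)
  moreover have "nk_nb i g' ` table p = B"
  proof -
    have "nk_sign (nk_nb i g') = - nk_sign g'" using nk.e_nb[of g' i] g'(1) by (simp add: faces_nk)
    then show ?thesis
      unfolding i(2) g'(3)[symmetric] dihedral_image(1)[OF nb] dihedral_image(1)[OF g'(1)] uminus_sgn_set by simp
  qed
  ultimately show ?case using g'(2) nb by (metis rtrancl.rtrancl_into_rtrancl)
qed

lemma same_sign_rot:
  assumes "g \<in> dihedral p" "g' \<in> dihedral p" "nk_sign g' = nk_sign g"
  obtains m where "g' = g \<circ> rot m"
proof -
  have ne: "\<epsilon> \<noteq> - \<epsilon>" using \<epsilon> by auto
  show thesis
    using assms(1)
  proof (cases rule: dihedral_cases)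
    case g: (1 a)
    show thesis using assms(2)
    proof (cases rule: dihedral_cases)
      case (1 a')
      then show thesis using g by (intro that[of "a' - a"]) (simp add: rot_refl_comp)
    qed (use assms(3) g ne in simp)
  next
    case g: (2 b)
    show thesis using assms(2)
    proof (cases rule: dihedral_cases)
      case (2 b')
      then show thesis using g by (intro that[of "b - b'"]) (simp add: rot_refl_comp)
    qed (use assms(3) g ne in simp)
  qed
qed

text \<open>The copies over one face are those of the same sign, which differ by right
  multiplication with a rotation. So a return downstairs is a return upstairs up to a deck
  transformation.\<close>

lemma fiber:
  assumes st: "straight_trajectory (double_pentagon p) d \<gamma>" "straight_trajectory (necklace p) d \<eta>"
    and lift: "is_lift p \<eta> \<gamma>" and eq: "\<gamma> t' = \<gamma> t" and g: "(g, y) \<in> \<eta> t"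
  obtains m where "(g \<circ> rot m, y) \<in> \<eta> t'"
proof -
  have gD: "g \<in> dihedral p" using trajectory_face[OF st(2) g] .
  obtain g' y' where g': "(g', y') \<in> \<eta> t'"
    using straight_trajectoryD_dir[OF st(2), of 1 t'] by (metis surface_pt_self)
  have g'D: "g' \<in> dihedral p" using trajectory_face[OF st(2) g'] .
  have "(g ` table p, y) \<in> \<gamma> t'" "(g' ` table p, y') \<in> \<gamma> t'"
    using lift g g' eq unfolding is_lift_def by fastforce+
  then have "(g ` table p, y) \<in> surface_pt (double_pentagon p) (g' ` table p, y')"
    using dp.trajectory_regular(2)[OF st(1)] by blast
  then obtain g'' where g'': "g'' \<in> dihedral p" "((g', y'), (g'', y)) \<in> (glue_rel (necklace p))\<^sup>*" "g'' ` table p = g ` table p"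
    using lift_path[OF g'D] unfolding surface_pt_mem_iff by blast
  have "nk_sign g'' = nk_sign g" using g''(1,3) gD table_image_sign by metis
  then obtain m where "g'' = g \<circ> rot m" using same_sign_rot[OF gD g''(1)] by blast
  moreover have "(g'', y) \<in> \<eta> t'"
    using nk.trajectory_regular(2)[OF st(2) g'] g''(2) by (simp add: surface_pt_mem_iff)
  ultimately show thesis using that by simp
qed

section \<open>Automorphisms of the necklace\<close>

text \<open>Right multiplication by \<open>rot m\<close> changes labels without moving anything in
  the plane: a deck transformation. Left multiplication by h moves the whole surface and permutes
  the absolute side numbers by i -> i + a or i -> b - i.\<close>

lemma nk_glue_image:
  assumes h: "h \<in> dihedral p" and gl: "((g, y), (g', y')) \<in> glue_rel (necklace p)"
  shows "((h \<circ> g \<circ> rot m, h y), (h \<circ> g' \<circ> rot m, h y')) \<in> glue_rel (necklace p)"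
proof -
  obtain i where g: "g \<in> dihedral p" and i: "of_real (nk_sign g) * y \<in> edge i"
    "g' = refl (2 * i) \<circ> g" "y' = y - of_real (nk_sign g) * mid2 i"
    using gl unfolding nk.glue_iff nk_nb_def faces_nk by auto
  obtain j where j: "h \<circ> refl (2 * i) = refl (2 * j) \<circ> h"
    and e: "of_real (nk_sign (h \<circ> g \<circ> rot m)) * h y \<in> edge j"
    and m: "h (of_real (nk_sign g) * mid2 i) = of_real (nk_sign (h \<circ> g \<circ> rot m)) * mid2 j"
    using h
  proof (cases rule: dihedral_cases)
    case h: (1 a)
    have s: "nk_sign (h \<circ> g \<circ> rot m) = nk_sign g"
      using g by (cases rule: dihedral_cases) (simp_all add: h rot_refl_comp)
    show thesis
    proof (rule that[of "i + a"])
      show "h \<circ> refl (2 * i) = refl (2 * (i + a)) \<circ> h" by (simp add: h rot_refl_comp algebra_simps)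
      have eq: "of_real (nk_sign g) * h y = zeta a * (of_real (nk_sign g) * y)"
        by (simp add: h rot_def mult.left_commute)
      show "of_real (nk_sign (h \<circ> g \<circ> rot m)) * h y \<in> edge (i + a)"
        unfolding s eq edge_rot_iff by (rule i(1))
      show "h (of_real (nk_sign g) * mid2 i) = of_real (nk_sign (h \<circ> g \<circ> rot m)) * mid2 (i + a)"
        unfolding s by (simp add: h rot_def mid2_add mult.left_commute)
    qed
  next
    case h: (2 b)
    have s: "nk_sign (h \<circ> g \<circ> rot m) = - nk_sign g"
      using g by (cases rule: dihedral_cases) (simp_all add: h rot_refl_comp)
    show thesis
    proof (rule that[of "b - i"])
      show "h \<circ> refl (2 * i) = refl (2 * (b - i)) \<circ> h" by (simp add: h rot_refl_comp algebra_simps)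
      have eq: "of_real (- nk_sign g) * h y = zeta b * (- cnj (of_real (nk_sign g) * y))"
        by (simp add: h refl_def mult.left_commute)
      have "zeta b * (- cnj (of_real (nk_sign g) * y)) \<in> edge (- i + b)"
        using i(1) unfolding edge_rot_iff by (simp only: neg_cnj_iff)
      then show "of_real (nk_sign (h \<circ> g \<circ> rot m)) * h y \<in> edge (b - i)"
        unfolding s eq by simp
      have "mid2 (b - i) = zeta b * mid2 (- i)" using mid2_add[of "- i" b] by simp
      then show "h (of_real (nk_sign g) * mid2 i) = of_real (nk_sign (h \<circ> g \<circ> rot m)) * mid2 (b - i)"
        unfolding s by (simp add: h refl_def cnj_mid2 mult.left_commute)
    qed
  qed
  have gm: "h \<circ> g \<circ> rot m \<in> dihedral p" using h g by (intro dihedral_comp) simp_all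
  have "h y' = h y - h (of_real (nk_sign g) * mid2 i)"
    using dihedral_linear(1)[OF h, of y "- 1" "of_real (nk_sign g) * mid2 i"] unfolding i(3) by simp
  moreover have "h \<circ> g' \<circ> rot m = nk_nb j (h \<circ> g \<circ> rot m)"
  proof -
    have "h \<circ> g' \<circ> rot m = (h \<circ> refl (2 * i)) \<circ> g \<circ> rot m" unfolding i(2) by (simp add: comp_assoc)
    then show ?thesis unfolding j nk_nb_def by (simp add: comp_assoc)
  qed
  ultimately show ?thesis
    unfolding nk.glue_iff faces_nk using gm e m by (intro bexI[of _ "h \<circ> g \<circ> rot m"] exI[of _ j] exI[of _ "h y"]) simp_all
qed

lemma nk_automorphism:
  assumes st: "straight_trajectory (necklace p) d \<eta>" and h: "h \<in> dihedral p"
  shows "straight_trajectory (necklace p) (h d) (\<lambda>t. map_prod (\<lambda>g. h \<circ> g \<circ> rot m) h ` \<eta> t)"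
    and "map_prod (\<lambda>g. h \<circ> g \<circ> rot m) h ` surface_pt (necklace p) (g, y) =
      surface_pt (necklace p) (h \<circ> g \<circ> rot m, h y)"
proof -
  obtain h' where h': "h' \<in> dihedral p" "\<And>z. h' (h z) = z" "\<And>z. h (h' z) = z"
    using dihedral_inverse[OF h] by metis
  have lin: "h (y + of_real s * d) = h y + of_real s * h d" for y s by (rule dihedral_linear(1)[OF h])
  have rr: "rot m (rot (- m) z) = z" "rot (- m) (rot m z) = z" for z by (simp_all add: rot_def)
  have inv1: "h' \<circ> (h \<circ> g \<circ> rot m) \<circ> rot (- m) = g" "h \<circ> (h' \<circ> g \<circ> rot (- m)) \<circ> rot m = g" for g
    by (simp_all add: fun_eq_iff rr h')
  have faces: "h \<circ> g \<circ> rot m \<in> faces (necklace p)" if "h \<in> dihedral p" "g \<in> faces (necklace p)" for h g m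
    using that dihedral_comp unfolding faces_nk by simp
  have face: "h y \<in> (h \<circ> g \<circ> rot m) ` S" if "y \<in> g ` S" "rot m ` S = S" for h g y m and S :: "complex set"
  proof -
    have "(h \<circ> g \<circ> rot m) ` S = h ` g ` S" using that(2) by (metis image_comp)
    then show ?thesis using that(1) by auto
  qed
  have tab: "rot m ` table p = table p" "rot m ` vertices p = vertices p" for m
    by (simp_all add: table_eq vertices_eq rot_image_sgn_set[OF \<epsilon>])
  note image = straight_trajectory_image[OF st, where A = h and B = h' and f = "\<lambda>g. h \<circ> g \<circ> rot m"
      and g = "\<lambda>g. h' \<circ> g \<circ> rot (- m)" and d' = "h d", OF lin inv1 h'(2,3)
      nk_glue_image[OF h] nk_glue_image[OF h'(1)] faces[OF h] _ faces[OF h'(1)]]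
  have f: "h y \<in> face (necklace p) (h \<circ> g \<circ> rot m)" if "y \<in> face (necklace p) g" for g y
    using face[of y g "table p" m h] tab that by (simp add: necklace_def)
  have c: "h' y \<in> corners (necklace p) (h' \<circ> g \<circ> rot (- m))" if "y \<in> corners (necklace p) g" for g y
    using face[of y g "vertices p" "- m" h'] tab that by (simp add: necklace_def)
  show "straight_trajectory (necklace p) (h d) (\<lambda>t. map_prod (\<lambda>g. h \<circ> g \<circ> rot m) h ` \<eta> t)"
    by (rule image(1)) (use f c in auto)
  show "map_prod (\<lambda>g. h \<circ> g \<circ> rot m) h ` surface_pt (necklace p) (g, y) =
      surface_pt (necklace p) (h \<circ> g \<circ> rot m, h y)"
    by (rule image(2)) (use f c in auto)
qed

text \<open>The deck transformation by \<open>rot m\<close> and the time shift by T agree at time 0,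
  hence always. Folding turns it into a rotation, as the new label maps zeta^(- m) x to g x.\<close>

lemma deck_shift:
  assumes st: "straight_trajectory (necklace p) d \<eta>" and g: "(g, y) \<in> \<eta> 0" "(g \<circ> rot m, y) \<in> \<eta> T"
  shows "folding_map (\<eta> (t + T)) = zeta (- m) * folding_map (\<eta> t)"
proof -
  have h: "rot 0 \<in> dihedral p" by simp
  have r0: "rot 0 = (\<lambda>z. z)" by (simp add: rot_def)
  define \<eta>' where "\<eta>' t = map_prod (\<lambda>g. rot 0 \<circ> g \<circ> rot m) (rot 0) ` \<eta> t" for t
  have st': "straight_trajectory (necklace p) d \<eta>'"
    using nk_automorphism(1)[OF st h, of m] unfolding \<eta>'_def by (simp add: r0)
  have mem: "(g \<circ> rot m, y) \<in> \<eta>' t" if "(g, y) \<in> \<eta> t" for g y t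
    unfolding \<eta>'_def using that by (intro image_eqI[of _ _ "(g, y)"]) (simp_all add: r0 fun_eq_iff)
  have "\<eta>' 0 = \<eta> (0 + T)"
    using nk.trajectory_regular(2)[OF st' mem[OF g(1)]] nk.trajectory_regular(2)[OF st g(2)] by simp
  then have eq: "\<eta>' = (\<lambda>t. \<eta> (t + T))"
    using nk.trajectory_unique[OF st' straight_trajectory_shift[OF st, of T], of 0] by simp
  obtain g1 y1 where g1: "(g1, y1) \<in> \<eta> t"
    using straight_trajectoryD_dir[OF st, of 1 t] by (metis surface_pt_self)
  obtain x where x: "y1 = g1 x" using dihedral_inverse[OF trajectory_face[OF st g1]] by metis
  have f: "folding_map (\<eta> t) = x" using folding_map_eq[OF st] g1 x by simp
  have "(g1 \<circ> rot m, y1) \<in> \<eta> (t + T)" using mem[OF g1] eq by metis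
  moreover have "y1 = (g1 \<circ> rot m) (zeta (- m) * x)" by (simp add: x rot_def)
  ultimately have "(g1 \<circ> rot m, (g1 \<circ> rot m) (zeta (- m) * x)) \<in> \<eta> (t + T)" by metis
  then have "folding_map (\<eta> (t + T)) = zeta (- m) * x" by (rule folding_map_eq[OF st])
  then show ?thesis by (simp add: f)
qed

end

text \<open>As m is a unit modulo 5, some n has - m n = 1 modulo 5; after time n T the curve is
  turned by exactly 2 pi / 5.\<close>

lemma order5_symmetricI:
  fixes \<beta> :: "real \<Rightarrow> complex"
  assumes shift: "\<And>t. \<beta> (t + T) = zeta (- m) * \<beta> t" and m: "\<not> 5 dvd m"
  shows "order5_symmetric (range \<beta>)"
proof -
  have n_times: "\<beta> (t + real n * T) = zeta (- m * int n) * \<beta> t" for n t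
  proof (induction n)
    case (Suc n)
    have "\<beta> (t + real (Suc n) * T) = \<beta> ((t + real n * T) + T)" by (simp add: algebra_simps)
    also have "\<dots> = zeta (- m + - m * int n) * \<beta> t" unfolding shift Suc zeta_add by (simp only: mult.assoc)
    also have "- m + - m * int n = - m * int (Suc n)" by (simp add: algebra_simps)
    finally show ?case .
  qed simp
  obtain n :: nat where n: "(- m * int n) mod 5 = 1"
  proof -
    have nz: "m mod 5 \<noteq> 0" using m by (simp add: dvd_eq_mod_eq_0)
    have *: "(- m * int n) mod 5 = (- (m mod 5) * int n) mod 5" for n
      by (metis mod_minus_eq mod_mult_left_eq)
    consider "m mod 5 = 1" | "m mod 5 = 2" | "m mod 5 = 3" | "m mod 5 = 4"
      using nz by (cases m rule: mod5_cases) auto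
    then show thesis
    proof cases
      case 1 show thesis by (rule that[of 4]) (subst *, simp add: 1)
    next
      case 2 show thesis by (rule that[of 2]) (subst *, simp add: 2)
    next
      case 3 show thesis by (rule that[of 3]) (subst *, simp add: 3)
    next
      case 4 show thesis by (rule that[of 1]) (subst *, simp add: 4)
    qed
  qed
  have "zeta (- m * int n) = zeta 1" using n by (simp only: zeta_eq_iff) simp
  then have step: "\<beta> (t + real n * T) = zeta 1 * \<beta> t" for t using n_times[of t n] by simp
  have cis: "cis (2 * pi / 5) = zeta 1" by (simp add: zeta_def)
  show ?thesis
    unfolding order5_symmetric_def rotation_invariant_def cis
  proof
    show "(\<lambda>z. zeta 1 * z) ` range \<beta> \<subseteq> range \<beta>" by (auto simp flip: step)
    show "range \<beta> \<subseteq> (\<lambda>z. zeta 1 * z) ` range \<beta>"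
    proof clarify
      fix t
      have "\<beta> t = zeta 1 * \<beta> (t - real n * T)" using step[of "t - real n * T"] by simp
      then show "\<beta> t \<in> (\<lambda>z. zeta 1 * z) ` range \<beta>" by blast
    qed
  qed
qed

section \<open>Billiard trajectories without holonomy\<close>

text \<open>The germs at x of segments contained in S, as vectors of length v. They depend on the
  set alone and so follow every symmetry of it; v will be the speed of the ball.\<close>

definition cone :: "complex set \<Rightarrow> real \<Rightarrow> complex \<Rightarrow> complex set" where
  "cone S v x = {w. norm w = v \<and> (\<exists>\<delta>>0. \<forall>s. 0 \<le> s \<longrightarrow> s \<le> \<delta> \<longrightarrow> x + of_real s * w \<in> S)}"

lemma cone_rotate:
  assumes S: "(\<lambda>z. c * z) ` S = S" and c: "norm c = 1"
  shows "cone S v (c * x) = (\<lambda>w. c * w) ` cone S v x"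
proof -
  have c0: "c \<noteq> 0" using c by auto
  have mem: "c * z \<in> S \<longleftrightarrow> z \<in> S" for z
  proof
    assume "c * z \<in> S"
    then obtain z' where "z' \<in> S" "c * z = c * z'" using S by blast
    then show "z \<in> S" using c0 by simp
  qed (use S in blast)
  have *: "c * w \<in> cone S v (c * x) \<longleftrightarrow> w \<in> cone S v x" for w
  proof -
    have "c * x + of_real s * (c * w) \<in> S \<longleftrightarrow> x + of_real s * w \<in> S" for s
      using mem[of "x + of_real s * w"] by (simp add: algebra_simps)
    then show ?thesis by (simp add: cone_def norm_mult c)
  qed
  show ?thesis
  proof
    show "(\<lambda>w. c * w) ` cone S v x \<subseteq> cone S v (c * x)" using * by auto
    show "cone S v (c * x) \<subseteq> (\<lambda>w. c * w) ` cone S v x"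
    proof
      fix w assume w: "w \<in> cone S v (c * x)"
      have "w = c * (w / c)" using c0 by simp
      then show "w \<in> (\<lambda>w. c * w) ` cone S v x" using w * by (metis image_eqI)
    qed
  qed
qed

section \<open>Recovering the trajectory from its image\<close>

text \<open>The situation of vanishing holonomy. By \<open>generic\<close> no reflection fixes the
  direction; then the velocity of the ball determines the copy of Q in which its lift runs.\<close>

locale folded_trajectory = table_form +
  fixes d :: complex and \<eta> :: "real \<Rightarrow> ((complex \<Rightarrow> complex) \<times> complex) set" and \<beta> :: "real \<Rightarrow> complex" and T :: real
  assumes st: "straight_trajectory (necklace p) d \<eta>"
    and \<beta>_eq: "\<beta> t = folding_map (\<eta> t)"
    and generic: "refl b d \<noteq> d"
    and T_pos: "T > 0" and periodic: "\<beta> (t + T) = \<beta> t"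
    and no_holonomy: "(g, y) \<in> \<eta> t \<Longrightarrow> (g \<circ> rot m, y) \<in> \<eta> t' \<Longrightarrow> 5 dvd m"
begin

lemma d_nonzero: "d \<noteq> 0"
  using generic[of 0] by (auto simp: refl_def)

lemma beta_in: "(g, g x) \<in> \<eta> t \<Longrightarrow> \<beta> t = x"
  using folding_map_eq[OF st] \<beta>_eq by simp

lemma mem_beta: "(g, y) \<in> \<eta> t \<Longrightarrow> y = g (\<beta> t)"
  using dihedral_inverse[OF trajectory_face[OF st]] beta_in by metis

text \<open>\<open>w\<close> is the velocity of the billiard ball just after (\<open>\<sigma> = 1\<close>) or just before (\<open>\<sigma> = -1\<close>) time \<open>t\<close>.\<close>

definition tangent :: "real \<Rightarrow> real \<Rightarrow> (complex \<Rightarrow> complex) \<Rightarrow> complex \<Rightarrow> bool" where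
  "tangent t \<sigma> g w \<longleftrightarrow> g \<in> dihedral p \<and> g w = d \<and>
    (\<exists>\<delta>>0. \<forall>s. 0 \<le> s \<longrightarrow> s \<le> \<delta> \<longrightarrow> (g, g (\<beta> t + of_real (\<sigma> * s) * w)) \<in> \<eta> (t + \<sigma> * s))"

lemma tangent_exists:
  assumes "\<sigma> = 1 \<or> \<sigma> = - 1" obtains g w where "tangent t \<sigma> g w"
proof -
  obtain \<delta> g y where *: "\<delta> > 0"
    "\<And>s. 0 \<le> s \<Longrightarrow> s \<le> \<delta> \<Longrightarrow> \<eta> (t + \<sigma> * s) = surface_pt (necklace p) (g, y + of_real s * (of_real \<sigma> * d))"
    using straight_trajectoryD_dir[OF st assms, of t] by metis
  have mem: "(g, y + of_real s * (of_real \<sigma> * d)) \<in> \<eta> (t + \<sigma> * s)" if "0 \<le> s" "s \<le> \<delta>" for s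
    using *(2)[OF that] by simp
  have y: "(g, y) \<in> \<eta> t" using mem[of 0] *(1) by simp
  have g: "g \<in> dihedral p" using trajectory_face[OF st y] .
  obtain w where w: "g w = d" using dihedral_inverse[OF g] by metis
  have "y + of_real s * (of_real \<sigma> * d) = g (\<beta> t + of_real (\<sigma> * s) * w)" for s
    using mem_beta[OF y] dihedral_linear(1)[OF g, of "\<beta> t" "\<sigma> * s" w] w by (simp add: mult.commute mult.left_commute)
  then have "tangent t \<sigma> g w" unfolding tangent_def using g w *(1) mem by metis
  then show thesis by (rule that)
qed

lemma tangentD:
  assumes "tangent t \<sigma> g w"
  shows "g \<in> dihedral p" "g w = d" "(g, g (\<beta> t)) \<in> \<eta> t" "norm w = norm d"
    "\<exists>\<delta>>0. \<forall>s. 0 \<le> s \<longrightarrow> s \<le> \<delta> \<longrightarrow> \<beta> (t + \<sigma> * s) = \<beta> t + of_real (\<sigma> * s) * w"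
proof -
  show g: "g \<in> dihedral p" "g w = d" using assms by (simp_all add: tangent_def)
  then show "norm w = norm d" using dihedral_linear(3) by metis
  obtain \<delta> where \<delta>: "\<delta> > 0" "\<And>s. 0 \<le> s \<Longrightarrow> s \<le> \<delta> \<Longrightarrow> (g, g (\<beta> t + of_real (\<sigma> * s) * w)) \<in> \<eta> (t + \<sigma> * s)"
    using assms unfolding tangent_def by blast
  show "(g, g (\<beta> t)) \<in> \<eta> t" using \<delta>(2)[of 0] \<delta>(1) by simp
  show "\<exists>\<delta>>0. \<forall>s. 0 \<le> s \<longrightarrow> s \<le> \<delta> \<longrightarrow> \<beta> (t + \<sigma> * s) = \<beta> t + of_real (\<sigma> * s) * w"
    using \<delta> beta_in by blast
qed

lemma beta_regular: "of_real \<epsilon> * \<beta> t \<in> pent - range vtx"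
proof -
  obtain g w where "tangent t 1 g w" using tangent_exists[of 1 t] by blast
  then have g: "g \<in> dihedral p" "(g, g (\<beta> t)) \<in> \<eta> t" using tangentD by blast+
  have reg: "of_real (nk_sign g) * g (\<beta> t) \<in> pent - range vtx"
    using nk.trajectory_regular(1)[OF st g(2)] by (simp add: nk.regular_def)
  then have "g (\<beta> t) \<in> g ` table p" "g (\<beta> t) \<notin> g ` vertices p"
    unfolding dihedral_image[OF g(1)] by (auto simp: sgn_set_def)
  then have "\<beta> t \<in> table p" "\<beta> t \<notin> vertices p"
    using dihedral_linear(4)[OF g(1)] by (metis imageE, metis imageI)
  then show ?thesis by (auto simp: table_eq vertices_eq sgn_set_def)
qed

lemma tangent_cone:
  assumes "\<sigma> = 1 \<or> \<sigma> = - 1" "tangent t \<sigma> g w"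
  shows "of_real \<sigma> * w \<in> cone (range \<beta>) (norm d) (\<beta> t)"
proof -
  obtain \<delta> where \<delta>: "\<delta> > 0" "\<And>s. 0 \<le> s \<Longrightarrow> s \<le> \<delta> \<Longrightarrow> \<beta> (t + \<sigma> * s) = \<beta> t + of_real (\<sigma> * s) * w"
    using tangentD(5)[OF assms(2)] by blast
  have "\<beta> t + of_real s * (of_real \<sigma> * w) \<in> range \<beta>" if "0 \<le> s" "s \<le> \<delta>" for s
  proof -
    have "\<beta> t + of_real s * (of_real \<sigma> * w) = \<beta> (t + \<sigma> * s)" using \<delta>(2)[OF that] by (simp add: ac_simps)
    then show ?thesis by simp
  qed
  moreover have "norm (of_real \<sigma> * w) = norm d" using assms(1) tangentD(4)[OF assms(2)] by auto
  ultimately show ?thesis unfolding cone_def using \<delta>(1) by blast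
qed

lemma beta_periodic_nat: "\<beta> (t + real n * T) = \<beta> t"
proof (induction n)
  case (Suc n)
  have "\<beta> (t + real (Suc n) * T) = \<beta> ((t + real n * T) + T)" by (simp add: algebra_simps)
  then show ?case using Suc periodic by simp
qed simp

text \<open>Moves any time into a compact interval, for the accumulation argument in
  \<open>cone_tangent\<close>.\<close>

lemma beta_fundamental: obtains t' where "0 \<le> t'" "t' \<le> T" "\<beta> t' = \<beta> t"
proof -
  define n where "n = \<lfloor>t / T\<rfloor>"
  have n: "of_int n \<le> t / T" "t / T < of_int n + 1" by (simp_all add: n_def)
  have bounds: "0 \<le> t - of_int n * T" "t - of_int n * T \<le> T"
    using n T_pos by (simp_all add: pos_le_divide_eq pos_divide_less_eq algebra_simps)
  have "\<beta> (t - of_int n * T) = \<beta> t"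
  proof (cases "0 \<le> n")
    case True
    then show ?thesis using beta_periodic_nat[of "t - of_int n * T" "nat n"] by simp
  next
    case False
    then show ?thesis using beta_periodic_nat[of t "nat (- n)"] by simp
  qed
  then show thesis using that bounds by blast
qed

text \<open>
  Any segment germ in the trajectory is a germ of the trajectory: points on the segment near \<open>x\<close> are
  reached at times in a compact interval, and an accumulation point of these times is a passage
  through \<open>x\<close> that follows the segment.
\<close>

lemma cone_tangent:
  assumes v: "v \<in> cone (range \<beta>) (norm d) x"
  obtains t \<sigma> g w where "\<sigma> = 1 \<or> \<sigma> = - 1" "\<beta> t = x" "tangent t \<sigma> g w" "v = of_real \<sigma> * w"
proof -
  obtain \<delta> where \<delta>: "\<delta> > 0" "\<And>s. 0 \<le> s \<Longrightarrow> s \<le> \<delta> \<Longrightarrow> x + of_real s * v \<in> range \<beta>" and nv: "norm v = norm d"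
    using v unfolding cone_def by auto
  \<comment> \<open>The points of the segment at parameter \<open>s n\<close> tend to x; the times
    at which they are visited accumulate at t0.\<close>
  define s where "s n = \<delta> / real (Suc n)" for n
  have s: "0 < s n" "s n \<le> \<delta>" for n using \<delta>(1) by (auto simp: s_def field_simps)
  have "\<exists>t. 0 \<le> t \<and> t \<le> T \<and> \<beta> t = x + of_real (s n) * v" for n
  proof -
    have "x + of_real (s n) * v \<in> range \<beta>" using \<delta>(2) s less_imp_le by blast
    then obtain t where "\<beta> t = x + of_real (s n) * v" by (metis imageE)
    then show ?thesis using beta_fundamental[of t] by metis
  qed
  then obtain \<tau> where \<tau>: "\<And>n. 0 \<le> \<tau> n" "\<And>n. \<tau> n \<le> T" "\<And>n. \<beta> (\<tau> n) = x + of_real (s n) * v" by metis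
  have "compact {0..T}" by simp
  then obtain t0 r where t0: "strict_mono r" "(\<tau> \<circ> r) \<longlonglongrightarrow> t0"
    using \<tau>(1,2) unfolding compact_def by (metis atLeastAtMost_iff)
  obtain g1 w1 where t1: "tangent t0 1 g1 w1" using tangent_exists[of 1 t0] by blast
  obtain g2 w2 where t2: "tangent t0 (- 1) g2 w2" using tangent_exists[of "- 1" t0] by blast
  obtain \<delta>1 where \<delta>1: "\<delta>1 > 0" "\<And>s. 0 \<le> s \<Longrightarrow> s \<le> \<delta>1 \<Longrightarrow> \<beta> (t0 + 1 * s) = \<beta> t0 + of_real (1 * s) * w1"
    using tangentD(5)[OF t1] by blast
  obtain \<delta>2 where \<delta>2: "\<delta>2 > 0" "\<And>s. 0 \<le> s \<Longrightarrow> s \<le> \<delta>2 \<Longrightarrow> \<beta> (t0 + - 1 * s) = \<beta> t0 + of_real (- 1 * s) * w2"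
    using tangentD(5)[OF t2] by blast
  define W where "W t = (if t0 \<le> t then w1 else w2)" for t
  have near: "\<beta> t = \<beta> t0 + of_real (t - t0) * W t" if "\<bar>t - t0\<bar> \<le> min \<delta>1 \<delta>2" for t
    using \<delta>1(2)[of "t - t0"] \<delta>2(2)[of "t0 - t"] that by (cases "t0 \<le> t") (auto simp: W_def)
  have nW: "norm (W t) = norm d" for t using tangentD(4) t1 t2 by (simp add: W_def)
  have ev: "\<forall>\<^sub>F n in sequentially. \<bar>\<tau> (r n) - t0\<bar> \<le> min \<delta>1 \<delta>2"
  proof -
    have "min \<delta>1 \<delta>2 > 0" using \<delta>1 \<delta>2 by simp
    from tendstoD[OF t0(2) this] show ?thesis by (rule eventually_mono) (simp add: dist_real_def)
  qed
  have lim_t: "(\<lambda>n. \<tau> (r n) - t0) \<longlonglongrightarrow> 0" using t0(2) by (simp add: o_def LIM_zero_iff)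
  have "(\<lambda>n. \<beta> (\<tau> (r n)) - \<beta> t0) \<longlonglongrightarrow> 0"
  proof (rule Lim_null_comparison)
    show "\<forall>\<^sub>F n in sequentially. norm (\<beta> (\<tau> (r n)) - \<beta> t0) \<le> \<bar>\<tau> (r n) - t0\<bar> * norm d"
      using ev by (rule eventually_mono) (simp add: near norm_mult nW flip: of_real_diff)
    show "(\<lambda>n. \<bar>\<tau> (r n) - t0\<bar> * norm d) \<longlonglongrightarrow> 0"
      using tendsto_mult_left_zero[OF tendsto_rabs_zero[OF lim_t]] .
  qed
  then have l1: "(\<lambda>n. \<beta> (\<tau> (r n))) \<longlonglongrightarrow> \<beta> t0" by (simp add: LIM_zero_iff)
  have "s \<longlonglongrightarrow> 0" unfolding s_def by (rule LIMSEQ_Suc[OF lim_const_over_n])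
  then have "(\<lambda>n. s (r n)) \<longlonglongrightarrow> 0" using LIMSEQ_subseq_LIMSEQ[OF _ t0(1)] by (simp add: o_def)
  then have "(\<lambda>n. x + of_real (s (r n)) * v) \<longlonglongrightarrow> x + of_real 0 * v"
    by (intro tendsto_intros)
  then have "(\<lambda>n. \<beta> (\<tau> (r n))) \<longlonglongrightarrow> x" unfolding \<tau>(3) by simp
  then have x: "\<beta> t0 = x" using l1 LIMSEQ_unique by blast
  obtain n where n: "\<bar>\<tau> (r n) - t0\<bar> \<le> min \<delta>1 \<delta>2" using ev by (auto simp: eventually_sequentially)
  define t where "t = \<tau> (r n)"
  have eq: "of_real (s (r n)) * v = of_real (t - t0) * W t"
    using near[OF n] \<tau>(3)[of "r n"] x unfolding t_def by simp
  then have "norm (of_real (s (r n)) * v) = norm (of_real (t - t0) * W t)" by simp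
  \<comment> \<open>Segment and path have the same speed, so the distance from x equals the time
    from t0 up to a common factor, and v is found by cancelling.\<close>
  then have abs: "s (r n) = \<bar>t - t0\<bar>"
    using d_nonzero s[of "r n"] by (simp add: norm_mult nW nv flip: of_real_diff)
  have tt: "t \<noteq> t0" using abs s(1)[of "r n"] by auto
  show thesis
  proof (cases "t0 < t")
    case True
    then have "of_real (t - t0) * v = of_real (t - t0) * w1" using eq abs by (simp add: W_def)
    then have "v = of_real 1 * w1" using tt by (simp flip: of_real_diff)
    then show thesis using that[of 1 t0 g1 w1] x t1 by simp
  next
    case False
    then have "of_real (t0 - t) * v = of_real (t - t0) * w2" using eq abs tt by (simp add: W_def)
    then have "of_real (t0 - t) * v = of_real (t0 - t) * - w2" by (simp add: algebra_simps)
    moreover have "of_real (t0 - t) \<noteq> (0::complex)" unfolding of_real_eq_0_iff using tt by simp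
    ultimately have "v = - w2" using mult_left_cancel by blast
    then have "v = of_real (- 1) * w2" by simp
    then show thesis using that[of "- 1" t0 g2 w2] x t2 by simp
  qed
qed

lemma finite_dihedral: "finite (dihedral p)"
proof -
  have "g \<in> rot ` {0..<5} \<union> refl ` {0..<5}" if "g \<in> dihedral p" for g
    using that
  proof (cases rule: dihedral_cases)
    case (1 a)
    then have "g = rot (a mod 5)" by (simp add: rot_eq_iff)
    then show ?thesis by auto
  next
    case (2 b)
    then have "g = refl (b mod 5)" by (simp add: refl_eq_iff)
    then show ?thesis by auto
  qed
  then have "dihedral p \<subseteq> rot ` {0..<5} \<union> refl ` {0..<5}" by blast
  then show ?thesis by (rule finite_subset) simp
qed

text \<open>By \<open>cone_tangent\<close> every germ is plus or minus an image of d under the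
  finite group, so the germs at a point can be summed.\<close>

lemma finite_cone: "finite (cone (range \<beta>) (norm d) x)"
proof -
  have "v \<in> (\<lambda>g. g d) ` dihedral p \<union> (\<lambda>g. - g d) ` dihedral p" if v: "v \<in> cone (range \<beta>) (norm d) x" for v
  proof -
    obtain t \<sigma> g w where \<sigma>: "\<sigma> = 1 \<or> \<sigma> = - 1" and tg: "tangent t \<sigma> g w" "v = of_real \<sigma> * w"
      using cone_tangent[OF v] by metis
    obtain h where h: "h \<in> dihedral p" "\<And>z. h (g z) = z" using dihedral_inverse[OF tangentD(1)[OF tg(1)]] by metis
    then have "w = h d" using tangentD(2)[OF tg(1)] by metis
    then show ?thesis using \<sigma> tg(2) h(1) by auto
  qed
  then have "cone (range \<beta>) (norm d) x \<subseteq> (\<lambda>g. g d) ` dihedral p \<union> (\<lambda>g. - g d) ` dihedral p" by blast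
  then show ?thesis by (rule finite_subset) (simp add: finite_dihedral)
qed

lemma fold_edge:
  assumes "g \<in> dihedral p" "of_real (nk_sign g) * g x \<in> edge j"
  obtains n where "of_real \<epsilon> * x \<in> edge n" "refl (2 * j) \<circ> g = g \<circ> refl (2 * n)"
  using assms(1)
proof (cases rule: dihedral_cases)
  case (1 a)
  have s: "nk_sign g = \<epsilon>" by (simp add: 1)
  have eq: "of_real (nk_sign g) * g x = zeta a * (of_real \<epsilon> * x)" unfolding s by (simp add: 1 rot_def mult.left_commute)
  have "zeta a * (of_real \<epsilon> * x) \<in> edge (j - a + a)" using assms(2) unfolding eq by simp
  then have "of_real \<epsilon> * x \<in> edge (j - a)" by (simp only: edge_rot_iff)
  moreover have "refl (2 * j) \<circ> g = g \<circ> refl (2 * (j - a))" by (simp add: 1 rot_refl_comp algebra_simps)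
  ultimately show thesis by (rule that)
next
  case (2 b)
  have s: "nk_sign g = - \<epsilon>" by (simp add: 2)
  have eq: "of_real (nk_sign g) * g x = zeta b * (- cnj (of_real \<epsilon> * x))"
    unfolding s by (simp add: 2 refl_def mult.left_commute)
  have "zeta b * (- cnj (of_real \<epsilon> * x)) \<in> edge (- (b - j) + b)" using assms(2) unfolding eq by simp
  then have "of_real \<epsilon> * x \<in> edge (b - j)" by (simp only: edge_rot_iff neg_cnj_iff)
  moreover have "refl (2 * j) \<circ> g = g \<circ> refl (2 * (b - j))" by (simp add: 2 rot_refl_comp algebra_simps)
  ultimately show thesis by (rule that)
qed

lemma two_labels:
  assumes "(g, g x) \<in> \<eta> t" "(g', g' x) \<in> \<eta> t"
  shows "g' = g \<or> (\<exists>n. of_real \<epsilon> * x \<in> edge n \<and> g' = g \<circ> refl (2 * n))"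
proof -
  have "(g', g' x) \<in> surface_pt (necklace p) (g, g x)" using nk.trajectory_regular(2)[OF st assms(1)] assms(2) by simp
  from nk.class_cases(2)[OF nk.trajectory_regular(1)[OF st assms(1)] this] show ?thesis
  proof
    assume "\<exists>i. of_real (nk_sign g) * g x \<in> edge i \<and> g' = nk_nb i g \<and> g' x = g x - of_real (nk_sign g) * mid2 i"
    then obtain i where "of_real (nk_sign g) * g x \<in> edge i" "g' = refl (2 * i) \<circ> g" by (auto simp: nk_nb_def)
    then show ?thesis using fold_edge[OF trajectory_face[OF st assms(1)]] by metis
  qed simp
qed

lemma dihedral_fixes:
  assumes "g \<in> dihedral p" "g d = d" shows "g = rot 0"
  using assms(1)
proof (cases rule: dihedral_cases)
  case (1 a)
  then have "zeta a = 1" using assms(2) d_nonzero by (simp add: rot_def)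
  then show ?thesis using 1 by (simp add: rot_eq_iff zeta_eq_1_iff)
qed (use generic assms(2) in simp)

text \<open>By genericity the stabilizer of d in the dihedral group is trivial.\<close>

lemma same_velocity:
  assumes "g \<in> dihedral p" "g' \<in> dihedral p" "g w = d" "g' w = d" shows "g' = g"
proof -
  obtain h where h: "h \<in> dihedral p" "\<And>z. h (g z) = z" "\<And>z. g (h z) = z"
    using dihedral_inverse[OF assms(1)] by metis
  have "(g' \<circ> h) d = d" using h(2) assms(3,4) by (metis comp_apply)
  then have "g' \<circ> h = rot 0" using dihedral_fixes dihedral_comp[OF assms(2) h(1)] by blast
  then have "g' (h (g z)) = g z" for z by (metis comp_apply mult_1 rot_def zeta_0)
  then show ?thesis by (simp add: h(2) fun_eq_iff)
qed

text \<open>Away from the sides the label does not change, so the velocities before and after agree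
  and give opposite germs.\<close>

lemma cone_interior:
  assumes "\<And>n. of_real \<epsilon> * x \<notin> edge n" "v \<in> cone (range \<beta>) (norm d) x"
  shows "- v \<in> cone (range \<beta>) (norm d) x"
proof -
  obtain t \<sigma> g w where \<sigma>: "\<sigma> = 1 \<or> \<sigma> = - 1" and x: "\<beta> t = x" and tg: "tangent t \<sigma> g w" "v = of_real \<sigma> * w"
    using cone_tangent[OF assms(2)] by metis
  have \<sigma>': "- \<sigma> = 1 \<or> - \<sigma> = - 1" using \<sigma> by auto
  obtain g' w' where tg': "tangent t (- \<sigma>) g' w'" using tangent_exists[OF \<sigma>', of t] by metis
  have "g' = g" using two_labels[OF tangentD(3)[OF tg(1)] tangentD(3)[OF tg']] assms(1) x by blast
  then have "w' = w" using tangentD(1,2)[OF tg(1)] tangentD(2)[OF tg'] dihedral_linear(4) by metis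
  then show ?thesis using tangent_cone[OF \<sigma>' tg'] tg(2) x by simp
qed

lemma refl_fixes:
  assumes "Re (v * cnj (mid2 n)) = 0" shows "refl (2 * n) v = v"
proof -
  have m: "cnj (mid2 n) = - zeta (- (2 * n)) * mid2 n"
    using mid2_add[of n "- (2 * n)"] by (simp add: cnj_mid2)
  have "v * cnj (mid2 n) + cnj (v * cnj (mid2 n)) = 0" using assms by (simp only: complex_add_cnj) simp
  then have "v * cnj (mid2 n) + cnj v * mid2 n = 0" by (simp only: complex_cnj_mult complex_cnj_cnj)
  then have "(cnj v - v * zeta (- (2 * n))) * mid2 n = 0"
    unfolding m by (simp only: left_diff_distrib mult_minus_left mult_minus_right mult.assoc uminus_add_conv_diff)
  then have "cnj v - v * zeta (- (2 * n)) = 0" by (metis mid2_neq_0 mult_eq_0_iff)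
  then have eq: "cnj v = v * zeta (- (2 * n))" by (simp only: right_minus_eq)
  show ?thesis unfolding refl_def eq by (simp only: mult.left_commute[of _ v] zeta_mult_uminus mult_1_right)
qed

text \<open>The law of reflection: if the ball leaves the side with velocity w, it arrived with
  \<open>refl (2 * n) w\<close>, so its germs w and - \<open>refl (2 * n) w\<close> are mirror
  images in the normal. Germs point into the table, and by genericity not along the side.\<close>

lemma cone_side:
  assumes x: "of_real \<epsilon> * x \<in> edge n" "of_real \<epsilon> * x \<notin> range vtx" and v: "v \<in> cone (range \<beta>) (norm d) x"
  shows "Re (of_real \<epsilon> * v * cnj (mid2 n)) < 0" "- refl (2 * n) v \<in> cone (range \<beta>) (norm d) x"
proof -
  have le: "Re (of_real \<epsilon> * v * cnj (mid2 n)) \<le> 0" if v: "v \<in> cone (range \<beta>) (norm d) x" for v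
  proof -
    obtain \<delta> where \<delta>: "\<delta> > 0" "\<And>s. 0 \<le> s \<Longrightarrow> s \<le> \<delta> \<Longrightarrow> x + of_real s * v \<in> range \<beta>"
      using v unfolding cone_def by auto
    have "of_real \<epsilon> * (x + of_real \<delta> * v) \<in> pent" using \<delta>(2)[of \<delta>] \<delta>(1) beta_regular by fastforce
    from pent_halfplane(1)[OF this, of n]
    have "Re (of_real \<epsilon> * x * cnj (mid2 n)) + \<delta> * Re (of_real \<epsilon> * v * cnj (mid2 n)) \<le> 2 * apo\<^sup>2"
      by (simp add: algebra_simps)
    moreover have "Re (of_real \<epsilon> * x * cnj (mid2 n)) = 2 * apo\<^sup>2"
      using pent_halfplane(2)[of "of_real \<epsilon> * x" n] x(1) edge_subset_pent by blast
    ultimately have "\<delta> * Re (of_real \<epsilon> * v * cnj (mid2 n)) \<le> 0" by simp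
    then show ?thesis using \<delta>(1) by (simp add: mult_le_0_iff)
  qed
  obtain t \<sigma> g w where \<sigma>: "\<sigma> = 1 \<or> \<sigma> = - 1" and t: "\<beta> t = x" and tg: "tangent t \<sigma> g w" "v = of_real \<sigma> * w"
    using cone_tangent[OF v] by metis
  have gD: "g \<in> dihedral p" and gw: "g w = d" using tangentD[OF tg(1)] by blast+
  \<comment> \<open>A velocity along the side would be carried to d both by g and by g composed with
    the reflection.\<close>
  have ne: "refl (2 * n) w \<noteq> w"
  proof
    assume *: "refl (2 * n) w = w"
    have "(g \<circ> refl (2 * n)) w = d" using * gw by simp
    then have "g \<circ> refl (2 * n) = g" using same_velocity[OF gD _ gw] gD dihedral_comp by simp
    then have "refl (2 * n) z = z" for z using dihedral_linear(4)[OF gD] by (metis comp_apply)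
    then have "refl (2 * n) = rot 0" by (simp add: rot_def fun_eq_iff)
    then show False by simp
  qed
  have ne_v: "Re (of_real \<epsilon> * v * cnj (mid2 n)) \<noteq> 0"
  proof
    assume *: "Re (of_real \<epsilon> * v * cnj (mid2 n)) = 0"
    have "Re (w * cnj (mid2 n)) = 0" using * \<epsilon> \<sigma> unfolding tg(2) by auto
    then show False using refl_fixes ne by blast
  qed
  then show "Re (of_real \<epsilon> * v * cnj (mid2 n)) < 0" using le[OF v] by simp
  have \<sigma>': "- \<sigma> = 1 \<or> - \<sigma> = - 1" using \<sigma> by auto
  obtain g' w' where tg': "tangent t (- \<sigma>) g' w'" using tangent_exists[OF \<sigma>', of t] by metis
  have v': "of_real (- \<sigma>) * w' \<in> cone (range \<beta>) (norm d) x" using tangent_cone[OF \<sigma>' tg'] t by simp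
  \<comment> \<open>With unchanged label the path would go straight on and have a germ pointing out
    of the table.\<close>
  have "g' \<noteq> g"
  proof
    assume "g' = g"
    then have "w' = w" using gD gw tangentD(2)[OF tg'] dihedral_linear(4) by metis
    then have "- v \<in> cone (range \<beta>) (norm d) x" using v' tg(2) by simp
    from le[OF this] le[OF v] ne_v show False by simp
  qed
  then obtain n' where n': "of_real \<epsilon> * x \<in> edge n'" "g' = g \<circ> refl (2 * n')"
    using two_labels[OF tangentD(3)[OF tg(1)] tangentD(3)[OF tg']] t by blast
  have "n' mod 5 = n mod 5" using edge_inter[OF n'(1) x(1,2)] .
  then have "refl (2 * n') = refl (2 * n)" unfolding refl_eq_iff by (rule mod5_rules(1))
  then have "g (refl (2 * n) w') = g w" using n'(2) tangentD(2)[OF tg'] gw by simp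
  then have "refl (2 * n) w' = w" using dihedral_linear(4)[OF gD] by blast
  then have "w' = refl (2 * n) w" by (auto simp: refl_def cnj_zeta)
  then have "of_real (- \<sigma>) * w' = - refl (2 * n) v" by (simp add: tg(2) refl_scale)
  then show "- refl (2 * n) v \<in> cone (range \<beta>) (norm d) x" using v' by simp
qed

lemma sum_cone_interior:
  assumes "\<And>n. of_real \<epsilon> * x \<notin> edge n" shows "\<Sum>(cone (range \<beta>) (norm d) x) = 0"
proof -
  let ?C = "cone (range \<beta>) (norm d) x"
  have "uminus ` ?C = ?C"
  proof
    show "uminus ` ?C \<subseteq> ?C" using cone_interior[OF assms] by auto
    show "?C \<subseteq> uminus ` ?C"
    proof
      fix v assume "v \<in> ?C"
      then have "- v \<in> ?C" by (rule cone_interior[OF assms])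
      then show "v \<in> uminus ` ?C" by (intro image_eqI[of _ _ "- v"]) auto
    qed
  qed
  then have "\<Sum>?C = \<Sum>(uminus ` ?C)" by simp
  also have "\<dots> = (\<Sum>v\<in>?C. - v)" by (subst sum.reindex) (auto simp: inj_on_def)
  finally have "\<Sum>?C = - \<Sum>?C" by (simp add: sum_negf)
  then show ?thesis by (simp add: eq_neg_iff_add_eq_0)
qed

text \<open>The germs are symmetric in the normal and point strictly inward, so their sum is a
  nonzero inward normal: c < 0, as \<epsilon> \<open>mid2 n\<close> points outward. Depending only
  on the image, it makes the sides visible to a symmetry.\<close>

lemma sum_cone_side:
  assumes x: "of_real \<epsilon> * x \<in> edge n" "of_real \<epsilon> * x \<notin> range vtx" and ne: "cone (range \<beta>) (norm d) x \<noteq> {}"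
  obtains c where "c < 0" "\<Sum>(cone (range \<beta>) (norm d) x) = of_real (\<epsilon> * c) * mid2 n"
proof -
  let ?C = "cone (range \<beta>) (norm d) x"
  define \<Sigma> where "\<Sigma> = \<Sum>?C"
  define f where "f v = - refl (2 * n) v" for v
  have ff: "f (f v) = v" for v by (simp add: f_def refl_def cnj_zeta)
  have "f ` ?C = ?C"
  proof
    show "f ` ?C \<subseteq> ?C" unfolding f_def using cone_side(2)[OF x] by auto
    show "?C \<subseteq> f ` ?C"
    proof
      fix v assume "v \<in> ?C"
      then have "f v \<in> ?C" unfolding f_def by (rule cone_side(2)[OF x])
      then show "v \<in> f ` ?C" by (intro image_eqI[of _ _ "f v"]) (simp_all add: ff)
    qed
  qed
  then have "\<Sigma> = \<Sum>(f ` ?C)" by (simp add: \<Sigma>_def)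
  also have "\<dots> = (\<Sum>v\<in>?C. f v)" by (rule sum.reindex[unfolded o_def id_def]) (metis ff inj_onI)
  also have "\<dots> = f \<Sigma>" by (simp add: f_def refl_def \<Sigma>_def sum_negf sum_distrib_left)
  finally have sym: "\<Sigma> = - zeta (2 * n) * cnj \<Sigma>" by (simp add: f_def refl_def)
  have m: "cnj (mid2 n) = - zeta (- (2 * n)) * mid2 n"
    using mid2_add[of n "- (2 * n)"] by (simp add: cnj_mid2)
  have "\<Sigma> * cnj (mid2 n) = (zeta (2 * n) * zeta (- (2 * n))) * (cnj \<Sigma> * mid2 n)"
    by (subst sym) (simp only: m mult_minus_left mult_minus_right minus_minus ac_simps)
  then have "cnj (\<Sigma> * cnj (mid2 n)) = \<Sigma> * cnj (mid2 n)" by simp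
  then have real: "\<Sigma> * cnj (mid2 n) = of_real (Re (\<Sigma> * cnj (mid2 n)))"
    by (metis complex_eq_iff complex_cnj Im_complex_of_real Re_complex_of_real complex_is_Real_iff Reals_cnj_iff)
  define \<rho> where "\<rho> = Re (\<Sigma> * cnj (mid2 n))"
  have "of_real \<epsilon> * \<Sigma> * cnj (mid2 n) = (\<Sum>v\<in>?C. of_real \<epsilon> * v * cnj (mid2 n))"
    by (simp add: \<Sigma>_def sum_distrib_left sum_distrib_right)
  then have "Re (of_real \<epsilon> * \<Sigma> * cnj (mid2 n)) = (\<Sum>v\<in>?C. Re (of_real \<epsilon> * v * cnj (mid2 n)))" by simp
  also have "\<dots> < (\<Sum>v\<in>?C. 0)"
    by (rule sum_strict_mono[OF finite_cone ne]) (rule cone_side(1)[OF x])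
  finally have "\<epsilon> * \<rho> < 0" by (simp add: \<rho>_def mult.assoc)
  have mm: "cnj (mid2 n) * mid2 n = of_real ((2 * apo)\<^sup>2)"
    using complex_norm_square[of "mid2 n"] by (simp add: norm_mid2 mult.commute)
  have a: "(2 * apo)\<^sup>2 > 0" using apo_pos by simp
  have "\<Sigma> * (cnj (mid2 n) * mid2 n) = of_real \<rho> * mid2 n" using real by (simp add: \<rho>_def mult.assoc[symmetric])
  then have "\<Sigma> * of_real ((2 * apo)\<^sup>2) = of_real \<rho> * mid2 n" unfolding mm .
  then have "\<Sigma> = of_real (\<rho> / (2 * apo)\<^sup>2) * mid2 n"
    using a by (simp add: field_simps del: of_real_power)
  moreover have "\<rho> / (2 * apo)\<^sup>2 = \<epsilon> * (\<epsilon> * \<rho> / (2 * apo)\<^sup>2)" using \<epsilon> by auto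
  ultimately have "\<Sigma> = of_real (\<epsilon> * (\<epsilon> * \<rho> / (2 * apo)\<^sup>2)) * mid2 n" by (simp only:)
  moreover have "\<epsilon> * \<rho> / (2 * apo)\<^sup>2 < 0" using \<open>\<epsilon> * \<rho> < 0\<close> a by (rule divide_neg_pos)
  ultimately show thesis by (intro that[of "\<epsilon> * \<rho> / (2 * apo)\<^sup>2"]) (simp_all only: \<Sigma>_def)
qed

text \<open>A path that avoids all sides never changes its copy, so it would be a full straight line
  inside a bounded polygon.\<close>

lemma hits_side: obtains t n where "of_real \<epsilon> * \<beta> t \<in> edge n"
proof (rule ccontr)
  assume "\<not> thesis"
  then have inner: "of_real \<epsilon> * \<beta> t \<notin> edge n" for t n using that by blast
  obtain g w where "tangent 0 1 g w" using tangent_exists[of 1 0] by blast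
  then have g: "(g, g (\<beta> 0)) \<in> \<eta> 0" using tangentD by blast
  define y0 where "y0 = g (\<beta> 0)"
  define P where "P t \<longleftrightarrow> (g, y0 + of_real t * d) \<in> \<eta> t" for t
  have one_side: "\<exists>\<delta>>0. \<forall>s\<in>{0..\<delta>}. P (t + \<sigma> * s) = P t" if \<sigma>: "\<sigma> = 1 \<or> \<sigma> = - 1" for t \<sigma>
  proof -
    obtain \<delta> l y where *: "\<delta> > 0"
      "\<And>s. 0 \<le> s \<Longrightarrow> s \<le> \<delta> \<Longrightarrow> \<eta> (t + \<sigma> * s) = surface_pt (necklace p) (l, y + of_real s * (of_real \<sigma> * d))"
      using straight_trajectoryD_dir[OF st \<sigma>, of t] by metis
    have P_iff: "P (t + \<sigma> * s) \<longleftrightarrow> g = l \<and> y0 + of_real t * d = y" if s: "0 \<le> s" "s \<le> \<delta>" for s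
    proof -
      have mem: "(l, y + of_real s * (of_real \<sigma> * d)) \<in> \<eta> (t + \<sigma> * s)" using *(2)[OF s] by simp
      have eq: "y0 + of_real (t + \<sigma> * s) * d = y0 + of_real t * d + of_real s * (of_real \<sigma> * d)"
        by (simp add: algebra_simps)
      show ?thesis
      proof
        assume "P (t + \<sigma> * s)"
        then have mem': "(g, y0 + of_real (t + \<sigma> * s) * d) \<in> \<eta> (t + \<sigma> * s)" by (simp add: P_def)
        note e1 = mem_beta[OF mem] and e2 = mem_beta[OF mem']
        have "g = l" using two_labels[of l "\<beta> (t + \<sigma> * s)" "t + \<sigma> * s" g] mem mem' e1 e2 inner by metis
        then show "g = l \<and> y0 + of_real t * d = y" using e1 e2 unfolding eq by (metis add_right_cancel)
      next
        assume "g = l \<and> y0 + of_real t * d = y"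
        then show "P (t + \<sigma> * s)" unfolding P_def eq using mem by simp
      qed
    qed
    have "P (t + \<sigma> * s) = P (t + \<sigma> * 0)" if "0 \<le> s" "s \<le> \<delta>" for s
      unfolding P_iff[OF that] P_iff[OF order_refl less_imp_le[OF *(1)]] ..
    then show ?thesis using *(1) by (intro exI[of _ \<delta>]) auto
  qed
  have "P 0 = P t" for t
    by (rule const_on_reals) (use one_side[of 1] one_side[of "- 1"] in auto)
  moreover have "P 0" using g by (simp add: P_def y0_def)
  ultimately have "(g, y0 + of_real t * d) \<in> \<eta> t" for t by (simp add: P_def)
  then have "of_real (nk_sign g) * (y0 + of_real t * d) \<in> pent" for t
    using nk.trajectory_regular(1)[OF st] by (fastforce simp: nk.regular_def)
  moreover obtain B where B: "\<And>z. z \<in> pent \<Longrightarrow> norm z \<le> B" using bounded_pent by (auto simp: bounded_iff)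
  ultimately have "norm (of_real (nk_sign g) * (y0 + of_real t * d)) \<le> B" for t by blast
  then have bd: "norm (y0 + of_real t * d) \<le> B" for t using nk_sign_cases[of g] by (auto simp: norm_mult)
  define t where "t = (B + norm y0 + 1) / norm d"
  have "B \<ge> 0" using bd[of 0] norm_ge_zero order_trans by blast
  then have "t \<ge> 0" unfolding t_def by (intro divide_nonneg_nonneg) auto
  then have "norm (of_real t * d) = t * norm d" by (simp add: norm_mult)
  also have "\<dots> = B + norm y0 + 1" using d_nonzero by (simp add: t_def)
  finally have "norm (of_real t * d) = B + norm y0 + 1" .
  moreover have "norm (of_real t * d) \<le> norm (y0 + of_real t * d) + norm y0"
    using norm_triangle_ineq4[of "y0 + of_real t * d" y0] by simp
  ultimately show False using bd[of t] by simp
qed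

text \<open>The sum of the germs rotates with the image. Nonzero on the sides and zero inside, it
  shows that a point on a side goes to a point on a side; comparing the two normals gives the
  angle.\<close>

lemma rotation_angle:
  assumes "(\<lambda>z. cis \<theta> * z) ` range \<beta> = range \<beta>"
  obtains m where "cis \<theta> = zeta m"
proof -
  obtain t n where n: "of_real \<epsilon> * \<beta> t \<in> edge n" by (rule hits_side)
  have reg: "of_real \<epsilon> * \<beta> t \<notin> range vtx" using beta_regular by blast
  let ?C = "cone (range \<beta>) (norm d)"
  obtain g w where "tangent t 1 g w" using tangent_exists[of 1 t] by blast
  then have ne: "?C (\<beta> t) \<noteq> {}" using tangent_cone[of 1 t g w] by auto
  obtain c where c: "c < 0" "\<Sum>(?C (\<beta> t)) = of_real (\<epsilon> * c) * mid2 n"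
    by (rule sum_cone_side[OF n reg ne])
  have rot: "?C (cis \<theta> * \<beta> t) = (\<lambda>w. cis \<theta> * w) ` ?C (\<beta> t)" by (rule cone_rotate[OF assms]) simp
  have inj: "inj_on (\<lambda>w. cis \<theta> * w) (?C (\<beta> t))" by (simp add: inj_on_def)
  have sum: "\<Sum>(?C (cis \<theta> * \<beta> t)) = cis \<theta> * \<Sum>(?C (\<beta> t))"
    unfolding rot sum.reindex[OF inj] by (simp add: sum_distrib_left)
  have nz: "\<Sum>(?C (\<beta> t)) \<noteq> 0" using c \<epsilon> by auto
  obtain t' where t': "cis \<theta> * \<beta> t = \<beta> t'" using assms by blast
  have "\<exists>n'. of_real \<epsilon> * \<beta> t' \<in> edge n'"
  proof (rule ccontr)
    assume "\<not> ?thesis"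
    then have "\<Sum>(?C (\<beta> t')) = 0" using sum_cone_interior[of "\<beta> t'"] by blast
    then show False using sum nz t' by simp
  qed
  then obtain n' where n': "of_real \<epsilon> * \<beta> t' \<in> edge n'" by blast
  have reg': "of_real \<epsilon> * \<beta> t' \<notin> range vtx" using beta_regular by blast
  have ne': "?C (\<beta> t') \<noteq> {}" using rot ne t' by simp
  obtain c' where c': "c' < 0" "\<Sum>(?C (\<beta> t')) = of_real (\<epsilon> * c') * mid2 n'"
    by (rule sum_cone_side[OF n' reg' ne'])
  have eq: "of_real (\<epsilon> * c') * mid2 n' = cis \<theta> * (of_real (\<epsilon> * c) * mid2 n)"
    using sum c(2) c'(2) t' by simp
  then have "norm (of_real (\<epsilon> * c') * mid2 n') = norm (cis \<theta> * (of_real (\<epsilon> * c) * mid2 n))" by (rule arg_cong)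
  then have "\<bar>\<epsilon> * c'\<bar> * (2 * apo) = \<bar>\<epsilon> * c\<bar> * (2 * apo)"
    by (simp only: norm_mult norm_cis norm_of_real norm_mid2 mult_1)
  then have "\<bar>\<epsilon> * c'\<bar> = \<bar>\<epsilon> * c\<bar>" using apo_pos by simp
  then have "c' = c" using c(1) c'(1) \<epsilon> by (auto simp: abs_mult)
  then have "of_real (\<epsilon> * c) * mid2 n' = of_real (\<epsilon> * c) * (cis \<theta> * mid2 n)" using eq by (simp add: ac_simps)
  moreover have "of_real (\<epsilon> * c) \<noteq> (0::complex)" using c(1) \<epsilon> by auto
  ultimately have "mid2 n' = cis \<theta> * mid2 n" using mult_left_cancel by blast
  moreover have "mid2 n' = zeta (n' - n) * mid2 n" using mid2_add[of n "n' - n"] by simp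
  ultimately have "cis \<theta> = zeta (n' - n)" by simp
  then show thesis by (rule that)
qed

lemma edge_not_0: "0 \<notin> edge n"
proof
  assume "0 \<in> edge n"
  moreover from this have "0 \<in> pent" using edge_subset_pent by blast
  ultimately have "Re (0 * cnj (mid2 n)) = 2 * apo\<^sup>2" using pent_halfplane(2)[of 0 n] by blast
  then show False using apo_pos by simp
qed

text \<open>
  A rotation of the trajectory that traverses it backwards comes from an involution of the necklace,
  and would have to fix the point reached after half the time; but only the center is fixed.
\<close>

lemma no_reversal:
  assumes m: "\<not> 5 dvd m" and tg: "tangent 0 1 g w" and t': "\<beta> t' = zeta m * \<beta> 0"
    and tg': "tangent t' (- 1) g' w'" "zeta m * w = - w'"
  shows False
proof -
  have gD: "g \<in> dihedral p" "g' \<in> dihedral p" using tangentD(1)[OF tg] tangentD(1)[OF tg'(1)] .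
  obtain gi where gi: "gi \<in> dihedral p" "\<And>z. gi (g z) = z" "\<And>z. g (gi z) = z" using dihedral_inverse[OF gD(1)] by metis
  \<comment> \<open>Chosen so that h composed with g is g' composed with \<open>rot m\<close>. The
    automorphism given by h and - m then carries the lift at time 0 to its point at time t' and
    turns d into - d.\<close>
  define h where "h = g' \<circ> rot m \<circ> gi"
  have hD: "h \<in> dihedral p" unfolding h_def using gD gi by (intro dihedral_comp) simp_all
  have hg: "h (g z) = g' (zeta m * z)" for z by (simp add: h_def gi rot_def)
  have neg: "g' (- z) = - g' z" for z using dihedral_linear(2)[OF gD(2), of "- 1" z] by simp
  have "h d = g' (- w')" using hg[of w] tangentD(2)[OF tg] tg'(2) by simp
  then have hd: "h d = - d" using neg tangentD(2)[OF tg'(1)] by simp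
  define \<eta>' where "\<eta>' t = map_prod (\<lambda>g. h \<circ> g \<circ> rot (- m)) h ` \<eta> t" for t
  have "straight_trajectory (necklace p) (- d) \<eta>'"
    using nk_automorphism(1)[OF st hD, of "- m"] unfolding \<eta>'_def hd .
  then have "straight_trajectory (necklace p) (- (- d)) (\<lambda>t. \<eta>' (- t))" by (rule straight_trajectory_reverse)
  then have st': "straight_trajectory (necklace p) d (\<lambda>t. \<eta>' (- (t + - t')))"
    using straight_trajectory_shift[of "necklace p" d "\<lambda>t. \<eta>' (- t)" "- t'"] by simp
  have mem: "(h \<circ> g1 \<circ> rot (- m), h y) \<in> \<eta>' t" if "(g1, y) \<in> \<eta> t" for g1 y t
    unfolding \<eta>'_def using that by (intro image_eqI[of _ _ "(g1, y)"]) simp_all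
  have "(h \<circ> g \<circ> rot (- m), h (g (\<beta> 0))) \<in> \<eta>' (- (t' + - t'))" using mem[OF tangentD(3)[OF tg]] by simp
  moreover have "h \<circ> g \<circ> rot (- m) = g'" by (simp add: fun_eq_iff hg) (simp add: rot_def)
  moreover have "h (g (\<beta> 0)) = g' (\<beta> t')" by (simp add: hg t')
  ultimately have "(g', g' (\<beta> t')) \<in> \<eta>' (- (t' + - t'))" by simp
  then have "\<eta>' (- (t' + - t')) = \<eta> t'"
    using nk.trajectory_regular(2)[OF st' , of g' "g' (\<beta> t')" t'] nk.trajectory_regular(2)[OF st tangentD(3)[OF tg'(1)]] by simp
  then have "(\<lambda>t. \<eta>' (- (t + - t'))) = \<eta>" using nk.trajectory_unique[OF st' st, of t'] by simp
  then have eta: "\<eta> t = \<eta>' (t' - t)" for t by (metis add.commute minus_add_distrib minus_minus uminus_add_conv_diff)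
  have rel: "\<beta> t = zeta m * \<beta> (t' - t)" for t
  proof -
    obtain g1 w1 where "tangent (t' - t) 1 g1 w1" using tangent_exists[of 1 "t' - t"] by blast
    then have g1: "(g1, g1 (\<beta> (t' - t))) \<in> \<eta> (t' - t)" using tangentD by blast
    have "h (g1 (\<beta> (t' - t))) = (h \<circ> g1 \<circ> rot (- m)) (zeta m * \<beta> (t' - t))" by (simp add: rot_def)
    then have "(h \<circ> g1 \<circ> rot (- m), (h \<circ> g1 \<circ> rot (- m)) (zeta m * \<beta> (t' - t))) \<in> \<eta> t"
      using mem[OF g1] eta by metis
    then show ?thesis by (rule beta_in)
  qed
  \<comment> \<open>Half the time is fixed by t -> t' - t, so the point reached there is fixed by a
    nontrivial rotation and is the center.\<close>
  define s0 where "s0 = t' / 2"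
  have "\<beta> s0 = zeta m * \<beta> s0" using rel[of s0] by (simp add: s0_def)
  moreover have "zeta m \<noteq> 1" using m by (simp add: zeta_eq_1_iff)
  ultimately have b0: "\<beta> s0 = 0" by simp
  obtain g1 w1 where t1: "tangent s0 1 g1 w1" using tangent_exists[of 1 s0] by blast
  obtain g2 w2 where t2: "tangent s0 (- 1) g2 w2" using tangent_exists[of "- 1" s0] by blast
  have "g2 = g1" using two_labels[OF tangentD(3)[OF t1] tangentD(3)[OF t2]] b0 edge_not_0 by auto
  then have w: "w2 = w1" using tangentD(1,2)[OF t1] tangentD(2)[OF t2] dihedral_linear(4) by metis
  obtain \<delta>1 where \<delta>1: "\<delta>1 > 0" "\<And>s. 0 \<le> s \<Longrightarrow> s \<le> \<delta>1 \<Longrightarrow> \<beta> (s0 + 1 * s) = \<beta> s0 + of_real (1 * s) * w1"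
    using tangentD(5)[OF t1] by blast
  obtain \<delta>2 where \<delta>2: "\<delta>2 > 0" "\<And>s. 0 \<le> s \<Longrightarrow> s \<le> \<delta>2 \<Longrightarrow> \<beta> (s0 + - 1 * s) = \<beta> s0 + of_real (- 1 * s) * w2"
    using tangentD(5)[OF t2] by blast
  define s where "s = min \<delta>1 \<delta>2"
  have s: "0 < s" "s \<le> \<delta>1" "s \<le> \<delta>2" using \<delta>1(1) \<delta>2(1) by (auto simp: s_def)
  \<comment> \<open>Near the center the path is straight with one velocity on both sides of s0,
    which forces zeta^m = -1.\<close>
  have "\<beta> (s0 + s) = zeta m * \<beta> (s0 - s)" using rel[of "s0 + s"] by (simp add: s0_def)
  then have "of_real s * w1 = zeta m * (- of_real s * w1)"
    using \<delta>1(2)[of s] \<delta>2(2)[of s] s b0 w by simp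
  then have "of_real s * w1 = (- zeta m) * (of_real s * w1)" by simp
  moreover have "of_real s * w1 \<noteq> 0" using s(1) tangentD(4)[OF t1] d_nonzero by auto
  ultimately have "- zeta m = 1" by (metis mult_cancel_right1)
  then have "zeta m = - zeta 0" by (simp add: minus_equation_iff[of "zeta m"])
  then show False using zeta_neq_minus by blast
qed

lemma not_symmetric: "\<not> rotationally_symmetric (range \<beta>)"
proof
  assume "rotationally_symmetric (range \<beta>)"
  then obtain \<theta> where \<theta>: "cis \<theta> \<noteq> 1" "(\<lambda>z. cis \<theta> * z) ` range \<beta> = range \<beta>"
    unfolding rotationally_symmetric_def rotation_invariant_def by blast
  obtain m where m: "cis \<theta> = zeta m" by (rule rotation_angle[OF \<theta>(2)])
  have m5: "\<not> 5 dvd m" using \<theta>(1) m zeta_eq_1_iff by simp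
  obtain g w where tg: "tangent 0 1 g w" using tangent_exists[of 1 0] by blast
  have "w \<in> cone (range \<beta>) (norm d) (\<beta> 0)" using tangent_cone[OF _ tg] by simp
  then have "zeta m * w \<in> cone (range \<beta>) (norm d) (zeta m * \<beta> 0)"
    using cone_rotate[OF \<theta>(2)] unfolding m by simp
  then obtain t' \<sigma> g' w' where \<sigma>: "\<sigma> = 1 \<or> \<sigma> = - 1" and t': "\<beta> t' = zeta m * \<beta> 0"
    and tg': "tangent t' \<sigma> g' w'" "zeta m * w = of_real \<sigma> * w'" using cone_tangent by metis
  from \<sigma> show False
  proof
    \<comment> \<open>Traversed forwards, the rotated germ lies over the same position with the
      label g composed with \<open>rot (- m)\<close>, so the trajectory has the holonomy -
      m.\<close>
    assume "\<sigma> = 1"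
    then have "zeta m * w = w'" using tg' by simp
    then have "(g' \<circ> rot m) w = d" using tangentD(2)[OF tg'(1)] by (simp add: rot_def)
    then have "g' \<circ> rot m = g"
      using same_velocity[OF tangentD(1)[OF tg] _ tangentD(2)[OF tg]] dihedral_comp[OF tangentD(1)[OF tg'(1)] rot_in_dihedral]
      by blast
    then have "g' = g \<circ> rot (- m)"
    proof -
      have "g' = (g' \<circ> rot m) \<circ> rot (- m)" by (simp add: rot_def fun_eq_iff)
      then show ?thesis unfolding \<open>g' \<circ> rot m = g\<close> .
    qed
    moreover have "g' (\<beta> t') = g (\<beta> 0)" using \<open>g' \<circ> rot m = g\<close> t' by (auto simp: rot_def)
    ultimately have "(g \<circ> rot (- m), g (\<beta> 0)) \<in> \<eta> t'" using tangentD(3)[OF tg'(1)] by metis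
    then have "5 dvd - m" using no_holonomy[OF tangentD(3)[OF tg]] by blast
    then show False using m5 by simp
  next
    assume "\<sigma> = - 1"
    then have "tangent t' (- 1) g' w'" "zeta m * w = - w'" using tg' by simp_all
    then show False by (rule no_reversal[OF m5 tg t'])
  qed
qed

end

section \<open>Tree directions and the conclusion\<close>

text \<open>The columns of \<open>P_matrix\<close> are 1 and \<open>omega\<close>.\<close>

lemma tree_direction_eq: "tree_direction ks = cpl (tree_vector ks $ 1) (tree_vector ks $ 2)"
  by (simp add: tree_direction_def P_matrix_def matrix_vector_mult_def sum_2 cpl_def complex_eq_iff
      omega_eq cos_pi_5 mult.commute)

text \<open>The axes of the reflections have arguments that are multiples of pi/5, and a positive
  combination of 1 and \<open>omega\<close> lies strictly between two neighboring ones.\<close>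

lemma tree_direction_generic:
  assumes x: "x > 0" and y: "y > 0" shows "refl b (cpl x y) \<noteq> cpl x y"
proof
  assume *: "refl b (cpl x y) = cpl x y"
  \<comment> \<open>For n = 2 b we have - 2 n = b modulo 5, so multiplication by zeta^n takes the
    axis of \<open>refl b\<close> to the real line.\<close>
  define n where "n = 2 * b"
  have b: "zeta b = zeta (- 2 * n)"
  proof -
    have "(b - - 2 * n) = 5 * b" by (simp add: n_def)
    then have "5 dvd b - - 2 * n" by (metis dvd_triv_left)
    then show ?thesis by (simp only: zeta_eq_iff mod_eq_dvd_iff)
  qed
  have "zeta n * cpl x y = zeta n * (zeta (- 2 * n) * cnj (cpl x y))" using * by (simp add: refl_def b)
  also have "\<dots> = zeta (n + - 2 * n) * cnj (cpl x y)" unfolding zeta_add by simp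
  also have "\<dots> = cnj (zeta n * cpl x y)" by (simp add: cnj_zeta)
  finally have "Im (zeta n * cpl x y) = Im (cnj (zeta n * cpl x y))" by simp
  then have "Im (zeta n * cpl x y) = 0" by simp
  then have 0: "Im (zeta (n mod 5) * cpl x y) = 0" by (simp only: zeta_mod)
  have om: "omega * zeta 1 = - zeta 4" "omega * zeta 2 = - 1" "omega * zeta 3 = - zeta 1" "omega * zeta 4 = - zeta 2"
    using omega_zeta[of 1] omega_zeta[of 2] omega_zeta[of 3] omega_zeta[of 4] zeta_mod[of 5] zeta_mod[of 6] zeta_mod[of 7] by simp_all
  have ex: "zeta i * cpl x y = of_real x * zeta i + of_real y * (omega * zeta i)" for i
    by (simp add: cpl_def algebra_simps)
  have pos: "x * sn > 0" "y * sn > 0" "x * (golden * sn) > 0" "y * (golden * sn) > 0"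
    using x y sn_pos golden_gt_1 by simp_all
  have Im_om: "Im omega = sn" by (simp add: omega_eq)
  then have Im_cpl: "Im (cpl x y) = y * sn" by (simp add: cpl_def)
  show False
    using 0 pos by (cases n rule: mod5_cases) (auto simp: ex om Im_zeta Im_om Im_cpl)
qed

context table_form
begin

text \<open>The time t' - t is arbitrary here, not known to be 1 or phi. The holonomy relation puts
  both coordinates of (t' - t) v into Z[phi], hence t' - t as well, by Bezout; so (t' - t) v lies in
  the ideal along with v.\<close>

lemma holonomy_dvd:
  assumes ks: "tree_word ks" "end_node ks = NF"
    and st: "straight_trajectory (necklace p) (tree_direction ks) \<eta>"
    and g: "(g, y) \<in> \<eta> t" "(g \<circ> rot m, y) \<in> \<eta> t'"
  shows "5 dvd m"
proof -
  define v1 v2 where "v1 = tree_vector ks $ 1" and "v2 = tree_vector ks $ 2"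
  have v: "v1 \<in> gold_ints" "v2 \<in> gold_ints"
    using tree_vector_gold_vec[OF ks(1)] by (simp_all add: gold_vec_def v1_def v2_def)
  have d: "tree_direction ks = cpl v1 v2" by (simp add: tree_direction_eq v1_def v2_def)
  have res: "5 dvd gold_res v1 - gold_res v2" using end_node_NF_iff[OF ks(1)] ks(2) by (simp add: v1_def v2_def)
  obtain a b where ab: "a \<in> gold_ints" "b \<in> gold_ints" "a * v1 + b * v2 = 1"
    using tree_vector_bezout[OF ks(1)] unfolding v1_def v2_def by blast
  define \<tau> where "\<tau> = t' - t"
  have hol: "of_real \<tau> * cpl v1 v2 - of_int (3 * \<epsilon>i * m) \<in> ideal5"
    using holonomy[OF st g] unfolding \<tau>_def d .
  then obtain X Y where XY: "of_real \<tau> * cpl v1 v2 - of_int (3 * \<epsilon>i * m) = cpl X Y" "X \<in> gold_ints" "Y \<in> gold_ints"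
    unfolding ideal5_def by blast
  have "cpl (\<tau> * v1) (\<tau> * v2) = cpl (X + of_int (3 * \<epsilon>i * m)) Y"
    using XY(1) unfolding cpl_scale by (simp add: cpl_def algebra_simps)
  then have "\<tau> * v1 = X + of_int (3 * \<epsilon>i * m)" "\<tau> * v2 = Y" by (simp_all only: cpl_eq_iff)
  then have "\<tau> * v1 \<in> gold_ints" "\<tau> * v2 \<in> gold_ints"
    using XY(2,3) gold_ints_add[OF XY(2) gold_ints_of_int] by (simp_all only:)
  moreover have "\<tau> = a * (\<tau> * v1) + b * (\<tau> * v2)"
  proof -
    have "a * (\<tau> * v1) + b * (\<tau> * v2) = \<tau> * (a * v1 + b * v2)" by (simp add: algebra_simps)
    then show ?thesis using ab(3) by simp
  qed
  ultimately have "\<tau> \<in> gold_ints" using ab(1,2) gold_ints_add gold_ints_mult by metis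
  then have "of_real \<tau> * cpl v1 v2 \<in> ideal5" using scale_in_ideal5_iff[OF v] res by simp
  from ideal5_diff[OF this hol] have "of_int (3 * \<epsilon>i * m) \<in> ideal5" by simp
  then have "5 dvd 3 * \<epsilon>i * m" by (simp only: of_int_in_ideal5_iff)
  then have "5 dvd 3 * m" using \<epsilon>i(2) by auto
  then show "5 dvd m" using dvd5_iff[of "3 * m" 3 m 0] by simp
qed

text \<open>The trajectory closes after time 1 or phi, with residue 1 or 3 prime to 5. So if 5 does
  not divide the residue of v_1 - v_2, the holonomy m over this time is nonzero.\<close>

lemma periodic_symmetric:
  assumes ks: "tree_word ks" "end_node ks \<noteq> NF"
    and st: "straight_trajectory (double_pentagon p) (tree_direction ks) \<gamma>"
      "straight_trajectory (necklace p) (tree_direction ks) \<eta>"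
    and lift: "is_lift p \<eta> \<gamma>"
  shows "order5_symmetric (range (folding_map \<circ> \<eta>))"
proof -
  define v1 v2 where "v1 = tree_vector ks $ 1" and "v2 = tree_vector ks $ 2"
  have v: "v1 \<in> gold_ints" "v2 \<in> gold_ints"
    using tree_vector_gold_vec[OF ks(1)] by (simp_all add: gold_vec_def v1_def v2_def)
  have d: "tree_direction ks = cpl v1 v2" by (simp add: tree_direction_eq v1_def v2_def)
  have res: "\<not> 5 dvd gold_res v1 - gold_res v2" using end_node_NF_iff[OF ks(1)] ks(2) by (simp add: v1_def v2_def)
  have "dp.closed_direction (tree_direction ks)"
    using dp.closed_direction_tree[OF ks(1)] by (simp add: tree_direction_eq)
  then have "(\<forall>t. \<gamma> (t + 1) = \<gamma> t) \<or> (\<forall>t. \<gamma> (t + golden) = \<gamma> t)"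
    using st(1) unfolding dp.closed_direction_def by blast
  then obtain T where T: "T = 1 \<or> T = golden" "\<gamma> (0 + T) = \<gamma> 0" by blast
  obtain g y where g: "(g, y) \<in> \<eta> 0"
    using straight_trajectoryD_dir[OF st(2), of 1 0] by (metis surface_pt_self)
  obtain m where m: "(g \<circ> rot m, y) \<in> \<eta> T" using fiber[OF st lift T(2) g] by auto
  have hol: "of_real T * cpl v1 v2 - of_int (3 * \<epsilon>i * m) \<in> ideal5"
    using holonomy[OF st(2) g m] by (simp add: d)
  have "\<not> 5 dvd m"
  proof
    assume "5 dvd m"
    then have "of_int (3 * \<epsilon>i * m) \<in> ideal5" by (simp only: of_int_in_ideal5_iff dvd_mult)
    from ideal5_add[OF hol this] have "of_real T * cpl v1 v2 \<in> ideal5" by simp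
    moreover have "T \<in> gold_ints" using T(1) by auto
    ultimately have "5 dvd gold_res T * (gold_res v1 - gold_res v2)" using scale_in_ideal5_iff[OF v] by blast
    then have "5 dvd gold_res v1 - gold_res v2"
      using T(1) dvd5_iff[of "3 * (gold_res v1 - gold_res v2)" 3 "gold_res v1 - gold_res v2" 0] by auto
    then show False using res by blast
  qed
  then show ?thesis
    using order5_symmetricI[of "folding_map \<circ> \<eta>" T m] deck_shift[OF st(2) g m] by simp
qed

lemma periodic_not_symmetric:
  assumes ks: "tree_word ks" "end_node ks = NF"
    and st: "straight_trajectory (double_pentagon p) (tree_direction ks) \<gamma>"
      "straight_trajectory (necklace p) (tree_direction ks) \<eta>"
    and per: "periodic_curve \<gamma>" and lift: "is_lift p \<eta> \<gamma>"
  shows "\<not> rotationally_symmetric (range (folding_map \<circ> \<eta>))"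
proof -
  \<comment> \<open>The horizontal direction is fixed by a reflection, but the empty word ends in
    \<open>NA\<close>; all other tree vectors have positive coordinates.\<close>
  have "ks \<noteq> []"
  proof
    assume "ks = []"
    then show False using end_node_NF_iff[OF ks(1)] ks(2) by (simp add: tree_vector_def)
  qed
  then have generic: "refl b (tree_direction ks) \<noteq> tree_direction ks" for b
    unfolding tree_direction_eq using tree_direction_generic tree_vector_pos[OF ks(1)] by blast
  obtain T where T: "T > 0" "\<And>t. \<gamma> (t + T) = \<gamma> t" using per unfolding periodic_curve_def by blast
  obtain g y where g: "(g, y) \<in> \<eta> 0"
    using straight_trajectoryD_dir[OF st(2), of 1 0] by (metis surface_pt_self)
  have "\<gamma> T = \<gamma> 0" using T(2)[of 0] by simp
  then obtain m where m: "(g \<circ> rot m, y) \<in> \<eta> T" using fiber[OF st lift _ g] by blast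
  have "5 dvd m" by (rule holonomy_dvd[OF ks st(2) g m])
  then have "zeta (- m) = 1" by (simp add: zeta_eq_1_iff)
  then have "folding_map (\<eta> (t + T)) = folding_map (\<eta> t)" for t using deck_shift[OF st(2) g m] by simp
  then interpret folded_trajectory p \<epsilon> k "tree_direction ks" \<eta> "folding_map \<circ> \<eta>" T
    using st(2) generic T(1) holonomy_dvd[OF ks st(2)] by unfold_locales auto
  show ?thesis by (rule not_symmetric)
qed

end

theorem theorem3p27:
  fixes p :: "nat \<Rightarrow> complex" and ks :: "nat list" and \<beta> :: "real \<Rightarrow> complex"
  assumes "pentagon_table p"
    and "tree_word ks"
    and "periodic_billiard_trajectory p ks \<beta>"
  shows "(end_node ks \<in> {NA, NB, NC, ND, NE} \<longrightarrow> order5_symmetric (range \<beta>)) \<and>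
         (end_node ks = NF \<longrightarrow> \<not> rotationally_symmetric (range \<beta>))"
proof -
  obtain \<epsilon> k where "\<epsilon> = 1 \<or> \<epsilon> = - 1" "\<And>j. p j = of_real \<epsilon> * vtx (int j + k)"
    using pentagon_table_form[OF assms(1)] by blast
  then interpret table_form p \<epsilon> k by unfold_locales
  obtain \<gamma> \<eta> where st: "straight_trajectory (double_pentagon p) (tree_direction ks) \<gamma>"
      "straight_trajectory (necklace p) (tree_direction ks) \<eta>"
    and per: "periodic_curve \<gamma>" and lift: "is_lift p \<eta> \<gamma>" and \<beta>: "\<beta> = folding_map \<circ> \<eta>"
    using assms(3) unfolding periodic_billiard_trajectory_def by blast
  have "order5_symmetric (range \<beta>)" if "end_node ks \<in> {NA, NB, NC, ND, NE}"
    unfolding \<beta> by (rule periodic_symmetric[OF assms(2) _ st lift]) (use that in auto)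
  moreover have "\<not> rotationally_symmetric (range \<beta>)" if "end_node ks = NF"
    unfolding \<beta> by (rule periodic_not_symmetric[OF assms(2) that st per lift])
  ultimately show ?thesis by blast
qed

end
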